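(* Let $\pi\in S_\infty$. The map $\varphi$ (defined in the context) is a bijection from $\operatorname{BPD}(\pi)$ to $\operatorname{PD}(\pi)$, identified with the set of compatible sequences of $\pi$, and it is weight-preserving: for every $D\in\operatorname{BPD}(\pi)$, if $\varphi(D)=(\mathbf a,\mathbf r)$ with $\mathbf r=(r_1,\dots,r_\ell)$, then $\prod_{(i,j)\ \text{blank in } D}x_i=\prod_{k=1}^{\ell}x_{r_k}$.
   Context: Permutations and products: $S_\infty=\bigcup_{n\ge1}S_n$ is the group of bijections of $\mathbb{Z}_{>0}$ fixing all but finitely many points; $s_i=(i\ i{+}1)$; $\ell$ is Coxeter length. Grid cells are indexed in matrix notation $(\text{row},\text{column})$, rows numbered from top. Pipe dreams. A (reduced) pipe dream of $\pi$ is a tiling of $\mathbb{Z}_{>0}\times\mathbb{Z}_{>0}$ by cross tiles and elbow tiles (an elbow tile consists of two arcs, one joining its north and west edges and one joining its south and east edges), with finitely many crosses, forming pipes that enter from the north boundary and leave at the west boundary, such that the pipe entering at the top of column $i$ leaves at the west end of row $\pi(i)$, and no two pipes cross twice. $\operatorname{PD}(\pi)$ is the set of these. Totally order cells by $(i,j)<(i',j')$ iff $i<i'$, or $i=i'$ and $j>j'$. If the crosses of $D\in\operatorname{PD}(\pi)$, $\ell=\ell(\pi)$, are $(r_1,j_1)<\dots<(r_\ell,j_\ell)$, the associated pair is $(\mathbf a,\mathbf r)$ with $a_k=r_k+j_k-1$; this identifies $\operatorname{PD}(\pi)$ with the set of compatible sequences of $\pi$, i.e. pairs $\mathbf a=(a_1,\dots,a_\ell)$,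 $\mathbf r=(r_1,\dots,r_\ell)$ of integer sequences such that $\mathbf a$ is a reduced word of $\pi$, $r_1\le\dots\le r_\ell$, $r_j\le a_j$ for all $j$, and $r_j<r_{j+1}$ whenever $a_j<a_{j+1}$. The weight of $(\mathbf a,\mathbf r)$ is $\prod_k x_{r_k}$. Bumpless pipe dreams. A (reduced) bumpless pipe dream of $\pi$ is a tiling of $\mathbb{Z}_{>0}\times\mathbb{Z}_{>0}$ by six tiles: blank, cross, horizontal segment, vertical segment, r-tile (an elbow joining the south and east edges), and j-tile (an elbow joining the west and north edges), with finitely many crosses, forming pipes labeled by $\mathbb{Z}_{>0}$ such that pipe $i$ enters from the south in column $i$, moves only north and east, and exits to the east in row $\pi(i)$, and no two pipes cross twice. $\operatorname{BPD}(\pi)$ is the set of these; one draws $D$ in an $n\times n$ square when $\pi\in S_n$. A bump tile has the same two arcs as the pipe-dream elbow tile (its north–west arc is a j-turn, its south–east arc an r-turn). Droop: if a pipe $p$ has an r-turn at $(a,b)$ and $c>a$, $d>b$, drooping $p$ at $(a,b)$ into $(c,d)$ replaces the part of $p$ inside the rectangle with rows $a..c$ and columns $b..d$ that runs up column $b$ from row $c$ to row $a$ and then east along row $a$ to column $d$, by the path running east along row $c$ from column $b$ to column $d$ and then up column $d$ to row $a$, leaving the other pipes unchanged and updating tiles accordingly; undrooping is the inverse operation. The operator $\nabla$ on bumpless pipe dreams. Let $D\in\operatorname{BPD}(\pi)$, $\ell(\pi)>0$, drawn in an $n\times n$ grid. Let $r$ be the smallest row containing a blank tile; mark the rightmost blank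 tile of row $r$. Repeat: (1) if the marked blank tile is not the rightmost tile of the maximal horizontal block of contiguous blank tiles containing it, move the mark to the rightmost tile of that block; let the marked tile be $(x,y)$ and let $p$ be the pipe through $(x,y+1)$. (2) If $p\ne y+1$, let $(x',y+1)$, $x'>x$, be the j-tile of $p$ in column $y+1$. (a) For each pipe $q$ crossing $p$ at some $(z,y+1)$ with $x<z<x'$ and such that $(z,y)$ is an r-tile, let $(z',y)$ be the j-tile of $q$ in column $y$; ignoring $p$, droop $q$ at $(z,y)$ within the rectangle with corners $(x,y)$ and $(x',y+1)$, so that $(z,y+1)$ becomes an r-tile and $(z',y+1)$ a j-tile. (b) Undroop $p$ at $(x',y+1)$ into $(x,y)$, move the mark to $(x',y+1)$, and return to (1). (3) If $p=y+1$, then pipes $y$ and $y+1$ cross at some $(x',y+1)$ with $x'>x$; replace this cross by a bump tile, undroop the j-turn of this tile into $(x,y)$, and adjust the pipes between rows $x$ and $x'$ as in (2)(a); stop. Setting $a=y$ for this final step, the result $\nabla D$ lies in $\operatorname{BPD}(s_a\pi)$, and one writes $\operatorname{pop}(D)=(a,r)$. The map $\varphi$: for $D\in\operatorname{BPD}(\pi)$ with $\ell(\pi)=\ell$, $\varphi(D)=((a_1,\dots,a_\ell),(r_1,\dots,r_\ell))$ where $\operatorname{pop}(\nabla^{k-1}D)=(a_k,r_k)$ for $k=1,\dots,\ell$. *)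

theory Defs
  imports
    "HOL-Combinatorics.Permutations"
    "HOL-Library.While_Combinator"
    "HOL-Library.Poly_Mapping"
begin

section \<open>Permutations and reduced words\<close>

text \<open>Permutations of the positive integers are functions on \<^typ>\<open>nat\<close> that fix 0.\<close>

definition S_infinity :: "(nat \<Rightarrow> nat) set" where
  "S_infinity = (\<Union>n\<in>{1..}. {\<pi>. \<pi> permutes {1..n}})"

definition simple_transposition :: "nat \<Rightarrow> nat \<Rightarrow> nat" where
  "simple_transposition i = transpose i (i + 1)"

text \<open>
  Products of permutations are read from left to right: in \<open>s\<^sub>a \<pi>\<close> the factor \<open>s\<^sub>a\<close> acts first,
  i.e. \<open>s\<^sub>a \<pi>\<close> is the function \<open>\<pi> \<circ> s\<^sub>a\<close>. This is the convention under which the row reading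
  word of a pipe dream of \<open>\<pi>\<close> (pipe \<open>i\<close> leaving in row \<open>\<pi> i\<close>) is a reduced word of \<open>\<pi>\<close>, and
  under which exchanging the exits of pipes \<open>a\<close> and \<open>a + 1\<close> turns \<open>\<pi>\<close> into \<open>s\<^sub>a \<pi>\<close>.
\<close>

fun word_product :: "nat list \<Rightarrow> nat \<Rightarrow> nat" where
  "word_product [] = id"
| "word_product (a # as) = word_product as \<circ> simple_transposition a"

definition is_word_of :: "nat list \<Rightarrow> (nat \<Rightarrow> nat) \<Rightarrow> bool" where
  "is_word_of as \<pi> \<longleftrightarrow> (\<forall>a\<in>set as. 1 \<le> a) \<and> word_product as = \<pi>"

definition coxeter_length :: "(nat \<Rightarrow> nat) \<Rightarrow> nat" where
  "coxeter_length \<pi> = (LEAST l. \<exists>as. is_word_of as \<pi> \<and> length as = l)"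

definition reduced_word :: "nat list \<Rightarrow> (nat \<Rightarrow> nat) \<Rightarrow> bool" where
  "reduced_word as \<pi> \<longleftrightarrow> is_word_of as \<pi> \<and> length as = coxeter_length \<pi>"

definition compatible_sequences :: "(nat \<Rightarrow> nat) \<Rightarrow> (nat list \<times> nat list) set" where
  "compatible_sequences \<pi> = {(as, rs).
     reduced_word as \<pi> \<and> length rs = length as \<and>
     (\<forall>k<length as. 1 \<le> rs ! k \<and> rs ! k \<le> as ! k) \<and>
     (\<forall>k. Suc k < length as \<longrightarrow> rs ! k \<le> rs ! Suc k) \<and>
     (\<forall>k. Suc k < length as \<longrightarrow> as ! k < as ! Suc k \<longrightarrow> rs ! k < rs ! Suc k)}"


section \<open>Cells and edges of the grid\<close>

text \<open>
  Cells are (row, column), rows numbered from the top. The grid consists of the cells with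
  positive coordinates; tilings take a fixed default value on all other cells. A pair \<open>(c, d)\<close>
  of a cell and a direction stands for the edge through which a pipe travelling in direction
  \<open>d\<close> enters \<open>c\<close>.
\<close>

type_synonym cell = "nat \<times> nat"

datatype direction = North | East | South | West

type_synonym edge = "cell \<times> direction"

fun neighbour :: "direction \<Rightarrow> cell \<Rightarrow> cell" where
  "neighbour North (i, j) = (i - 1, j)"
| "neighbour East (i, j) = (i, j + 1)"
| "neighbour South (i, j) = (i + 1, j)"
| "neighbour West (i, j) = (i, j - 1)"

definition in_grid :: "cell \<Rightarrow> bool" where
  "in_grid c \<longleftrightarrow> 1 \<le> fst c \<and> 1 \<le> snd c"


section \<open>Pipe dreams\<close>

datatype pd_tile = PD_Cross | PD_Elbow

fun pd_turn :: "pd_tile \<Rightarrow> direction \<Rightarrow> direction option" where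
  "pd_turn PD_Cross South = Some South"
| "pd_turn PD_Cross West = Some West"
| "pd_turn PD_Elbow South = Some West"
| "pd_turn PD_Elbow West = Some South"
| "pd_turn _ _ = None"

definition pd_step :: "(cell \<Rightarrow> pd_tile) \<Rightarrow> edge \<Rightarrow> edge \<Rightarrow> bool" where
  "pd_step D e e' \<longleftrightarrow> in_grid (fst e) \<and>
     pd_turn (D (fst e)) (snd e) = Some (snd e') \<and> fst e' = neighbour (snd e') (fst e)"

definition pd_pipe :: "(cell \<Rightarrow> pd_tile) \<Rightarrow> nat \<Rightarrow> edge set" where
  "pd_pipe D p = {e. (pd_step D)\<^sup>*\<^sup>* ((1, p), South) e}"

definition pd_crossing :: "(cell \<Rightarrow> pd_tile) \<Rightarrow> nat \<Rightarrow> nat \<Rightarrow> cell \<Rightarrow> bool" where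
  "pd_crossing D p q c \<longleftrightarrow> p \<noteq> q \<and> D c = PD_Cross \<and>
     (\<exists>d. (c, d) \<in> pd_pipe D p) \<and> (\<exists>d. (c, d) \<in> pd_pipe D q)"

text \<open>Leaving the grid at the west end of row \<open>i\<close> means reaching column 0 in row \<open>i\<close>.\<close>

definition PD :: "(nat \<Rightarrow> nat) \<Rightarrow> (cell \<Rightarrow> pd_tile) set" where
  "PD \<pi> = {D.
     (\<forall>c. \<not> in_grid c \<longrightarrow> D c = PD_Elbow) \<and>
     finite {c. D c = PD_Cross} \<and>
     (\<forall>i\<ge>1. ((\<pi> i, 0), West) \<in> pd_pipe D i) \<and>
     (\<forall>p q c c'. pd_crossing D p q c \<longrightarrow> pd_crossing D p q c' \<longrightarrow> c = c')}"

fun cell_less :: "cell \<Rightarrow> cell \<Rightarrow> bool" where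
  "cell_less (i, j) (i', j') \<longleftrightarrow> i < i' \<or> (i = i' \<and> j > j')"

definition pd_crosses :: "(cell \<Rightarrow> pd_tile) \<Rightarrow> cell list" where
  "pd_crosses D = (THE cs. sorted_wrt cell_less cs \<and> set cs = {c. D c = PD_Cross})"

definition pd_sequence :: "(cell \<Rightarrow> pd_tile) \<Rightarrow> nat list \<times> nat list" where
  "pd_sequence D = (map (\<lambda>(r, j). r + j - 1) (pd_crosses D), map fst (pd_crosses D))"


section \<open>Bumpless pipe dreams\<close>

text \<open>
  \<open>RTile\<close> joins the south and east edges, \<open>JTile\<close> the west and north edges. \<open>Bump\<close> has both
  arcs; it is not allowed in a bumpless pipe dream and occurs only inside the last step of the
  operator \<open>nabla\<close>.
\<close>

datatype tile = Blank | Cross | Horizontal | Vertical | RTile | JTile | Bump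

text \<open>The direction in which a pipe leaves a tile that it enters travelling north or east.\<close>

fun turn :: "tile \<Rightarrow> direction \<Rightarrow> direction option" where
  "turn Cross North = Some North"
| "turn Cross East = Some East"
| "turn Horizontal East = Some East"
| "turn Vertical North = Some North"
| "turn RTile North = Some East"
| "turn JTile East = Some North"
| "turn Bump North = Some East"
| "turn Bump East = Some North"
| "turn _ _ = None"

definition has_south :: "tile \<Rightarrow> bool" where
  "has_south t \<longleftrightarrow> turn t North \<noteq> None"

definition has_west :: "tile \<Rightarrow> bool" where
  "has_west t \<longleftrightarrow> turn t East \<noteq> None"

definition has_north :: "tile \<Rightarrow> bool" where
  "has_north t \<longleftrightarrow> (\<exists>d. turn t d = Some North)"

definition has_east :: "tile \<Rightarrow> bool" where
  "has_east t \<longleftrightarrow> (\<exists>d. turn t d = Some East)"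

definition bpd_step :: "(cell \<Rightarrow> tile) \<Rightarrow> edge \<Rightarrow> edge \<Rightarrow> bool" where
  "bpd_step D e e' \<longleftrightarrow>
     turn (D (fst e)) (snd e) = Some (snd e') \<and> fst e' = neighbour (snd e') (fst e)"

text \<open>
  Pipe \<open>p\<close> enters from the south end of column \<open>p\<close>, which is infinitely far away: it consists of
  the edges reached from every sufficiently low edge of that column.
\<close>

definition bpd_pipe :: "(cell \<Rightarrow> tile) \<Rightarrow> nat \<Rightarrow> edge set" where
  "bpd_pipe D p = {e. \<exists>m. \<forall>i\<ge>m. (bpd_step D)\<^sup>*\<^sup>* ((i, p), North) e}"

definition passes :: "(cell \<Rightarrow> tile) \<Rightarrow> nat \<Rightarrow> cell \<Rightarrow> bool" where
  "passes D p c \<longleftrightarrow> (\<exists>d. (c, d) \<in> bpd_pipe D p)"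

definition crossing :: "(cell \<Rightarrow> tile) \<Rightarrow> nat \<Rightarrow> nat \<Rightarrow> cell \<Rightarrow> bool" where
  "crossing D p q c \<longleftrightarrow> p \<noteq> q \<and> D c = Cross \<and> passes D p c \<and> passes D q c"

text \<open>
  \<open>D\<close> can be drawn in an \<open>n \<times> n\<close> square: outside of it \<open>D\<close> agrees with the tiling of the
  identity permutation, in which pipe \<open>i\<close> turns only once, at \<open>(i, i)\<close>.
\<close>

definition drawn_in :: "nat \<Rightarrow> (cell \<Rightarrow> tile) \<Rightarrow> bool" where
  "drawn_in n D \<longleftrightarrow> (\<forall>i\<ge>1. \<forall>j\<ge>1. n < i \<or> n < j \<longrightarrow>
     D (i, j) = (if i = j then RTile else if i < j then Horizontal else Vertical))"

text \<open>
  Since \<open>D\<close> is blank outside the grid, the condition that edges of adjacent tiles match also says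
  that no pipe touches the north or west boundary. Being drawn in some finite square implies that
  there are finitely many crosses. Finiteness of the set of crosses alone would not suffice: if
  every pipe \<open>i\<close> of the identity tiling is drooped from \<open>(i, i)\<close> into \<open>(i + 1, i + 1)\<close>, the
  result has no cross and matching edges, but a blank tile at \<open>(1, 1)\<close>.
\<close>

definition BPD :: "(nat \<Rightarrow> nat) \<Rightarrow> (cell \<Rightarrow> tile) set" where
  "BPD \<pi> = {D.
     (\<forall>c. \<not> in_grid c \<longrightarrow> D c = Blank) \<and>
     (\<forall>c. D c \<noteq> Bump) \<and>
     (\<forall>i j. has_north (D (Suc i, j)) = has_south (D (i, j))) \<and>
     (\<forall>i j. has_east (D (i, j)) = has_west (D (i, Suc j))) \<and>
     (\<exists>n. drawn_in n D) \<and>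
     (\<forall>i\<ge>1. \<exists>m. \<forall>j\<ge>m. ((\<pi> i, j), East) \<in> bpd_pipe D i) \<and>
     (\<forall>p q c c'. crossing D p q c \<longrightarrow> crossing D p q c' \<longrightarrow> c = c')}"

definition blank_cells :: "(cell \<Rightarrow> tile) \<Rightarrow> cell set" where
  "blank_cells D = {c. in_grid c \<and> D c = Blank}"


section \<open>Droops\<close>

text \<open>
  The two paths from \<open>(k, j)\<close> to \<open>(i, l)\<close> along the boundary of the rectangle with north-west
  corner \<open>(i, j)\<close> and south-east corner \<open>(k, l)\<close>, as sets of edges.
\<close>

fun up_then_right :: "cell \<Rightarrow> cell \<Rightarrow> edge set" where
  "up_then_right (i, j) (k, l) =
     {((m, j), North) | m. i \<le> m \<and> m < k} \<union> {((i, m), East) | m. j < m \<and> m \<le> l}"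

fun right_then_up :: "cell \<Rightarrow> cell \<Rightarrow> edge set" where
  "right_then_up (i, j) (k, l) =
     {((k, m), East) | m. j < m \<and> m \<le> l} \<union> {((m, l), North) | m. i \<le> m \<and> m < k}"

text \<open>
  \<open>droop nw se P\<close> droops the pipe \<open>P\<close> at \<open>nw\<close> into \<open>se\<close>; \<open>undroop nw se P\<close> undroops it at \<open>se\<close>
  into \<open>nw\<close>. They act on a single pipe, so that two pipes may share edges temporarily.
\<close>

definition droop :: "cell \<Rightarrow> cell \<Rightarrow> edge set \<Rightarrow> edge set" where
  "droop nw se P = (P - up_then_right nw se) \<union> right_then_up nw se"

definition undroop :: "cell \<Rightarrow> cell \<Rightarrow> edge set \<Rightarrow> edge set" where
  "undroop nw se P = (P - right_then_up nw se) \<union> up_then_right nw se"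

text \<open>The tiling traced out by a family of pipes.\<close>

definition joins :: "(nat \<Rightarrow> edge set) \<Rightarrow> cell \<Rightarrow> direction \<Rightarrow> direction \<Rightarrow> bool" where
  "joins F c d d' \<longleftrightarrow> (\<exists>p. (c, d) \<in> F p \<and> (neighbour d' c, d') \<in> F p)"

definition tiling_of :: "(nat \<Rightarrow> edge set) \<Rightarrow> cell \<Rightarrow> tile" where
  "tiling_of F c =
     (if joins F c North North then (if joins F c East East then Cross else Vertical)
      else if joins F c East East then Horizontal
      else if joins F c North East then (if joins F c East North then Bump else RTile)
      else if joins F c East North then JTile
      else Blank)"


section \<open>The operator nabla\<close>

definition pipe_through :: "(cell \<Rightarrow> tile) \<Rightarrow> cell \<Rightarrow> nat" where
  "pipe_through D c = (THE p. passes D p c)"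

text \<open>
  Pipe \<open>p\<close> runs in column \<open>y + 1\<close> from its j-turn in row \<open>x'\<close> up to row \<open>x\<close>. The condition
  \<open>to_droop D p x y x' q z\<close> selects the pipes \<open>q\<close> that have to make room for it.
\<close>

definition to_droop ::
  "(cell \<Rightarrow> tile) \<Rightarrow> nat \<Rightarrow> nat \<Rightarrow> nat \<Rightarrow> nat \<Rightarrow> nat \<Rightarrow> nat \<Rightarrow> bool" where
  "to_droop D p x y x' q z \<longleftrightarrow>
     x < z \<and> z < x' \<and> crossing D p q (z, y + 1) \<and> D (z, y) = RTile"

text \<open>
  The simultaneous droop of these pipes \<open>q\<close> (each one ignoring \<open>p\<close>) and undroop of \<open>p\<close> at
  \<open>(x', y + 1)\<close> into \<open>(x, y)\<close>.
\<close>

definition column_move ::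
  "(cell \<Rightarrow> tile) \<Rightarrow> nat \<Rightarrow> nat \<Rightarrow> nat \<Rightarrow> nat \<Rightarrow> cell \<Rightarrow> tile" where
  "column_move D p x y x' = tiling_of (\<lambda>q.
     if q = p then undroop (x, y) (x', y + 1) (bpd_pipe D p)
     else if \<exists>z. to_droop D p x y x' q z then
       (let z = (THE z. to_droop D p x y x' q z);
            z' = (THE z'. D (z', y) = JTile \<and> passes D q (z', y))
        in droop (z, y) (z', y + 1) (bpd_pipe D q))
     else bpd_pipe D q)"

definition first_blank_row :: "(cell \<Rightarrow> tile) \<Rightarrow> nat" where
  "first_blank_row D = (LEAST r. \<exists>j. (r, j) \<in> blank_cells D)"

definition initial_mark :: "(cell \<Rightarrow> tile) \<Rightarrow> cell" where
  "initial_mark D =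
     (first_blank_row D, GREATEST j. (first_blank_row D, j) \<in> blank_cells D)"

text \<open>The loop state is the current tiling together with the marked cell.\<close>

type_synonym marked_tiling = "(cell \<Rightarrow> tile) \<times> cell"

fun slide_mark :: "marked_tiling \<Rightarrow> marked_tiling" where
  "slide_mark (D, (x, y)) =
     (D, (x, GREATEST y'. y \<le> y' \<and> (\<forall>j\<in>{y..y'}. D (x, j) = Blank)))"

fun at_last_step :: "marked_tiling \<Rightarrow> bool" where
  "at_last_step (D, (x, y)) \<longleftrightarrow> pipe_through D (x, y + 1) = y + 1"

fun move_step :: "marked_tiling \<Rightarrow> marked_tiling" where
  "move_step (D, (x, y)) =
     (let p = pipe_through D (x, y + 1);
          x' = (THE x'. x < x' \<and> D (x', y + 1) = JTile \<and> passes D p (x', y + 1))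
      in (column_move D p x y x', (x', y + 1)))"

text \<open>
  After the crossing of the pipes \<open>y\<close> and \<open>y + 1\<close> has been replaced by a bump tile, its j-turn
  belongs to pipe \<open>y\<close> of the new tiling.
\<close>

fun last_step :: "marked_tiling \<Rightarrow> cell \<Rightarrow> tile" where
  "last_step (D, (x, y)) =
     (let x' = (THE x'. x < x' \<and> crossing D y (y + 1) (x', y + 1))
      in column_move (D((x', y + 1) := Bump)) y x y x')"

definition nabla_loop :: "(cell \<Rightarrow> tile) \<Rightarrow> marked_tiling" where
  "nabla_loop D =
     while (\<lambda>s. \<not> at_last_step s) (\<lambda>s. slide_mark (move_step s))
       (slide_mark (D, initial_mark D))"

definition nabla :: "(cell \<Rightarrow> tile) \<Rightarrow> cell \<Rightarrow> tile" where
  "nabla D = last_step (nabla_loop D)"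

definition pop :: "(cell \<Rightarrow> tile) \<Rightarrow> nat \<times> nat" where
  "pop D = (snd (snd (nabla_loop D)), first_blank_row D)"

definition phi :: "(nat \<Rightarrow> nat) \<Rightarrow> (cell \<Rightarrow> tile) \<Rightarrow> nat list \<times> nat list" where
  "phi \<pi> D =
     (map (\<lambda>k. fst (pop ((nabla ^^ k) D))) [0..<coxeter_length \<pi>],
      map (\<lambda>k. snd (pop ((nabla ^^ k) D))) [0..<coxeter_length \<pi>])"


section \<open>Weights\<close>

text \<open>
  Polynomials over the integers in the variables \<open>x\<^sub>i\<close>, as finitely supported functions from
  exponent vectors to coefficients.
\<close>

type_synonym int_mpoly = "(nat \<Rightarrow>\<^sub>0 nat) \<Rightarrow>\<^sub>0 int"

definition var :: "nat \<Rightarrow> int_mpoly" where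
  "var i = Poly_Mapping.single (Poly_Mapping.single i 1) 1"

definition bpd_weight :: "(cell \<Rightarrow> tile) \<Rightarrow> int_mpoly" where
  "bpd_weight D = (\<Prod>(i, j)\<in>blank_cells D. var i)"

definition sequence_weight :: "nat list \<times> nat list \<Rightarrow> int_mpoly" where
  "sequence_weight ar = (\<Prod>r\<leftarrow>snd ar. var r)"

end

theory Submission
  imports Defs
begin

text \<open>
  Label every edge of the grid by the pipe that uses it: \<open>V i j\<close> and \<open>H i j\<close> are the labels of the
  south and the east edge of the cell \<open>(i, j)\<close>, and 0 means that the edge is not used. A bumpless
  pipe dream is the same as such a labelling with a local rule at each cell, and it is reduced iff at
  each cross the horizontal label is smaller than the vertical one.

  In these terms a column move in the columns \<open>y\<close> and \<open>y + 1\<close> exchanges \<open>V i y\<close> and \<open>V i (y + 1)\<close> for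
  \<open>x \<le> i < x'\<close>. Let \<open>C\<^sub>i\<close> be the set of columns with a used south edge in row \<open>i\<close>. Then \<open>nabla\<close>
  replaces \<open>C\<^sub>i\<close> by \<open>s\<^bsub>f(i) - 1\<^esub> C\<^sub>i\<close> for \<open>i \<ge> r\<close>, where \<open>f(r)\<close> is the column of the r-turn in row \<open>r\<close>,
  \<open>f(i + 1)\<close> is the least element of \<open>C\<^bsub>i + 1\<^esub>\<close> that is at least \<open>f(i)\<close>, and \<open>f\<close> ends in the constant
  \<open>a + 1\<close>. Conversely \<open>g = f - 1\<close> is determined by the result and \<open>a\<close>: \<open>g(i)\<close> is the greatest element
  of the new \<open>C\<^sub>i\<close> that is at most \<open>g(i + 1)\<close>. So \<open>nabla\<close> is injective, and comparing the
  path \<open>g\<close> of one step with the path \<open>f\<close> of the next step gives the compatibility condition in one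
  direction and the existence of the inverse step in the other.

  For pipe dreams, the labels at a cell are the values of a partial product of the row reading
  word, and a word is reduced iff each letter exchanges two increasing labels, i.e. iff no two labels
  are exchanged twice.
\<close>

section \<open>Words and inversions\<close>

text \<open>Reducedness is a statement about whole pipes, while a move touches only two columns. In
  labels it is a condition on single cells, and every pair of labels that cross after a move already
  crossed before it; so reducedness survives a move without retracing any pipe. Only the last step
  of \<open>nabla\<close> changes the permutation: replacing the cross by a bump amounts to
  exchanging the labels \<open>y\<close> and \<open>y + 1\<close> on the part of the grid beyond it,
  and what remains is an ordinary move that removes the bump. The sets \<open>C\<^sub>i\<close>
  determine a reduced tiling because a cell with all four edges used must be a cross, so steps can
  be compared and inverted on these sets alone. In the inverse step, the choice of a greatest
  element could run into an empty set. A lower path prevents this: the path of the next step if that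
  step starts in the same row, otherwise a constant path. The compatibility condition is just what
  keeps this lower path from exceeding \<open>a\<close>.\<close>

definition inversions :: "(nat \<Rightarrow> nat) \<Rightarrow> (nat \<times> nat) set" where
  "inversions \<pi> = {(i, j). i < j \<and> \<pi> j < \<pi> i}"

lemma S_infinityI: "\<pi> permutes {1..n} \<Longrightarrow> \<pi> \<in> S_infinity"
proof -
  assume "\<pi> permutes {1..n}"
  then have "\<pi> permutes {1..Suc n}" by (rule permutes_subset) auto
  then show ?thesis unfolding S_infinity_def by (intro UN_I[of "Suc n"]) auto
qed

lemma S_infinityE:
  assumes "\<pi> \<in> S_infinity"
  obtains n where "\<pi> permutes {1..n}"
  using assms unfolding S_infinity_def by auto

lemma S_infinity_bij: "\<pi> \<in> S_infinity \<Longrightarrow> bij \<pi>"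
  by (metis S_infinityE permutes_bij)

lemma S_infinity_0: "\<pi> \<in> S_infinity \<Longrightarrow> \<pi> 0 = 0"
  by (metis S_infinityE permutes_not_in atLeastAtMost_iff not_one_le_zero)

lemma S_infinity_eq_0_iff: "\<pi> \<in> S_infinity \<Longrightarrow> \<pi> i = 0 \<longleftrightarrow> i = 0"
  by (metis S_infinity_0 S_infinity_bij bij_pointE)

lemma S_infinity_compose:
  assumes "\<pi> \<in> S_infinity" "\<rho> \<in> S_infinity" shows "\<pi> \<circ> \<rho> \<in> S_infinity"
proof -
  obtain m n where "\<pi> permutes {1..m}" "\<rho> permutes {1..n}" using assms by (metis S_infinityE)
  then have "\<pi> permutes {1..max m n}" "\<rho> permutes {1..max m n}"
    by (meson atLeastatMost_subset_iff max.cobounded1 max.cobounded2 order_refl permutes_subset)+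
  then show ?thesis by (blast intro: S_infinityI permutes_compose)
qed

lemma simple_transposition_S_infinity: "1 \<le> a \<Longrightarrow> simple_transposition a \<in> S_infinity"
  unfolding simple_transposition_def
  by (rule S_infinityI[of _ "a + 1"], rule permutes_swap_id) auto

lemma simple_transposition_involution [simp]:
  "simple_transposition a \<circ> simple_transposition a = id"
  unfolding simple_transposition_def by (rule transpose_comp_involutory)

lemma word_product_append:
  "word_product (as @ bs) = word_product bs \<circ> word_product as"
  by (induction as) (auto simp: comp_assoc)

lemma word_product_S_infinity: "\<forall>a\<in>set as. 1 \<le> a \<Longrightarrow> word_product as \<in> S_infinity"
proof (induction as)
  case Nil
  then show ?case using S_infinityI[OF permutes_id] by (metis word_product.simps(1))
next
  case (Cons a as)
  then show ?case
    unfolding word_product.simps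
    by (intro S_infinity_compose simple_transposition_S_infinity) auto
qed

lemma finite_inversions: "\<pi> \<in> S_infinity \<Longrightarrow> finite (inversions \<pi>)"
proof -
  assume "\<pi> \<in> S_infinity"
  then obtain n where n: "\<pi> permutes {1..n}" by (metis S_infinityE)
  have "inversions \<pi> \<subseteq> {0..n} \<times> {0..n}"
  proof
    fix x assume "x \<in> inversions \<pi>"
    then obtain i j where x: "x = (i, j)" "i < j" "\<pi> j < \<pi> i" by (auto simp: inversions_def)
    have "j \<le> n"
    proof (rule ccontr)
      assume "\<not> j \<le> n"
      then have j: "\<pi> j = j" using n by (simp add: permutes_not_in)
      show False
      proof (cases "i \<in> {1..n}")
        case True
        then have "\<pi> i \<in> {1..n}" using permutes_in_image[OF n] by blast
        then show False using x j \<open>\<not> j \<le> n\<close> by auto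
      next
        case False
        then have "\<pi> i = i" using n by (simp add: permutes_not_in)
        then show False using x j by simp
      qed
    qed
    then show "x \<in> {0..n} \<times> {0..n}" using x by auto
  qed
  then show ?thesis by (rule finite_subset) simp
qed

section \<open>The number of inversions as Coxeter length\<close>

lemma simple_transposition_mono:
  assumes "i < j" "(i, j) \<noteq> (a, Suc a)"
  shows "simple_transposition a i < simple_transposition a j"
  using assms by (auto simp: simple_transposition_def transpose_def)

text \<open>The transposition keeps the order of every pair of positions except
  \<open>(a, a + 1)\<close>, so it carries the old inversions onto the new ones other than this
  pair, which becomes an inversion itself.\<close>

lemma inversions_ascent:
  assumes "\<pi> \<in> S_infinity" "\<pi> a < \<pi> (Suc a)"
  shows "card (inversions (\<pi> \<circ> simple_transposition a)) = Suc (card (inversions \<pi>))"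
proof -
  let ?s = "simple_transposition a"
  have s: "?s (?s i) = i" for i by (simp add: simple_transposition_def)
  have sa: "?s a = Suc a" "?s (Suc a) = a" by (auto simp: simple_transposition_def)
  have eq: "inversions (\<pi> \<circ> ?s) = insert (a, Suc a) (map_prod ?s ?s ` inversions \<pi>)" (is "?L = ?R")
  proof (intro set_eqI iffI)
    fix x assume "x \<in> ?L"
    then obtain i j where x: "x = (i, j)" "i < j" "\<pi> (?s j) < \<pi> (?s i)" by (auto simp: inversions_def)
    show "x \<in> ?R"
    proof (cases "(i, j) = (a, Suc a)")
      case False
      then have "(?s i, ?s j) \<in> inversions \<pi>"
        using x simple_transposition_mono by (auto simp: inversions_def)
      then have "map_prod ?s ?s (?s i, ?s j) \<in> map_prod ?s ?s ` inversions \<pi>" by (rule imageI)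
      then show ?thesis using x s by simp
    qed (use x in auto)
  next
    fix x assume "x \<in> ?R"
    then consider "x = (a, Suc a)" | i j where "x = (?s i, ?s j)" "i < j" "\<pi> j < \<pi> i"
      by (auto simp: inversions_def)
    then show "x \<in> ?L"
    proof cases
      case 1
      then show ?thesis using assms sa by (auto simp: inversions_def)
    next
      case 2
      have "(i, j) \<noteq> (a, Suc a)" using assms 2 by auto
      then show ?thesis using 2 s simple_transposition_mono by (auto simp: inversions_def)
    qed
  qed
  have inj: "inj (map_prod ?s ?s)" by (rule injI) (metis map_prod_simp prod.collapse s prod.inject)
  have "(a, Suc a) \<notin> map_prod ?s ?s ` inversions \<pi>"
  proof
    assume "(a, Suc a) \<in> map_prod ?s ?s ` inversions \<pi>"
    then obtain i j where ij: "(i, j) \<in> inversions \<pi>" "?s i = a" "?s j = Suc a" by auto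
    then have "i = Suc a" "j = a" using s sa by metis+
    then show False using ij by (simp add: inversions_def)
  qed
  moreover have "finite (map_prod ?s ?s ` inversions \<pi>)" using assms finite_inversions by blast
  ultimately show ?thesis
    unfolding eq by (simp add: card_image inj_on_subset[OF inj])
qed

lemma inversions_descent:
  assumes "\<pi> \<in> S_infinity" "1 \<le> a" "\<pi> (Suc a) < \<pi> a"
  shows "card (inversions \<pi>) = Suc (card (inversions (\<pi> \<circ> simple_transposition a)))"
proof -
  let ?s = "simple_transposition a"
  have "card (inversions ((\<pi> \<circ> ?s) \<circ> ?s)) = Suc (card (inversions (\<pi> \<circ> ?s)))"
    using assms
    by (intro inversions_ascent S_infinity_compose simple_transposition_S_infinity)
      (auto simp: simple_transposition_def)
  then show ?thesis by (simp add: comp_assoc)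
qed

text \<open>An increasing map satisfies \<open>i \<le> \<pi> i\<close>, and an excess at
  \<open>i\<close> would persist at \<open>i + n + 1\<close>, which lies beyond the support of
  \<open>\<pi>\<close>.\<close>

lemma S_infinity_ascending_imp_id:
  assumes "\<pi> \<in> S_infinity" "\<And>a. 1 \<le> a \<Longrightarrow> \<pi> a \<le> \<pi> (Suc a)"
  shows "\<pi> = id"
proof -
  have inj: "inj \<pi>" using assms S_infinity_bij bij_is_inj by blast
  have "\<pi> a < \<pi> (Suc a)" for a
  proof (cases "a = 0")
    case True
    then show ?thesis using S_infinity_0[OF assms(1)] S_infinity_eq_0_iff[OF assms(1), of 1]
      by simp
  next
    case False
    then show ?thesis using assms(2)[of a] inj_eq[OF inj, of a "Suc a"] by (cases "\<pi> a = \<pi> (Suc a)") auto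
  qed
  then have mono: "strict_mono \<pi>" by (simp add: strict_mono_Suc_iff)
  have ge: "i \<le> \<pi> i" for i using strict_mono_imp_increasing[OF mono] .
  obtain n where n: "\<pi> permutes {1..n}" using assms by (metis S_infinityE)
  have "\<pi> i = i" for i
  proof -
    have "\<pi> (i + n + 1) = i + n + 1" using n by (simp add: permutes_not_in)
    moreover have "\<pi> i + k \<le> \<pi> (i + k)" for k
      by (induction k) (use mono in \<open>auto simp: strict_mono_Suc_iff Suc_le_eq intro: le_less_trans\<close>)
    from this[of "n + 1"] have "\<pi> i + (n + 1) \<le> \<pi> (i + n + 1)" by (simp add: add.assoc)
    ultimately show ?thesis using ge[of i] by simp
  qed
  then show ?thesis by auto
qed

lemma inversions_id [simp]: "inversions id = {}" "inversions (\<lambda>i. i) = {}"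
  by (auto simp: inversions_def)

text \<open>Sorting by descents: a permutation other than the identity has a descent, and exchanging
  its two values removes exactly one inversion.\<close>

lemma ex_word_of_inversions:
  assumes "\<pi> \<in> S_infinity"
  shows "\<exists>as. is_word_of as \<pi> \<and> length as = card (inversions \<pi>)"
  using assms
proof (induction "card (inversions \<pi>)" arbitrary: \<pi>)
  case 0
  then have "inversions \<pi> = {}" using finite_inversions by auto
  then have "\<pi> a \<le> \<pi> (Suc a)" for a by (auto simp: inversions_def not_less[symmetric])
  then have "\<pi> = id" using 0 S_infinity_ascending_imp_id by blast
  then show ?case by (intro exI[of _ "[]"]) (simp add: is_word_of_def fun_eq_iff)
next
  case (Suc k)
  have "\<exists>a\<ge>1. \<pi> (Suc a) < \<pi> a"
    by (metis S_infinity_ascending_imp_id Suc.hyps(2) Suc.prems card.empty inversions_id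
        nat.distinct(1) not_le)
  then obtain a where a: "1 \<le> a" "\<pi> (Suc a) < \<pi> a" by auto
  have S: "\<pi> \<circ> simple_transposition a \<in> S_infinity"
    using Suc.prems a by (intro S_infinity_compose simple_transposition_S_infinity)
  have "k = card (inversions (\<pi> \<circ> simple_transposition a))"
    using inversions_descent[OF Suc.prems a] Suc.hyps(2) by simp
  from Suc.hyps(1)[OF this S] obtain as
    where as: "is_word_of as (\<pi> \<circ> simple_transposition a)"
      "length as = card (inversions (\<pi> \<circ> simple_transposition a))" by auto
  have "is_word_of (a # as) \<pi>" using as a by (auto simp: is_word_of_def comp_assoc)
  then show ?case using as inversions_descent[OF Suc.prems a] by (intro exI[of _ "a # as"]) simp
qed

lemma inversions_compose_le:
  assumes "\<pi> \<in> S_infinity" "1 \<le> a"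
  shows "card (inversions (\<pi> \<circ> simple_transposition a)) \<le> Suc (card (inversions \<pi>))"
proof (cases "\<pi> a < \<pi> (Suc a)")
  case True
  then show ?thesis using inversions_ascent assms by simp
next
  case False
  moreover have "\<pi> a \<noteq> \<pi> (Suc a)"
    using inj_eq[OF bij_is_inj[OF S_infinity_bij[OF assms(1)]], of a "Suc a"] by simp
  ultimately show ?thesis using inversions_descent assms by simp
qed

lemma inversions_le_length: "is_word_of as \<pi> \<Longrightarrow> card (inversions \<pi>) \<le> length as"
proof (induction as arbitrary: \<pi>)
  case Nil
  then have "\<pi> = id" by (simp add: is_word_of_def)
  then show ?case by simp
next
  case (Cons a as)
  then have "card (inversions (word_product as)) \<le> length as" by (auto simp: is_word_of_def)
  moreover have "word_product as \<in> S_infinity" "1 \<le> a"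
    using Cons word_product_S_infinity by (auto simp: is_word_of_def)
  moreover have "\<pi> = word_product as \<circ> simple_transposition a" using Cons by (auto simp: is_word_of_def)
  ultimately show ?case using inversions_compose_le[of "word_product as" a] by (metis Suc_le_mono le_trans length_Cons)
qed

lemma coxeter_length_eq_inversions:
  "\<pi> \<in> S_infinity \<Longrightarrow> coxeter_length \<pi> = card (inversions \<pi>)"
  unfolding coxeter_length_def
  by (rule Least_equality) (use ex_word_of_inversions inversions_le_length in blast)+

lemma coxeter_length_descent:
  assumes "\<pi> \<in> S_infinity" "1 \<le> a" "\<pi> (Suc a) < \<pi> a"
  shows "coxeter_length \<pi> = Suc (coxeter_length (\<pi> \<circ> simple_transposition a))"
  using inversions_descent[OF assms] assms
  by (simp add: coxeter_length_eq_inversions S_infinity_compose simple_transposition_S_infinity)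

lemma coxeter_length_eq_0_iff: "\<pi> \<in> S_infinity \<Longrightarrow> coxeter_length \<pi> = 0 \<longleftrightarrow> \<pi> = id"
proof
  assume *: "\<pi> \<in> S_infinity" "coxeter_length \<pi> = 0"
  then obtain as where "is_word_of as \<pi>" "length as = 0"
    using ex_word_of_inversions coxeter_length_eq_inversions by metis
  then show "\<pi> = id" by (simp add: is_word_of_def)
next
  assume "\<pi> \<in> S_infinity" "\<pi> = id"
  then show "coxeter_length \<pi> = 0" by (simp add: coxeter_length_eq_inversions)
qed

text \<open>The first letter acts first, so it names a position of \<open>\<pi>\<close>. At an
  ascent the remaining word would have to produce more inversions than it has letters.\<close>

lemma reduced_word_Cons:
  "reduced_word (a # as) \<pi> \<longleftrightarrow>
     \<pi> \<in> S_infinity \<and> 1 \<le> a \<and> \<pi> (Suc a) < \<pi> a \<and> reduced_word as (\<pi> \<circ> simple_transposition a)"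
proof
  assume red: "reduced_word (a # as) \<pi>"
  then have w: "1 \<le> a" "\<forall>a\<in>set as. 1 \<le> a" "\<pi> = word_product as \<circ> simple_transposition a"
    by (auto simp: reduced_word_def is_word_of_def)
  then have S: "\<pi> \<in> S_infinity" by (auto intro!: S_infinity_compose simple_transposition_S_infinity word_product_S_infinity)
  have w': "is_word_of as (\<pi> \<circ> simple_transposition a)"
    using w by (simp add: is_word_of_def comp_assoc)
  have S': "\<pi> \<circ> simple_transposition a \<in> S_infinity" using S w by (auto intro!: S_infinity_compose simple_transposition_S_infinity)
  have len: "Suc (length as) = card (inversions \<pi>)"
    using red S by (simp add: reduced_word_def coxeter_length_eq_inversions)
  have "\<not> \<pi> a < \<pi> (Suc a)"
    using inversions_ascent[OF S, of a] inversions_le_length[OF w'] len by auto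
  moreover have "\<pi> a \<noteq> \<pi> (Suc a)"
    using inj_eq[OF bij_is_inj[OF S_infinity_bij[OF S]], of a "Suc a"] by simp
  ultimately have d: "\<pi> (Suc a) < \<pi> a" by simp
  then have "reduced_word as (\<pi> \<circ> simple_transposition a)"
    using coxeter_length_descent[OF S w(1) d] w' red by (simp add: reduced_word_def)
  then show "\<pi> \<in> S_infinity \<and> 1 \<le> a \<and> \<pi> (Suc a) < \<pi> a \<and> reduced_word as (\<pi> \<circ> simple_transposition a)"
    using S w d by simp
next
  assume *: "\<pi> \<in> S_infinity \<and> 1 \<le> a \<and> \<pi> (Suc a) < \<pi> a \<and> reduced_word as (\<pi> \<circ> simple_transposition a)"
  then have "coxeter_length \<pi> = Suc (length as)"
    using coxeter_length_descent[of \<pi> a] by (simp add: reduced_word_def)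
  moreover have "word_product as \<circ> simple_transposition a = \<pi>"
    using * by (simp add: reduced_word_def is_word_of_def comp_assoc)
  ultimately show "reduced_word (a # as) \<pi>"
    using * by (auto simp: reduced_word_def is_word_of_def)
qed

lemma reduced_word_Nil: "reduced_word [] \<pi> \<longleftrightarrow> \<pi> = id"
  using coxeter_length_eq_0_iff[of id] S_infinityI[OF permutes_id]
  by (auto simp: reduced_word_def is_word_of_def)

section \<open>Pipe dreams\<close>

text \<open>The inverse of \<open>word_product as\<close>: the latter sends a label to its position
  after all letters have acted, \<open>arrangement as\<close> sends a position to the label standing
  there.\<close>

definition arrangement :: "nat list \<Rightarrow> nat \<Rightarrow> nat" where
  "arrangement as = word_product (rev as)"

lemma arrangement_Nil [simp]: "arrangement [] = id"
  by (simp add: arrangement_def)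

lemma arrangement_append: "arrangement (as @ bs) = arrangement as \<circ> arrangement bs"
  by (simp add: arrangement_def word_product_append)

lemma arrangement_snoc: "arrangement (as @ [a]) = arrangement as \<circ> simple_transposition a"
  by (simp only: arrangement_def rev_append rev.simps append.simps word_product.simps)

lemma word_product_snoc: "word_product (as @ [a]) = simple_transposition a \<circ> word_product as"
  by (simp add: word_product_append fun_eq_iff)

lemma word_product_arrangement:
  "word_product as (arrangement as i) = i" "arrangement as (word_product as i) = i"
proof -
  have inv: "simple_transposition a (simple_transposition a i) = i" for a i
    by (simp add: simple_transposition_def)
  have "\<forall>i. word_product as (arrangement as i) = i \<and> arrangement as (word_product as i) = i"
    by (induction as rule: rev_induct)
      (simp_all add: arrangement_snoc word_product_snoc inv)
  then show "word_product as (arrangement as i) = i" "arrangement as (word_product as i) = i" by auto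
qed

lemma arrangement_fixes:
  "(\<And>a. a \<in> set as \<Longrightarrow> a \<noteq> k \<and> Suc a \<noteq> k) \<Longrightarrow> arrangement as k = k"
  by (induction as rule: rev_induct)
    (auto simp: arrangement_snoc simple_transposition_def transpose_def)

lemma word_product_rev_eq_iff: "word_product (rev as) = word_product (rev bs) \<longleftrightarrow> word_product as = word_product bs"
proof -
  have *: "word_product (rev as) = word_product (rev bs)" if "word_product as = word_product bs" for as bs
  proof
    fix i
    have "word_product as (arrangement as i) = word_product as (arrangement bs i)"
      using word_product_arrangement(1)[of as i] word_product_arrangement(1)[of bs i] that by simp
    then have "arrangement as i = arrangement bs i" using word_product_arrangement(2) by metis
    then show "word_product (rev as) i = word_product (rev bs) i" by (simp add: arrangement_def)
  qed
  show ?thesis using *[of as bs] *[of "rev as" "rev bs"] by auto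
qed

text \<open>Reversing a word inverts its product, so the words of a permutation and of its inverse
  correspond with equal lengths.\<close>

lemma coxeter_length_rev: "coxeter_length (word_product (rev as)) = coxeter_length (word_product as)"
proof -
  have "(\<exists>bs. is_word_of bs (word_product (rev as)) \<and> length bs = l) \<longleftrightarrow>
        (\<exists>bs. is_word_of bs (word_product as) \<and> length bs = l)" for l
  proof
    assume "\<exists>bs. is_word_of bs (word_product (rev as)) \<and> length bs = l"
    then obtain bs where "is_word_of bs (word_product (rev as))" "length bs = l" by auto
    then have "is_word_of (rev bs) (word_product as) \<and> length (rev bs) = l"
      unfolding is_word_of_def using word_product_rev_eq_iff[of "rev bs" as] by simp
    then show "\<exists>bs. is_word_of bs (word_product as) \<and> length bs = l" by blast
  next
    assume "\<exists>bs. is_word_of bs (word_product as) \<and> length bs = l"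
    then obtain bs where "is_word_of bs (word_product as)" "length bs = l" by auto
    then have "is_word_of (rev bs) (word_product (rev as)) \<and> length (rev bs) = l"
      unfolding is_word_of_def using word_product_rev_eq_iff[of bs as] by simp
    then show "\<exists>bs. is_word_of bs (word_product (rev as)) \<and> length bs = l" by blast
  qed
  then show ?thesis unfolding coxeter_length_def by simp
qed

definition ascending_word :: "nat list \<Rightarrow> bool" where
  "ascending_word as \<longleftrightarrow> (\<forall>k<length as. arrangement (take k as) (as ! k) < arrangement (take k as) (Suc (as ! k)))"

lemma ascending_word_snoc:
  "ascending_word (as @ [a]) \<longleftrightarrow> ascending_word as \<and> arrangement as a < arrangement as (Suc a)"
  by (auto simp: ascending_word_def less_Suc_eq nth_append)

text \<open>Appending a letter to \<open>as\<close> prepends it to \<open>rev as\<close>, where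
  \<open>reduced_word_Cons\<close> demands a descent; this descent says that the letter exchanges
  two increasing labels.\<close>

lemma reduced_rev_iff_ascending:
  assumes "\<forall>a\<in>set as. 1 \<le> a"
  shows "reduced_word (rev as) (word_product (rev as)) \<longleftrightarrow> ascending_word as"
  using assms
proof (induction as rule: rev_induct)
  case Nil
  have "reduced_word (rev []) (word_product (rev []))"
    unfolding rev.simps word_product.simps reduced_word_Nil ..
  moreover have "ascending_word []" by (simp add: ascending_word_def)
  ultimately show ?case by blast
next
  case (snoc a as)
  let ?\<rho> = "word_product (rev as)"
  have S: "word_product (a # rev as) \<in> S_infinity" by (rule word_product_S_infinity) (use snoc in auto)
  have v: "word_product (a # rev as) (Suc a) = ?\<rho> a" "word_product (a # rev as) a = ?\<rho> (Suc a)"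
    by (simp_all add: simple_transposition_def)
  have c: "word_product (a # rev as) \<circ> simple_transposition a = ?\<rho>"
    by (simp only: word_product.simps comp_assoc simple_transposition_involution comp_id)
  have eq: "reduced_word (a # rev as) (word_product (a # rev as)) \<longleftrightarrow> ?\<rho> a < ?\<rho> (Suc a) \<and> reduced_word (rev as) ?\<rho>"
    unfolding reduced_word_Cons c v using S snoc.prems by simp
  have r: "rev (as @ [a]) = a # rev as" by simp
  have "reduced_word (rev as) ?\<rho> \<longleftrightarrow> ascending_word as" using snoc by simp
  then show ?case unfolding r ascending_word_snoc arrangement_def eq by blast
qed

lemma reduced_iff_ascending:
  "reduced_word as \<pi> \<longleftrightarrow> is_word_of as \<pi> \<and> ascending_word as"
proof (cases "is_word_of as \<pi>")
  case True
  then have pos: "\<forall>a\<in>set as. 1 \<le> a" and \<pi>: "\<pi> = word_product as" by (auto simp: is_word_of_def)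
  have "is_word_of (rev as) (word_product (rev as))" using pos by (simp add: is_word_of_def)
  then have "reduced_word as \<pi> \<longleftrightarrow> reduced_word (rev as) (word_product (rev as))"
    using True coxeter_length_rev[of as] unfolding \<pi> reduced_word_def by simp
  then show ?thesis using reduced_rev_iff_ascending[OF pos] True by simp
qed (simp add: reduced_word_def)

text \<open>A discrete intermediate value argument: a letter reverses the relative position of two
  labels only if it exchanges precisely these two.\<close>

lemma order_change:
  assumes "k \<le> l" "l \<le> length as" "word_product (take k as) p < word_product (take k as) q"
    "\<not> word_product (take l as) p < word_product (take l as) q"
  shows "\<exists>m. k \<le> m \<and> m < l \<and> arrangement (take m as) (as ! m) = p \<and> arrangement (take m as) (Suc (as ! m)) = q"
  using assms(1,2,4)
proof (induction l rule: dec_induct)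
  case base
  then show ?case using assms(3) by simp
next
  case (step l)
  let ?w = "word_product (take l as)"
  show ?case
  proof (cases "?w p < ?w q")
    case False
    then show ?thesis using step.IH step.prems step.hyps by (meson Suc_leD less_Suc_eq)
  next
    case True
    have t: "take (Suc l) as = take l as @ [as ! l]" using step.prems by (simp add: take_Suc_conv_app_nth)
    have "\<not> simple_transposition (as ! l) (?w p) < simple_transposition (as ! l) (?w q)"
      using step.prems(2) unfolding t word_product_snoc by simp
    then have "?w p = as ! l" "?w q = Suc (as ! l)"
      using simple_transposition_mono[OF True, of "as ! l"] by auto
    then have "arrangement (take l as) (as ! l) = p \<and> arrangement (take l as) (Suc (as ! l)) = q"
      using word_product_arrangement(2)[of "take l as" p] word_product_arrangement(2)[of "take l as" q] by simp
    then show ?thesis using step.hyps by blast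
  qed
qed

text \<open>Two labels exchanged twice, each time out of increasing order, must be exchanged back in
  between by a letter acting on a decreasing pair. Conversely, a decreasing pair has been exchanged
  before, since all labels start in increasing order.\<close>

lemma ascending_word_iff_distinct_pairs:
  "ascending_word as \<longleftrightarrow> (\<forall>k l. k < l \<longrightarrow> l < length as \<longrightarrow>
     {arrangement (take k as) (as ! k), arrangement (take k as) (Suc (as ! k))} \<noteq>
     {arrangement (take l as) (as ! l), arrangement (take l as) (Suc (as ! l))})" (is "_ \<longleftrightarrow> ?R")
proof
  assume A: "ascending_word as"
  show ?R
  proof (intro allI impI notI)
    fix k l assume kl: "k < l" "l < length as"
      and eq: "{arrangement (take k as) (as ! k), arrangement (take k as) (Suc (as ! k))} =
        {arrangement (take l as) (as ! l), arrangement (take l as) (Suc (as ! l))}"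
    define p where "p = arrangement (take k as) (as ! k)"
    define q where "q = arrangement (take k as) (Suc (as ! k))"
    have "p < q" using A kl unfolding ascending_word_def p_def q_def by simp
    moreover have "arrangement (take l as) (as ! l) < arrangement (take l as) (Suc (as ! l))"
      using A kl unfolding ascending_word_def by simp
    ultimately have pl: "arrangement (take l as) (as ! l) = p" "arrangement (take l as) (Suc (as ! l)) = q"
      using eq unfolding p_def[symmetric] q_def[symmetric] by (auto simp: doubleton_eq_iff)
    have t: "take (Suc k) as = take k as @ [as ! k]" using kl by (simp add: take_Suc_conv_app_nth)
    have "word_product (take k as) p = as ! k" "word_product (take k as) q = Suc (as ! k)"
      unfolding p_def q_def by (rule word_product_arrangement)+
    then have "word_product (take (Suc k) as) q < word_product (take (Suc k) as) p"
      unfolding t word_product_snoc by (simp add: simple_transposition_def)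
    moreover have "word_product (take l as) p = as ! l" "word_product (take l as) q = Suc (as ! l)"
      unfolding pl[symmetric] by (rule word_product_arrangement)+
    then have "\<not> word_product (take l as) q < word_product (take l as) p" by simp
    ultimately obtain m where m: "Suc k \<le> m" "m < l" "arrangement (take m as) (as ! m) = q"
      "arrangement (take m as) (Suc (as ! m)) = p"
      using order_change[of "Suc k" l as q p] kl by auto
    then have "q < p" using A kl unfolding ascending_word_def by (metis less_trans)
    then show False using \<open>p < q\<close> by simp
  qed
next
  assume R: ?R
  show "ascending_word as"
    unfolding ascending_word_def
  proof (intro allI impI, rule ccontr)
    fix k assume k: "k < length as"
    define q where "q = arrangement (take k as) (as ! k)"
    define p where "p = arrangement (take k as) (Suc (as ! k))"
    assume "\<not> arrangement (take k as) (as ! k) < arrangement (take k as) (Suc (as ! k))"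
    then have "p \<le> q" unfolding p_def q_def by simp
    moreover have wp: "word_product (take k as) q = as ! k" "word_product (take k as) p = Suc (as ! k)"
      unfolding p_def q_def by (rule word_product_arrangement)+
    then have "p \<noteq> q" by auto
    ultimately have "p < q" by simp
    then obtain m where m: "m < k" "arrangement (take m as) (as ! m) = p" "arrangement (take m as) (Suc (as ! m)) = q"
      using order_change[of 0 k as p q] k wp by auto
    have "{arrangement (take m as) (as ! m), arrangement (take m as) (Suc (as ! m))} =
        {arrangement (take k as) (as ! k), arrangement (take k as) (Suc (as ! k))}"
      unfolding m(2,3) unfolding p_def q_def by (rule insert_commute)
    then show False using R m(1) k by blast
  qed
qed

section \<open>Sorting cells in reading order\<close>

lemma cell_less_irrefl: "\<not> cell_less c c"
  by (cases c) simp

lemma cell_less_trans: "cell_less c d \<Longrightarrow> cell_less d e \<Longrightarrow> cell_less c e"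
  by (cases c; cases d; cases e) auto

lemma cell_less_total: "c \<noteq> d \<Longrightarrow> cell_less c d \<or> cell_less d c"
  by (cases c; cases d) auto

lemma transp_cell_less: "transp cell_less"
  unfolding transp_def using cell_less_trans by blast

lemma ex_sorted_cells: "finite X \<Longrightarrow> \<exists>cs. sorted_wrt cell_less cs \<and> set cs = X"
proof (induction X rule: finite_induct)
  case (insert c X)
  then obtain cs where cs: "sorted_wrt cell_less cs" "set cs = X" by blast
  let ?cs = "filter (\<lambda>d. cell_less d c) cs @ c # filter (\<lambda>d. cell_less c d) cs"
  have "sorted_wrt cell_less ?cs"
    using cs(1) by (auto simp: sorted_wrt_append sorted_wrt_filter simp del: cell_less.simps intro: cell_less_trans)
  moreover have "set ?cs = insert c X" 
    unfolding set_append set_filter list.set using cs(2) insert.hyps(2) cell_less_total by blast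
  ultimately show ?case by blast
qed (auto intro: exI[of _ "[]"])

lemma sorted_cells_distinct: "sorted_wrt cell_less ds \<Longrightarrow> distinct ds"
  using cell_less_irrefl by (induction ds) (auto simp del: cell_less.simps)

lemma filter_eq_distinct: "distinct ds \<Longrightarrow> filter (\<lambda>d. d = c) ds = (if c \<in> set ds then [c] else [])"
  by (induction ds) auto

lemma sorted_cells_unique:
  "sorted_wrt cell_less cs \<Longrightarrow> sorted_wrt cell_less ds \<Longrightarrow> set cs = set ds \<Longrightarrow> cs = ds"
proof (induction cs arbitrary: ds)
  case (Cons c cs)
  then obtain d ds' where ds: "ds = d # ds'" by (cases ds) auto
  have "c = d"
  proof (rule ccontr)
    assume "c \<noteq> d"
    then have "c \<in> set ds'" "d \<in> set cs" using Cons.prems(3) unfolding ds by auto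
    then have "cell_less d c" "cell_less c d" using Cons.prems unfolding ds by auto
    then show False using cell_less_trans cell_less_irrefl by blast
  qed
  moreover have "c \<notin> set cs" "d \<notin> set ds'" using Cons.prems(1,2) cell_less_irrefl unfolding ds sorted_wrt.simps by blast+
  then have "set cs = set ds'" using Cons.prems(3) \<open>c = d\<close> unfolding ds by auto
  ultimately show ?case using Cons unfolding ds by auto
qed simp

lemma pd_crosses_eqI: "sorted_wrt cell_less cs \<Longrightarrow> set cs = {c. D c = PD_Cross} \<Longrightarrow> pd_crosses D = cs"
  unfolding pd_crosses_def by (rule the_equality) (auto intro: sorted_cells_unique)

lemma pd_crosses_props:
  assumes "finite {c. D c = PD_Cross}"
  shows "sorted_wrt cell_less (pd_crosses D)" "set (pd_crosses D) = {c. D c = PD_Cross}"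
  using ex_sorted_cells[OF assms] pd_crosses_eqI by metis+

text \<open>As \<open>A\<close> is closed downwards along the list, its elements form an initial
  segment; this is how the reading word up to one cell extends to the reading word up to a later
  one.\<close>

lemma filter_sorted_split:
  assumes "sorted_wrt R cs" "\<And>c d. R c d \<Longrightarrow> A d \<Longrightarrow> A c" "\<And>c. A c \<Longrightarrow> B c"
  shows "filter B cs = filter A cs @ filter (\<lambda>c. B c \<and> \<not> A c) cs"
  using assms(1)
proof (induction cs)
  case (Cons c cs)
  show ?case
  proof (cases "A c")
    case True
    then show ?thesis using Cons assms(3) by simp
  next
    case False
    then have none: "\<forall>d\<in>set cs. \<not> A d" using Cons.prems assms(2) by auto
    then have "filter A cs = []" "filter (\<lambda>c. B c \<and> \<not> A c) cs = filter B cs"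
      by (auto simp: filter_empty_conv intro: filter_cong)
    then show ?thesis using False by simp
  qed
qed simp

section \<open>Labels of the edges of a pipe dream\<close>

fun cell_letter :: "cell \<Rightarrow> nat" where
  "cell_letter (i, j) = i + j - 1"

lemma pd_sequence_eq: "pd_sequence D = (map cell_letter (pd_crosses D), map fst (pd_crosses D))"
proof -
  have "(\<lambda>(r, j). r + j - 1) = cell_letter" by (rule ext) auto
  then show ?thesis unfolding pd_sequence_def by simp
qed

locale crosses =
  fixes D :: "cell \<Rightarrow> pd_tile"
  assumes outside: "\<And>c. \<not> in_grid c \<Longrightarrow> D c = PD_Elbow"
    and fin: "finite {c. D c = PD_Cross}"
begin

abbreviation "cs \<equiv> pd_crosses D"

text \<open>The labels on all positions when the reading has arrived just before the cell
  \<open>c\<close>.\<close>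

definition "labels c = arrangement (map cell_letter (filter (\<lambda>d. cell_less d c) cs))"

definition "all_labels = arrangement (map cell_letter cs)"

text \<open>The cross in \<open>(i, j)\<close> is the letter \<open>i + j - 1\<close> and exchanges
  the positions \<open>i + j - 1\<close> and \<open>i + j\<close>. The north edge of the cell is at
  the first position and its east edge at the second. Directions in which no pipe runs get the
  default 0.\<close>

fun pd_label :: "edge \<Rightarrow> nat" where
  "pd_label ((i, j), South) = labels (i, j) (i + j - 1)"
| "pd_label ((i, j), West) = labels (i, j) (i + j)"
| "pd_label (c, d) = 0"

lemmas cs = pd_crosses_props[OF fin]

lemma cross_in_grid: "(i, j) \<in> set cs \<Longrightarrow> 1 \<le> i \<and> 1 \<le> j"
  using cs(2) outside[of "(i, j)"] by (auto simp: in_grid_def)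

lemma labels_mono:
  assumes "\<And>d. cell_less d c \<Longrightarrow> cell_less d c'"
  shows "labels c' = labels c \<circ> arrangement (map cell_letter (filter (\<lambda>d. cell_less d c' \<and> \<not> cell_less d c) cs))"
  unfolding labels_def arrangement_append[symmetric] map_append[symmetric]
  by (subst filter_sorted_split[where A = "\<lambda>d. cell_less d c" and B = "\<lambda>d. cell_less d c'", OF cs(1)])
    (use assms cell_less_trans in auto)

text \<open>\<open>(i, j - 1)\<close> is the next cell in reading order, so at most the letter of
  \<open>(i, j)\<close> is added. For \<open>j = 1\<close> it is the formal cell
  \<open>(i, 0)\<close> at the end of the row.\<close>

lemma labels_west:
  assumes "1 \<le> j"
  shows "labels (i, j - 1) = (if D (i, j) = PD_Cross then labels (i, j) \<circ> simple_transposition (i + j - 1) else labels (i, j))"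
proof -
  have iff: "cell_less d (i, j - 1) \<and> \<not> cell_less d (i, j) \<longleftrightarrow> d = (i, j)" for d
    using assms by (cases d) auto
  have "distinct cs" using cs(1) by (rule sorted_cells_distinct)
  then have f: "filter (\<lambda>d. d = (i, j)) cs = (if (i, j) \<in> set cs then [(i, j)] else [])"
    by (rule filter_eq_distinct)
  have "labels (i, j - 1) = labels (i, j) \<circ> arrangement (map cell_letter (filter (\<lambda>d. d = (i, j)) cs))"
    using labels_mono[of "(i, j)" "(i, j - 1)"] unfolding iff using assms by force
  then show ?thesis unfolding f using cs(2) arrangement_snoc[of "[]"] by auto
qed

text \<open>The crosses read in between lie in row \<open>i\<close> in columns up to
  \<open>j - 1\<close>, with letters at most \<open>i + j - 2\<close>, or in row
  \<open>i + 1\<close> right of column \<open>j\<close>, with letters at least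
  \<open>i + j + 1\<close>. None of them moves position \<open>i + j\<close>.\<close>

lemma labels_south:
  assumes "1 \<le> j" shows "labels (i + 1, j) (i + j) = labels (i, j - 1) (i + j)"
proof -
  have "labels (i + 1, j) = labels (i, j - 1) \<circ>
      arrangement (map cell_letter (filter (\<lambda>d. cell_less d (i + 1, j) \<and> \<not> cell_less d (i, j - 1)) cs))"
    by (rule labels_mono) auto
  moreover have "arrangement (map cell_letter (filter (\<lambda>d. cell_less d (i + 1, j) \<and> \<not> cell_less d (i, j - 1)) cs)) (i + j) = i + j"
    by (rule arrangement_fixes) (use assms cross_in_grid in fastforce)
  ultimately show ?thesis by simp
qed

lemma pd_label_step:
  assumes "pd_step D e e'" shows "pd_label e' = pd_label e"
proof -
  obtain i j d where e: "e = ((i, j), d)" by (metis prod.exhaust)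
  have ij: "1 \<le> i" "1 \<le> j" and t: "pd_turn (D (i, j)) d = Some (snd e')" "fst e' = neighbour (snd e') (i, j)"
    using assms by (auto simp: pd_step_def e in_grid_def)
  have w: "labels (i, j - 1) = (if D (i, j) = PD_Cross then labels (i, j) \<circ> simple_transposition (i + j - 1) else labels (i, j))"
    using labels_west[OF ij(2)] .
  have s: "labels (Suc i, j) (i + j) = labels (i, j - 1) (i + j)" using labels_south[OF ij(2), of i] by simp
  have tr: "simple_transposition (i + j - 1) (i + j - 1) = i + j" "simple_transposition (i + j - 1) (i + j) = i + j - 1"
    using ij by (auto simp: simple_transposition_def)
  have ar: "i + (j - 1) = i + j - 1" using ij by simp
  obtain c' d' where e': "e' = (c', d')" by (cases e')
  show ?thesis
  proof (cases "D (i, j)")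
    case PD_Cross
    then consider "d = South" "e' = ((i + 1, j), South)" | "d = West" "e' = ((i, j - 1), West)"
      using t e' by (cases d) auto
    then show ?thesis by cases (use w s tr ar PD_Cross e in auto)
  next
    case PD_Elbow
    then consider "d = West" "e' = ((i + 1, j), South)" | "d = South" "e' = ((i, j - 1), West)"
      using t e' by (cases d) auto
    then show ?thesis by cases (use w s tr ar PD_Elbow e in auto)
  qed
qed

lemma pd_label_start: "1 \<le> p \<Longrightarrow> pd_label ((1, p), South) = p"
  using cross_in_grid unfolding pd_label.simps labels_def
  by (subst arrangement_fixes) fastforce+

lemma pd_label_pipe: 
  assumes "e \<in> pd_pipe D p" "1 \<le> p"
  shows "pd_label e = p" "1 \<le> fst (fst e)"
proof -
  have "(pd_step D)\<^sup>*\<^sup>* ((1, p), South) e" using assms by (simp add: pd_pipe_def)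
  then have "pd_label e = p \<and> 1 \<le> fst (fst e)"
  proof (induction rule: rtranclp_induct)
    case base
    then show ?case using pd_label_start assms by simp
  next
    case (step e e')
    have "1 \<le> fst (fst e')"
    proof -
      obtain i j d where e: "e = ((i, j), d)" by (metis prod.exhaust)
      have "snd e' = South \<or> snd e' = West"
        using step(2) unfolding pd_step_def by (cases "D (fst e)"; cases "snd e") auto
      then show ?thesis using step unfolding pd_step_def e by auto
    qed
    then show ?case using pd_label_step step by simp
  qed
  then show "pd_label e = p" "1 \<le> fst (fst e)" by auto
qed

lemma pd_pipe_step: "e \<in> pd_pipe D p \<Longrightarrow> pd_step D e e' \<Longrightarrow> e' \<in> pd_pipe D p"
  unfolding pd_pipe_def by (auto intro: rtranclp.rtrancl_into_rtrancl)

text \<open>Labels tell which pipe an edge can belong to, not that it belongs to one. Right of all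
  crosses a row consists of elbows, which turn the pipes on the north edges westwards; from there
  the row is filled leftwards, and the row below inherits its north edges.\<close>

lemma ex_pipe:
  assumes "1 \<le> i"
  shows "(\<forall>j\<ge>1. \<exists>p\<ge>1. ((i, j), South) \<in> pd_pipe D p) \<and> (\<forall>j. \<exists>p\<ge>1. ((i, j), West) \<in> pd_pipe D p)"
proof -
  obtain N where N: "\<And>i j. D (i, j) = PD_Cross \<Longrightarrow> j \<le> N"
  proof -
    have "finite (snd ` {c. D c = PD_Cross})" using fin by simp
    then obtain N where "\<forall>k\<in>snd ` {c. D c = PD_Cross}. k \<le> N" using finite_nat_set_iff_bounded_le by blast
    then have "j \<le> N" if "D (i, j) = PD_Cross" for i j using that by force
    then show ?thesis by (rule that)
  qed
  have west: "\<exists>p\<ge>1. ((i, j), West) \<in> pd_pipe D p"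
    if i: "1 \<le> i" and south: "\<forall>j\<ge>1. \<exists>p\<ge>1. ((i, j), South) \<in> pd_pipe D p" for i j
  proof (induction "N - j" arbitrary: j rule: less_induct)
    case less
    show ?case
    proof (cases "D (i, Suc j)")
      case PD_Cross
      then have "N - Suc j < N - j" using N[OF PD_Cross] by simp
      then obtain p where p: "p \<ge> 1" "((i, Suc j), West) \<in> pd_pipe D p" using less by blast
      have "pd_step D ((i, Suc j), West) ((i, j), West)" using PD_Cross i by (simp add: pd_step_def in_grid_def)
      then show ?thesis using pd_pipe_step p by blast
    next
      case PD_Elbow
      obtain p where p: "p \<ge> 1" "((i, Suc j), South) \<in> pd_pipe D p" using south by force
      have "pd_step D ((i, Suc j), South) ((i, j), West)" using PD_Elbow i by (simp add: pd_step_def in_grid_def)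
      then show ?thesis using pd_pipe_step p by blast
    qed
  qed
  have "\<forall>j\<ge>1. \<exists>p\<ge>1. ((i, j), South) \<in> pd_pipe D p"
    using assms
  proof (induction i rule: dec_induct)
    case base
    have "((1, j), South) \<in> pd_pipe D j" for j unfolding pd_pipe_def by simp
    then show ?case by blast
  next
    case (step i)
    show ?case
    proof (intro allI impI)
      fix j :: nat assume j: "1 \<le> j"
      show "\<exists>p\<ge>1. ((Suc i, j), South) \<in> pd_pipe D p"
      proof (cases "D (i, j)")
        case PD_Cross
        obtain p where p: "p \<ge> 1" "((i, j), South) \<in> pd_pipe D p" using step j by blast
        have "pd_step D ((i, j), South) ((Suc i, j), South)" using PD_Cross step j by (simp add: pd_step_def in_grid_def)
        then show ?thesis using pd_pipe_step p by blast
      next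
        case PD_Elbow
        obtain p where p: "p \<ge> 1" "((i, j), West) \<in> pd_pipe D p" using west[OF step(1) step.IH] by blast
        have "pd_step D ((i, j), West) ((Suc i, j), South)" using PD_Elbow step j by (simp add: pd_step_def in_grid_def)
        then show ?thesis using pd_pipe_step p by blast
      qed
    qed
  qed
  then show ?thesis using west[OF assms] by blast
qed

lemma pd_pipe_iff:
  assumes "1 \<le> i" "1 \<le> p"
  shows "1 \<le> j \<Longrightarrow> ((i, j), South) \<in> pd_pipe D p \<longleftrightarrow> labels (i, j) (i + j - 1) = p"
    "((i, j), West) \<in> pd_pipe D p \<longleftrightarrow> labels (i, j) (i + j) = p"
  using ex_pipe[OF assms(1)] pd_label_pipe(1) assms(2) by (metis pd_label.simps(1)) (metis ex_pipe[OF assms(1)] pd_label_pipe(1) assms(2) pd_label.simps(2))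

text \<open>The crosses still to be read lie in lower rows and have letters above \<open>i\<close>,
  so they fix position \<open>i\<close>, the one at which row \<open>i\<close> ends.\<close>

lemma exit_label: "labels (i, 0) i = all_labels i"
proof -
  have "all_labels = labels (i, 0) \<circ> arrangement (map cell_letter (filter (\<lambda>d. \<not> cell_less d (i, 0)) cs))"
    unfolding all_labels_def labels_def arrangement_append[symmetric] map_append[symmetric]
    using filter_sorted_split[where A = "\<lambda>d. cell_less d (i, 0)" and B = "\<lambda>d. True", OF cs(1)] cell_less_trans
    by (metis (mono_tags, lifting) filter_True filter_cong)
  moreover have "arrangement (map cell_letter (filter (\<lambda>d. \<not> cell_less d (i, 0)) cs)) i = i"
    by (rule arrangement_fixes) (use cross_in_grid in fastforce)
  ultimately show ?thesis by simp
qed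

lemma exits_iff:
  assumes "\<pi> \<in> S_infinity"
  shows "(\<forall>i\<ge>1. ((\<pi> i, 0), West) \<in> pd_pipe D i) \<longleftrightarrow> is_word_of (map cell_letter cs) \<pi>"
proof -
  let ?as = "map cell_letter cs"
  have pos: "\<forall>a\<in>set ?as. 1 \<le> a" using cross_in_grid by fastforce
  have pi: "1 \<le> \<pi> i \<longleftrightarrow> 1 \<le> i" for i using S_infinity_eq_0_iff[OF assms, of i] by (metis less_one not_le)
  have "(\<forall>i\<ge>1. ((\<pi> i, 0), West) \<in> pd_pipe D i) \<longleftrightarrow> (\<forall>i\<ge>1. arrangement ?as (\<pi> i) = i)"
    using pd_pipe_iff(2)[of "\<pi> _" _ 0] pi exit_label unfolding all_labels_def by simp
  also have "\<dots> \<longleftrightarrow> (\<forall>i. arrangement ?as (\<pi> i) = i)"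
  proof -
    have "arrangement ?as (\<pi> 0) = 0"
      unfolding S_infinity_0[OF assms] using pos by (intro arrangement_fixes) auto
    then show ?thesis by (metis less_one not_le)
  qed
  also have "\<dots> \<longleftrightarrow> word_product ?as = \<pi>"
    using word_product_arrangement[of ?as] by (metis ext)
  finally show ?thesis using pos unfolding is_word_of_def by blast
qed

lemma labels_nth:
  assumes "k < length cs"
  shows "labels (cs ! k) = arrangement (take k (map cell_letter cs))"
proof -
  have s: "cell_less (cs ! l) (cs ! m)" if "l < m" "m < length cs" for l m
    using cs(1) that by (simp add: sorted_wrt_iff_nth_less)
  have "filter (\<lambda>d. cell_less d (cs ! k)) cs = filter (\<lambda>d. cell_less d (cs ! k)) (take k cs) @ filter (\<lambda>d. cell_less d (cs ! k)) (drop k cs)"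
    by (metis append_take_drop_id filter_append)
  also have "filter (\<lambda>d. cell_less d (cs ! k)) (take k cs) = take k cs"
    unfolding filter_id_conv
  proof
    fix c assume "c \<in> set (take k cs)"
    then obtain l where "l < k" "c = cs ! l" by (auto simp: in_set_conv_nth)
    then show "cell_less c (cs ! k)" using s assms by simp
  qed
  also have "filter (\<lambda>d. cell_less d (cs ! k)) (drop k cs) = []"
  proof -
    have "\<not> cell_less (cs ! (k + m)) (cs ! k)" if "k + m < length cs" for m
    proof (cases "m = 0")
      case True
      then show ?thesis using cell_less_irrefl by simp
    next
      case False
      then have "cell_less (cs ! k) (cs ! (k + m))" using s[of k "k + m"] that by simp
      then show ?thesis using cell_less_trans cell_less_irrefl by blast
    qed
    note n = this
    show ?thesis
      unfolding filter_empty_conv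
    proof
      fix c assume "c \<in> set (drop k cs)"
      then obtain m where "m < length cs - k" "c = cs ! (k + m)" by (auto simp: in_set_conv_nth)
      then have "k + m < length cs" "c = cs ! (k + m)" by simp_all
      then show "\<not> cell_less c (cs ! k)" using n by simp
    qed
  qed
  finally show ?thesis by (simp add: labels_def take_map)
qed

lemma crossing_iff:
  assumes "k < length cs" "p \<noteq> q"
  shows "pd_crossing D p q (cs ! k) \<longleftrightarrow>
    {p, q} = {arrangement (take k (map cell_letter cs)) (map cell_letter cs ! k),
      arrangement (take k (map cell_letter cs)) (Suc (map cell_letter cs ! k))}"
proof -
  obtain i j where c: "cs ! k = (i, j)" by (cases "cs ! k")
  have X: "D (i, j) = PD_Cross" using cs(2) nth_mem[OF assms(1)] c by auto
  have ij: "1 \<le> i" "1 \<le> j" using cross_in_grid[of i j] nth_mem[OF assms(1)] c by auto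
  let ?n = "labels (i, j) (i + j - 1)" and ?e = "labels (i, j) (i + j)"
  have dirs: "(\<exists>d. ((i, j), d) \<in> pd_pipe D p) \<longleftrightarrow> p = ?n \<or> p = ?e" if "1 \<le> p" for p
  proof
    assume "\<exists>d. ((i, j), d) \<in> pd_pipe D p"
    then obtain d where d: "((i, j), d) \<in> pd_pipe D p" by blast
    then show "p = ?n \<or> p = ?e" using pd_label_pipe(1)[OF d that] that by (cases d) auto
  next
    assume "p = ?n \<or> p = ?e"
    then show "\<exists>d. ((i, j), d) \<in> pd_pipe D p"
      using pd_pipe_iff(1)[OF ij(1) that ij(2)] pd_pipe_iff(2)[OF ij(1) that, of j] by metis
  qed
  \<comment> \<open>\<open>pd_crossing\<close> also ranges over the number 0. The path of that
    number starts outside the grid and makes no step.\<close>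
  have pipe0: "\<not> (\<exists>d. ((i, j), d) \<in> pd_pipe D 0)"
  proof -
    have "e = ((1, 0), South)" if "(pd_step D)\<^sup>*\<^sup>* ((1, 0), South) e" for e
      using that by (cases rule: converse_rtranclpE) (auto simp: pd_step_def in_grid_def)
    then show ?thesis using ij unfolding pd_pipe_def by fastforce
  qed
  have pos: "1 \<le> ?n" "1 \<le> ?e"
    using ex_pipe[OF ij(1)] ij(2) pd_label_pipe(1) by (metis pd_label.simps(1), metis pd_label.simps(2))
  have "pd_crossing D p q (i, j) \<longleftrightarrow> {p, q} = {?n, ?e}"
  proof (cases "p = 0 \<or> q = 0")
    case True
    then show ?thesis using pipe0 pos unfolding pd_crossing_def by (auto simp: doubleton_eq_iff)
  next
    case False
    then show ?thesis using X assms(2) dirs[of p] dirs[of q] unfolding pd_crossing_def by auto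
  qed
  moreover have "Suc (i + j - 1) = i + j" using ij by simp
  ultimately show ?thesis using labels_nth[OF assms(1)] assms(1) c by (simp add: nth_map)
qed

lemma single_crossing_iff:
  assumes "\<forall>a\<in>set (map cell_letter cs). 1 \<le> a"
  shows "(\<forall>p q c c'. pd_crossing D p q c \<longrightarrow> pd_crossing D p q c' \<longrightarrow> c = c') \<longleftrightarrow>
    ascending_word (map cell_letter cs)" (is "?L \<longleftrightarrow> _")
proof -
  let ?as = "map cell_letter cs"
  let ?pair = "\<lambda>k. {arrangement (take k ?as) (?as ! k), arrangement (take k ?as) (Suc (?as ! k))}"
  have dist: "distinct cs" using cs(1) by (rule sorted_cells_distinct)
  have ne: "arrangement (take k ?as) (?as ! k) \<noteq> arrangement (take k ?as) (Suc (?as ! k))" for k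
    using word_product_arrangement(1)[of "take k ?as"] by (metis n_not_Suc_n)
  have "?L \<longleftrightarrow> (\<forall>k l. k < l \<longrightarrow> l < length ?as \<longrightarrow> ?pair k \<noteq> ?pair l)"
  proof
    assume L: ?L
    show "\<forall>k l. k < l \<longrightarrow> l < length ?as \<longrightarrow> ?pair k \<noteq> ?pair l"
    proof (intro allI impI notI)
      fix k l assume kl: "k < l" "l < length ?as" "?pair k = ?pair l"
      let ?p = "arrangement (take k ?as) (?as ! k)" and ?q = "arrangement (take k ?as) (Suc (?as ! k))"
      have len: "k < length cs" "l < length cs" using kl(1,2) by auto
      have "pd_crossing D ?p ?q (cs ! k)" "pd_crossing D ?p ?q (cs ! l)"
        using iffD2[OF crossing_iff[OF len(1) ne[of k]] refl] iffD2[OF crossing_iff[OF len(2) ne[of k]] kl(3)] .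
      then have "cs ! k = cs ! l" using L by blast
      then show False using dist kl nth_eq_iff_index_eq[OF dist, of k l] by simp
    qed
  next
    assume R: "\<forall>k l. k < l \<longrightarrow> l < length ?as \<longrightarrow> ?pair k \<noteq> ?pair l"
    show ?L
    proof (intro allI impI)
      fix p q c c' assume c: "pd_crossing D p q c" "pd_crossing D p q c'"
      then have pq: "p \<noteq> q" and "c \<in> set cs" "c' \<in> set cs" using cs(2) unfolding pd_crossing_def by auto
      then obtain k l where kl: "k < length cs" "l < length cs" "c = cs ! k" "c' = cs ! l"
        by (metis in_set_conv_nth)
      have "?pair k = ?pair l" using c crossing_iff[OF _ pq] kl by metis
      then have "k = l" using R kl(1,2) by (metis length_map linorder_neqE_nat)
      then show "c = c'" using kl by simp
    qed
  qed
  then show ?thesis unfolding ascending_word_iff_distinct_pairs .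
qed

end

section \<open>Pipe dreams as compatible sequences\<close>

lemma PD_iff:
  assumes "\<pi> \<in> S_infinity"
  shows "D \<in> PD \<pi> \<longleftrightarrow> (\<forall>c. \<not> in_grid c \<longrightarrow> D c = PD_Elbow) \<and> finite {c. D c = PD_Cross} \<and>
     reduced_word (map cell_letter (pd_crosses D)) \<pi>"
proof (cases "(\<forall>c. \<not> in_grid c \<longrightarrow> D c = PD_Elbow) \<and> finite {c. D c = PD_Cross}")
  case True
  then interpret crosses D by unfold_locales auto
  show ?thesis
    using True exits_iff[OF assms] single_crossing_iff unfolding PD_def reduced_iff_ascending
    by (auto simp: is_word_of_def)
next
  case False
  then show ?thesis unfolding PD_def by blast
qed

lemma pd_sequence_compatible:
  assumes S: "\<pi> \<in> S_infinity" and D: "D \<in> PD \<pi>"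
  shows "pd_sequence D \<in> compatible_sequences \<pi>"
proof -
  interpret crosses D using D by unfold_locales (auto simp: PD_def)
  have s: "cell_less (cs ! k) (cs ! Suc k)" if "Suc k < length cs" for k
    using cs(1) that by (simp add: sorted_wrt_iff_nth_less)
  have g: "1 \<le> fst (cs ! k)" "1 \<le> snd (cs ! k)" if "k < length cs" for k
    using cross_in_grid nth_mem[OF that] by (metis prod.collapse)+
  have letter: "cell_letter c = fst c + snd c - 1" for c by (cases c) simp
  have less: "cell_less c d \<longleftrightarrow> fst c < fst d \<or> (fst c = fst d \<and> snd d < snd c)" for c d
    by (cases c; cases d) simp
  show ?thesis
    unfolding pd_sequence_eq compatible_sequences_def
  proof (intro CollectI case_prodI conjI allI impI)
    show "reduced_word (map cell_letter cs) \<pi>" using PD_iff[OF S] D by blast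
    fix k
    { assume "k < length (map cell_letter cs)"
      then have k: "k < length cs" by simp
      then show "1 \<le> map fst cs ! k" "map fst cs ! k \<le> map cell_letter cs ! k"
        using g[OF k] by (auto simp: letter) }
    { assume "Suc k < length (map cell_letter cs)"
      then have k: "Suc k < length cs" by simp
      then show "map fst cs ! k \<le> map fst cs ! Suc k" using s[OF k] by (auto simp: less)
      assume "map cell_letter cs ! k < map cell_letter cs ! Suc k"
      then show "map fst cs ! k < map fst cs ! Suc k" using s[OF k] k by (auto simp: less letter) }
  qed simp
qed

text \<open>A cross in row \<open>r\<close> with letter \<open>a\<close> lies in column
  \<open>a + 1 - r\<close>, so the sequence determines the set of crosses.\<close>

lemma bij_pd_sequence:
  assumes S: "\<pi> \<in> S_infinity"
  shows "bij_betw pd_sequence (PD \<pi>) (compatible_sequences \<pi>)"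
proof (rule bij_betwI')
  fix D D' assume D: "D \<in> PD \<pi>" and D': "D' \<in> PD \<pi>"
  interpret X: crosses D using D by unfold_locales (auto simp: PD_def)
  interpret X': crosses D' using D' by unfold_locales (auto simp: PD_def)
  show "pd_sequence D = pd_sequence D' \<longleftrightarrow> D = D'"
  proof
    assume eq: "pd_sequence D = pd_sequence D'"
    have inv: "map2 (\<lambda>a r. (r, a + 1 - r)) (map cell_letter ds) (map fst ds) = ds"
      if "\<And>i j. (i, j) \<in> set ds \<Longrightarrow> 1 \<le> i \<and> 1 \<le> j" for ds
      using that by (induction ds) force+
    have e: "map cell_letter X.cs = map cell_letter X'.cs" "map fst X.cs = map fst X'.cs"
      using eq unfolding pd_sequence_eq by (simp_all only: prod.inject)
    have "X.cs = map2 (\<lambda>a r. (r, a + 1 - r)) (map cell_letter X.cs) (map fst X.cs)"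
      using inv[OF X.cross_in_grid] by (rule sym)
    also have "\<dots> = X'.cs" unfolding e by (rule inv[OF X'.cross_in_grid])
    finally have "X.cs = X'.cs" .
    then have "D c = PD_Cross \<longleftrightarrow> D' c = PD_Cross" for c using X.cs(2) X'.cs(2) by auto
    then show "D = D'" by (intro ext) (metis pd_tile.exhaust)
  qed simp
next
  fix D assume "D \<in> PD \<pi>"
  then show "pd_sequence D \<in> compatible_sequences \<pi>" by (rule pd_sequence_compatible[OF S])
next
  fix ar assume "ar \<in> compatible_sequences \<pi>"
  then obtain as rs where ar: "ar = (as, rs)" and red: "reduced_word as \<pi>" and len: "length rs = length as"
    and b: "\<And>k. k < length as \<Longrightarrow> 1 \<le> rs ! k \<and> rs ! k \<le> as ! k"
    and inc: "\<And>k. Suc k < length as \<Longrightarrow> rs ! k \<le> rs ! Suc k"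
    and strict: "\<And>k. Suc k < length as \<Longrightarrow> as ! k < as ! Suc k \<Longrightarrow> rs ! k < rs ! Suc k"
    unfolding compatible_sequences_def by auto
  define ds where "ds = map2 (\<lambda>a r. (r, a + 1 - r)) as rs"
  have ds: "length ds = length as" "\<And>k. k < length as \<Longrightarrow> ds ! k = (rs ! k, as ! k + 1 - rs ! k)"
    using len unfolding ds_def by auto
  have asc: "ascending_word as" using red reduced_iff_ascending by blast
  \<comment> \<open>A repeated letter would exchange the same two labels back, hence out of
    decreasing order. So within a row the letters strictly decrease, which is the reading
    order.\<close>
  have ne: "as ! k \<noteq> as ! Suc k" if "Suc k < length as" for k
  proof
    assume eq: "as ! k = as ! Suc k"
    have "take (Suc k) as = take k as @ [as ! k]" using that by (simp add: take_Suc_conv_app_nth)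
    then have "arrangement (take (Suc k) as) (as ! Suc k) = arrangement (take k as) (Suc (as ! k))"
      "arrangement (take (Suc k) as) (Suc (as ! Suc k)) = arrangement (take k as) (as ! k)"
      unfolding eq[symmetric] by (simp_all add: arrangement_snoc simple_transposition_def)
    then show False using asc that unfolding ascending_word_def by (metis Suc_lessD less_asym)
  qed
  have "sorted_wrt cell_less ds"
    unfolding sorted_wrt_iff_nth_Suc_transp[OF transp_cell_less]
  proof (intro allI impI)
    fix k assume "Suc k < length ds"
    then have k: "k < length as" "Suc k < length as" using ds(1) by auto
    have "rs ! k < rs ! Suc k \<or> (rs ! k = rs ! Suc k \<and> as ! Suc k < as ! k)"
      using inc[OF k(2)] strict[OF k(2)] ne[OF k(2)] by linarith
    then show "cell_less (ds ! k) (ds ! Suc k)"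
      using b[OF k(1)] b[OF k(2)] unfolding ds(2)[OF k(1)] ds(2)[OF k(2)] cell_less.simps by linarith
  qed
  define D where "D c = (if c \<in> set ds then PD_Cross else PD_Elbow)" for c
  have X: "{c. D c = PD_Cross} = set ds" by (auto simp: D_def)
  have cr: "pd_crosses D = ds" using pd_crosses_eqI \<open>sorted_wrt cell_less ds\<close> X by blast
  have "map cell_letter ds = as"
    by (rule nth_equalityI) (use ds b in \<open>auto simp: Suc_diff_le\<close>)
  moreover have "map fst ds = rs" by (rule nth_equalityI) (use ds len in auto)
  ultimately have seq: "pd_sequence D = ar" unfolding pd_sequence_eq cr ar by simp
  have "in_grid c" if c: "c \<in> set ds" for c
  proof -
    obtain k where k: "k < length as" "c = ds ! k" using c ds(1) by (auto simp: in_set_conv_nth)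
    then show ?thesis using b[OF k(1)] unfolding k(2) ds(2)[OF k(1)] in_grid_def fst_conv snd_conv by linarith
  qed
  then have "\<forall>c. \<not> in_grid c \<longrightarrow> D c = PD_Elbow" by (auto simp: D_def)
  then have "D \<in> PD \<pi>" unfolding PD_iff[OF S] X cr using red \<open>map cell_letter ds = as\<close> by simp
  then show "\<exists>D\<in>PD \<pi>. ar = pd_sequence D" using seq by blast
qed

section \<open>Labellings of bumpless pipe dreams\<close>

text \<open>The arguments belong to the south, west, north and east edge, and 0 is an absent pipe:
  either both pipes go straight or both turn. Two present pipes that turn form a bump.\<close>

definition paired :: "nat \<Rightarrow> nat \<Rightarrow> nat \<Rightarrow> nat \<Rightarrow> bool" where
  "paired s w n e \<longleftrightarrow> (n = s \<and> e = w) \<or> (n = w \<and> e = s)"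

definition tile_at :: "nat \<Rightarrow> nat \<Rightarrow> nat \<Rightarrow> nat \<Rightarrow> tile" where
  "tile_at s w n e =
     (if s \<noteq> 0 \<and> w \<noteq> 0 then (if n = s then Cross else Bump)
      else if s \<noteq> 0 then (if n \<noteq> 0 then Vertical else RTile)
      else if w \<noteq> 0 then (if n \<noteq> 0 then JTile else Horizontal)
      else Blank)"

fun field_tiling :: "(nat \<Rightarrow> nat \<Rightarrow> nat) \<Rightarrow> (nat \<Rightarrow> nat \<Rightarrow> nat) \<Rightarrow> cell \<Rightarrow> tile" where
  "field_tiling V H (i, j) =
     (if i = 0 \<or> j = 0 then Blank else tile_at (V i j) (H i (j - 1)) (V (i - 1) j) (H i j))"

text \<open>The last two clauses describe the far part: below row \<open>n\<close> pipe
  \<open>j\<close> runs in column \<open>j\<close>, and every row ends with a pipe in the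
  east.\<close>

definition label_field :: "nat \<Rightarrow> (nat \<Rightarrow> nat \<Rightarrow> nat) \<Rightarrow> (nat \<Rightarrow> nat \<Rightarrow> nat) \<Rightarrow> bool" where
  "label_field n V H \<longleftrightarrow>
     (\<forall>j. V 0 j = 0) \<and> (\<forall>i. V i 0 = 0) \<and> (\<forall>i. H i 0 = 0) \<and> (\<forall>j. H 0 j = 0) \<and>
     (\<forall>i\<ge>1. \<forall>j\<ge>1. paired (V i j) (H i (j - 1)) (V (i - 1) j) (H i j)) \<and>
     (\<forall>i j. n \<le> i \<or> n < j \<longrightarrow> V i j = (if 1 \<le> j \<and> j \<le> i then j else 0)) \<and>
     (\<forall>i\<ge>1. \<forall>j\<ge>n. i \<le> j \<longrightarrow> H i j \<noteq> 0)"

text \<open>The cell \<open>b\<close> is exempt: it holds the bump tile in the last step of \<open>nabla\<close>. The choice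
  \<open>b = (0, 0)\<close> exempts nothing.\<close>

definition nobump :: "cell \<Rightarrow> (nat \<Rightarrow> nat \<Rightarrow> nat) \<Rightarrow> (nat \<Rightarrow> nat \<Rightarrow> nat) \<Rightarrow> bool" where
  "nobump b V H \<longleftrightarrow> (\<forall>i\<ge>1. \<forall>j\<ge>1. (i, j) \<noteq> b \<longrightarrow>
     V i j = 0 \<or> H i (j - 1) = 0 \<or> V (i - 1) j = V i j)"

text \<open>A cell whose south and west edges are used is a cross or a bump. Together with
  \<open>nobump\<close> all the cells counted here are crosses, so the north label is not
  consulted.\<close>

definition cross_pairs :: "cell \<Rightarrow> (nat \<Rightarrow> nat \<Rightarrow> nat) \<Rightarrow> (nat \<Rightarrow> nat \<Rightarrow> nat) \<Rightarrow> (nat \<times> nat) set" where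
  "cross_pairs b V H = {(w, s). \<exists>i\<ge>1. \<exists>j\<ge>1. (i, j) \<noteq> b \<and> s = V i j \<and> w = H i (j - 1) \<and> s \<noteq> 0 \<and> w \<noteq> 0}"

definition ascending :: "(nat \<times> nat) set \<Rightarrow> bool" where
  "ascending X \<longleftrightarrow> (\<forall>(w, s)\<in>X. w < s)"

definition exits :: "(nat \<Rightarrow> nat) \<Rightarrow> (nat \<Rightarrow> nat \<Rightarrow> nat) \<Rightarrow> bool" where
  "exits \<pi> H \<longleftrightarrow> (\<forall>p\<ge>1. \<exists>m. \<forall>j\<ge>m. H (\<pi> p) j = p)"

text \<open>An edge is named by the cell it leads into, so the east edge of \<open>(i, j)\<close>
  appears with column \<open>Suc j\<close>.\<close>

definition edges_of :: "(nat \<Rightarrow> nat \<Rightarrow> nat) \<Rightarrow> (nat \<Rightarrow> nat \<Rightarrow> nat) \<Rightarrow> nat \<Rightarrow> edge set" where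
  "edges_of V H p = (if p = 0 then {} else
     {((i, j), North) | i j. V i j = p} \<union> {((i, Suc j), East) | i j. H i j = p})"

lemma label_fieldD:
  assumes "label_field n V H"
  shows "V 0 j = 0" "V i 0 = 0" "H i 0 = 0" "H 0 j = 0"
    "1 \<le> i \<Longrightarrow> 1 \<le> j \<Longrightarrow> paired (V i j) (H i (j - 1)) (V (i - 1) j) (H i j)"
    "n \<le> i \<or> n < j \<Longrightarrow> V i j = (if 1 \<le> j \<and> j \<le> i then j else 0)"
    "1 \<le> i \<Longrightarrow> n \<le> j \<Longrightarrow> i \<le> j \<Longrightarrow> H i j \<noteq> 0"
  using assms unfolding label_field_def by auto

lemma label_field_mono: "label_field n V H \<Longrightarrow> n \<le> m \<Longrightarrow> label_field m V H"
  unfolding label_field_def by auto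

lemma North_in_edges_of [simp]: "((i, j), North) \<in> edges_of V H p \<longleftrightarrow> p \<noteq> 0 \<and> V i j = p"
  by (auto simp: edges_of_def)

lemma East_in_edges_of [simp]:
  "((i, j), East) \<in> edges_of V H p \<longleftrightarrow> p \<noteq> 0 \<and> j \<noteq> 0 \<and> H i (j - 1) = p"
  by (auto simp: edges_of_def intro: exI[of _ "j - 1"])

lemma South_West_notin_edges_of [simp]:
  "(c, South) \<notin> edges_of V H p" "(c, West) \<notin> edges_of V H p"
  by (auto simp: edges_of_def)

lemma edges_of_step:
  assumes "label_field n V H" "bpd_step (field_tiling V H) e e'" "e \<in> edges_of V H p"
  shows "e' \<in> edges_of V H p"
proof -
  obtain i j d where e: "e = ((i, j), d)" by (metis prod.exhaust)
  obtain c' d' where e': "e' = (c', d')" by (metis prod.exhaust)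
  have ij: "1 \<le> i" "1 \<le> j" using assms(2) by (auto simp: bpd_step_def e Suc_le_eq split: if_splits)
  then have L: "paired (V i j) (H i (j - 1)) (V (i - 1) j) (H i j)" using assms(1) by (rule label_fieldD(5)[rotated 1])
  have t: "turn (tile_at (V i j) (H i (j - 1)) (V (i - 1) j) (H i j)) d = Some d'" "c' = neighbour d' (i, j)"
    using assms(2) ij by (auto simp: bpd_step_def e e')
  show ?thesis using assms(3) t ij L unfolding e e' paired_def tile_at_def
    by (cases d) (auto split: if_splits)
qed

lemma far_path:
  assumes "label_field n V H" "n \<le> i" "1 \<le> p" "p \<le> i" "i \<le> k"
  shows "(bpd_step (field_tiling V H))\<^sup>*\<^sup>* ((k, p), North) ((i, p), North)"
  using assms(5)
proof (induction k rule: dec_induct)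
  case base
  then show ?case by simp
next
  case (step k)
  have "V (Suc k) p = p" "V k p = p" using step assms label_fieldD(6)[OF assms(1)] by auto
  then have "bpd_step (field_tiling V H) ((Suc k, p), North) ((k, p), North)"
    using assms by (auto simp: bpd_step_def tile_at_def)
  then show ?case using step.IH by (rule converse_rtranclp_into_rtranclp)
qed

lemma bpd_pipe_step: "e \<in> bpd_pipe D p \<Longrightarrow> bpd_step D e e' \<Longrightarrow> e' \<in> bpd_pipe D p"
  unfolding bpd_pipe_def by (auto intro: rtranclp.rtrancl_into_rtrancl)

text \<open>Each edge is traced back to the south or west until it lies below row \<open>n\<close>.
  The quantity \<open>(n - i) + j\<close> decreases except in the turn from an east edge to the
  south edge of the same cell, so south edges are treated first.\<close>

lemma edges_of_subset_pipe:
  assumes P: "label_field n V H"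
  shows "(V i j \<noteq> 0 \<longrightarrow> ((i, j), North) \<in> bpd_pipe (field_tiling V H) (V i j)) \<and>
    (H i j \<noteq> 0 \<longrightarrow> ((i, Suc j), East) \<in> bpd_pipe (field_tiling V H) (H i j))"
proof (induction "(n - i) + j" arbitrary: i j rule: less_induct)
  case less
  let ?D = "field_tiling V H"
  have north: "((i, j), North) \<in> bpd_pipe ?D (V i j)" if V: "V i j \<noteq> 0"
  proof (cases "n \<le> i")
    case True
    then have "V i j = j" "1 \<le> j" "j \<le> i" using label_fieldD(6)[OF P, of i j] V by (auto split: if_splits)
    then show ?thesis using far_path[OF P True, of j] by (auto simp: bpd_pipe_def)
  next
    case False
    have j: "1 \<le> j" using V label_fieldD(2)[OF P] by (cases j) auto
    have L: "paired (V (Suc i) j) (H (Suc i) (j - 1)) (V i j) (H (Suc i) j)"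
      using label_fieldD(5)[OF P, of "Suc i" j] j by simp
    show ?thesis
    proof (cases "V (Suc i) j = V i j")
      case True
      then have "((Suc i, j), North) \<in> bpd_pipe ?D (V i j)"
        using less[of "Suc i" j] False V by auto
      moreover have "bpd_step ?D ((Suc i, j), North) ((i, j), North)"
        using True j V by (auto simp: bpd_step_def tile_at_def)
      ultimately show ?thesis by (rule bpd_pipe_step)
    next
      case F: False
      then have H: "H (Suc i) (j - 1) = V i j" using L by (auto simp: paired_def)
      then have "((Suc i, Suc (j - 1)), East) \<in> bpd_pipe ?D (V i j)"
        using less[of "Suc i" "j - 1"] False V by auto
      moreover have "bpd_step ?D ((Suc i, Suc (j - 1)), East) ((i, j), North)"
        using F H j V by (auto simp: bpd_step_def tile_at_def)
      ultimately show ?thesis by (rule bpd_pipe_step)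
    qed
  qed
  have "((i, Suc j), East) \<in> bpd_pipe ?D (H i j)" if H: "H i j \<noteq> 0"
  proof -
    have j: "1 \<le> j" "1 \<le> i" using H label_fieldD(3,4)[OF P] by (cases j; cases i; auto)+
    have L: "paired (V i j) (H i (j - 1)) (V (i - 1) j) (H i j)"
      using label_fieldD(5)[OF P j(2,1)] .
    show ?thesis
    proof (cases "H i (j - 1) = H i j \<and> V (i - 1) j = V i j")
      case True
      then have "((i, Suc (j - 1)), East) \<in> bpd_pipe ?D (H i j)"
        using less[of i "j - 1"] H j by auto
      moreover have "bpd_step ?D ((i, Suc (j - 1)), East) ((i, Suc j), East)"
        using True j H by (auto simp: bpd_step_def tile_at_def)
      ultimately show ?thesis by (rule bpd_pipe_step)
    next
      case F: False
      then have V: "V i j = H i j" "V (i - 1) j = H i (j - 1)" using L by (auto simp: paired_def)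
      then have "((i, j), North) \<in> bpd_pipe ?D (H i j)" using north H by auto
      moreover have "bpd_step ?D ((i, j), North) ((i, Suc j), East)"
        using F V j H by (auto simp: bpd_step_def tile_at_def)
      ultimately show ?thesis by (rule bpd_pipe_step)
    qed
  qed
  then show ?case using north by blast
qed

text \<open>Labels are the true names of the pipes: forward from far below, where label and column
  agree, the label is kept, and every labelled edge traces back to there.\<close>

lemma bpd_pipe_field:
  assumes P: "label_field n V H"
  shows "bpd_pipe (field_tiling V H) p = edges_of V H p"
proof (cases "p = 0")
  case True
  \<comment> \<open>Column 0 is blank, so a path starting in it cannot move and no edge is reached
    from two different starting rows.\<close>
  have "bpd_pipe (field_tiling V H) 0 = {}"
  proof -
    have "(bpd_step (field_tiling V H))\<^sup>*\<^sup>* ((i, 0), North) e \<Longrightarrow> e = ((i, 0), North)" for i e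
      by (auto simp: bpd_step_def elim: converse_rtranclpE)
    then have "e = ((m, 0), North) \<and> e = ((Suc m, 0), North)"
      if "\<forall>i\<ge>m. (bpd_step (field_tiling V H))\<^sup>*\<^sup>* ((i, 0), North) e" for e m
      using that by (metis le_SucI order_refl)
    then show ?thesis unfolding bpd_pipe_def by fastforce
  qed
  then show ?thesis using True by (simp add: edges_of_def)
next
  case False
  show ?thesis
  proof (intro set_eqI iffI)
    fix e assume "e \<in> bpd_pipe (field_tiling V H) p"
    then obtain m where m: "\<forall>i\<ge>m. (bpd_step (field_tiling V H))\<^sup>*\<^sup>* ((i, p), North) e"
      by (auto simp: bpd_pipe_def)
    have "(bpd_step (field_tiling V H))\<^sup>*\<^sup>* ((m + n + p, p), North) e" using m by simp
    then show "e \<in> edges_of V H p"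
    proof (induction rule: rtranclp_induct)
      case base
      then show ?case using False label_fieldD(6)[OF P, of "m + n + p" p] by simp
    next
      case (step e e')
      then show ?case using edges_of_step[OF P] by blast
    qed
  next
    fix e assume "e \<in> edges_of V H p"
    then show "e \<in> bpd_pipe (field_tiling V H) p"
      using edges_of_subset_pipe[OF P] False by (auto simp: edges_of_def)
  qed
qed

section \<open>Monotonicity of the pipes\<close>

lemma bpd_step_deterministic: "bpd_step D e e1 \<Longrightarrow> bpd_step D e e2 \<Longrightarrow> e1 = e2"
  by (auto simp: bpd_step_def prod_eq_iff)

lemma bpd_pipe_chain:
  assumes "e1 \<in> bpd_pipe D p" "e2 \<in> bpd_pipe D p"
  shows "(bpd_step D)\<^sup>*\<^sup>* e1 e2 \<or> (bpd_step D)\<^sup>*\<^sup>* e2 e1"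
proof -
  obtain m1 m2 where "\<forall>i\<ge>m1. (bpd_step D)\<^sup>*\<^sup>* ((i, p), North) e1"
    "\<forall>i\<ge>m2. (bpd_step D)\<^sup>*\<^sup>* ((i, p), North) e2" using assms by (auto simp: bpd_pipe_def)
  then have "(bpd_step D)\<^sup>*\<^sup>* ((m1 + m2, p), North) e1" "(bpd_step D)\<^sup>*\<^sup>* ((m1 + m2, p), North) e2"
    by auto
  then show ?thesis
  proof (induction rule: rtranclp_induct)
    case base
    then show ?case by blast
  next
    case (step y z)
    then have "(bpd_step D)\<^sup>*\<^sup>* y e2 \<or> (bpd_step D)\<^sup>*\<^sup>* e2 y" by blast
    then show ?case
    proof
      assume "(bpd_step D)\<^sup>*\<^sup>* y e2"
      then show ?thesis
        by (cases rule: converse_rtranclpE) (use step.hyps bpd_step_deterministic in \<open>blast+\<close>)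
    qed (use step.hyps in \<open>auto intro: rtranclp.rtrancl_into_rtrancl\<close>)
  qed
qed

lemma turn_North_East: "turn t d = Some d' \<Longrightarrow> (d = North \<or> d = East) \<and> (d' = North \<or> d' = East)"
  by (cases t; cases d; auto)

text \<open>The terms are doubled coordinates of midpoints of edges: the south edge of
  \<open>(i, j)\<close> lies at \<open>(2 * i, 2 * j)\<close> and the west edge at
  \<open>(2 * i - 1, 2 * j - 1)\<close>. Pipes move only north and east.\<close>

lemma bpd_step_rank:
  assumes "(bpd_step D)\<^sup>*\<^sup>* e e'"
  shows "2 * fst (fst e') - (if snd e' = North then 0 else 1) \<le> 2 * fst (fst e) - (if snd e = North then 0 else 1)
    \<and> 2 * snd (fst e) - (if snd e = North then 0 else 1) \<le> 2 * snd (fst e') - (if snd e' = North then 0 else 1)"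
  using assms
proof (induction rule: rtranclp_induct)
  case (step y z)
  have "2 * fst (fst z) - (if snd z = North then 0 else 1) \<le> 2 * fst (fst y) - (if snd y = North then 0 else 1)
    \<and> 2 * snd (fst y) - (if snd y = North then 0 else 1) \<le> 2 * snd (fst z) - (if snd z = North then 0 else 1)"
    using step(2) turn_North_East[of "D (fst y)" "snd y" "snd z"]
    by (cases y; cases z) (auto simp: bpd_step_def)
  then show ?case using step by force
qed auto

text \<open>Two such edges of one pipe would be joined by steps, but already the first step from a
  south edge decreases the doubled row coordinate.\<close>

lemma V_inj:
  assumes P: "label_field n V H" and "V i j = V i k" "V i j \<noteq> 0"
  shows "j = k"
proof -
  let ?D = "field_tiling V H"
  have "j = k" if "(bpd_step ?D)\<^sup>*\<^sup>* ((i, j), North) ((i, k), North)" "i \<noteq> 0" for j k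
    using that(1)
  proof (cases rule: converse_rtranclpE)
    case (step y)
    then have "2 * i \<le> 2 * fst (fst y) - (if snd y = North then 0 else 1)"
      using bpd_step_rank[of ?D y "((i, k), North)"] by auto
    moreover have "2 * fst (fst y) - (if snd y = North then 0 else 1) < 2 * i"
      using step(1) that(2) turn_North_East[of "?D (i, j)" North "snd y"]
      by (cases y) (auto simp: bpd_step_def simp del: field_tiling.simps)
    ultimately show ?thesis by simp
  qed auto
  moreover have "((i, j), North) \<in> bpd_pipe ?D (V i j)" "((i, k), North) \<in> bpd_pipe ?D (V i j)"
    using assms by (auto simp: bpd_pipe_field[OF P])
  moreover have "i \<noteq> 0" using assms(3) label_fieldD(1)[OF P] by metis
  ultimately show ?thesis using bpd_pipe_chain by metis
qed

lemma H_inj: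
  assumes P: "label_field n V H" and "H i j = H k j" "H i j \<noteq> 0"
  shows "i = k"
proof -
  let ?D = "field_tiling V H"
  have "i = k" if "(bpd_step ?D)\<^sup>*\<^sup>* ((i, Suc j), East) ((k, Suc j), East)" for i k
    using that(1)
  proof (cases rule: converse_rtranclpE)
    case (step y)
    then have "2 * snd (fst y) - (if snd y = North then 0 else 1) \<le> 2 * Suc j - 1"
      using bpd_step_rank[of ?D y "((k, Suc j), East)"] by auto
    moreover have "2 * Suc j - 1 < 2 * snd (fst y) - (if snd y = North then 0 else 1)"
      using step(1) turn_North_East[of "?D (i, Suc j)" East "snd y"]
      by (cases y) (auto simp: bpd_step_def simp del: field_tiling.simps)
    ultimately show ?thesis by simp
  qed auto
  moreover have "((i, Suc j), East) \<in> bpd_pipe ?D (H i j)" "((k, Suc j), East) \<in> bpd_pipe ?D (H i j)"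
    using assms by (auto simp: bpd_pipe_field[OF P])
  ultimately show ?thesis using bpd_pipe_chain by metis
qed

lemma label_le_column:
  assumes P: "label_field n V H"
  shows "V i j \<noteq> 0 \<Longrightarrow> V i j \<le> j" "H i j \<noteq> 0 \<Longrightarrow> H i j \<le> j"
proof -
  let ?D = "field_tiling V H"
  have *: "2 * p \<le> 2 * snd (fst e) - (if snd e = North then 0 else 1)" if "e \<in> bpd_pipe ?D p" for e p
  proof -
    obtain m where "(bpd_step ?D)\<^sup>*\<^sup>* ((m, p), North) e" using \<open>e \<in> _\<close> by (auto simp: bpd_pipe_def)
    then show ?thesis using bpd_step_rank[of ?D "((m, p), North)" e] by auto
  qed
  show "V i j \<noteq> 0 \<Longrightarrow> V i j \<le> j"
    using *[of "((i, j), North)" "V i j"] by (auto simp: bpd_pipe_field[OF P])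
  show "H i j \<noteq> 0 \<Longrightarrow> H i j \<le> j"
    using *[of "((i, Suc j), East)" "H i j"] by (auto simp: bpd_pipe_field[OF P])
qed

lemma H_traverse_back:
  assumes P: "label_field n V H" and "H i j = p" "p \<noteq> 0"
  shows "\<exists>k\<ge>1. k \<le> j \<and> V i k = p \<and> (\<forall>m. k \<le> m \<and> m \<le> j \<longrightarrow> H i m = p)"
  using assms(2)
proof (induction j)
  case 0
  then show ?case using label_fieldD(3)[OF P] assms by auto
next
  case (Suc j)
  have "i \<noteq> 0" using Suc.prems assms(3) label_fieldD(4)[OF P] by metis
  then have "paired (V i (Suc j)) (H i j) (V (i - 1) (Suc j)) p"
    using label_fieldD(5)[OF P, of i "Suc j"] Suc by auto
  then consider "H i j = p" | "V i (Suc j) = p" by (auto simp: paired_def)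
  then show ?case
  proof cases
    case 1
    then obtain k where "k\<ge>1" "k \<le> j" "V i k = p" "\<forall>m. k \<le> m \<and> m \<le> j \<longrightarrow> H i m = p" using Suc by auto
    then show ?thesis using Suc.prems by (intro exI[of _ k]) (auto simp: le_Suc_eq)
  next
    case 2
    then show ?thesis using Suc.prems by (intro exI[of _ "Suc j"]) (auto simp: le_Suc_eq)
  qed
qed

lemma H_traverse:
  assumes P: "label_field n V H" and "H i j = p" "p \<noteq> 0"
  shows "(\<exists>k>j. V (i - 1) k = p \<and> (\<forall>m. j \<le> m \<and> m < k \<longrightarrow> H i m = p)) \<or> (\<forall>m\<ge>j. H i m = p)"
proof (cases "\<forall>m\<ge>j. H i m = p")
  case False
  define k where "k = (LEAST k. j \<le> k \<and> H i k \<noteq> p)"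
  have k: "j \<le> k \<and> H i k \<noteq> p" unfolding k_def by (rule LeastI_ex) (use False in auto)
  have lt: "H i m = p" if "j \<le> m" "m < k" for m
    using not_less_Least[of m "\<lambda>k. j \<le> k \<and> H i k \<noteq> p"] that unfolding k_def by auto
  have "j < k" using k assms(2) by (metis le_neq_implies_less)
  then have "paired (V i k) p (V (i - 1) k) (H i k)"
    using label_fieldD(5)[OF P, of i k] lt[of "k - 1"] assms(2,3) label_fieldD(4)[OF P] by (cases "i = 0") auto
  then have "V (i - 1) k = p" using k by (auto simp: paired_def)
  then show ?thesis using lt \<open>j < k\<close> by blast
qed auto

lemma V_below:
  assumes P: "label_field n V H" and "V i k = p" "p \<noteq> 0"
  shows "\<exists>j\<ge>1. j \<le> k \<and> V (Suc i) j = p \<and> (\<forall>m. j \<le> m \<and> m < k \<longrightarrow> H (Suc i) m = p)"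
proof -
  have k: "1 \<le> k" using assms label_fieldD(2)[OF P] by (cases k) auto
  then have "paired (V (Suc i) k) (H (Suc i) (k - 1)) p (H (Suc i) k)"
    using label_fieldD(5)[OF P, of "Suc i" k] assms by simp
  then consider "V (Suc i) k = p" | "H (Suc i) (k - 1) = p" by (auto simp: paired_def)
  then show ?thesis
  proof cases
    case 2
    then obtain j where "j\<ge>1" "j \<le> k - 1" "V (Suc i) j = p" "\<forall>m. j \<le> m \<and> m \<le> k - 1 \<longrightarrow> H (Suc i) m = p"
      using H_traverse_back[OF P] assms(3) by blast
    then show ?thesis using k by (intro exI[of _ j]) auto
  qed (use k in auto)
qed

lemma V_traverse:
  assumes P: "label_field n V H" and "V (Suc i) j = p" "p \<noteq> 0"
  shows "(\<exists>k\<ge>j. V i k = p \<and> (\<forall>m. j \<le> m \<and> m < k \<longrightarrow> H (Suc i) m = p)) \<or> (\<forall>m\<ge>j. H (Suc i) m = p)"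
proof -
  have j: "1 \<le> j" using assms label_fieldD(2)[OF P] by (cases j) auto
  then have "paired p (H (Suc i) (j - 1)) (V i j) (H (Suc i) j)"
    using label_fieldD(5)[OF P, of "Suc i" j] assms by simp
  then consider "V i j = p" | "H (Suc i) j = p" by (auto simp: paired_def)
  then show ?thesis
  proof cases
    case 2
    then show ?thesis using H_traverse[OF P 2 assms(3)] by (auto intro: less_imp_le)
  qed auto
qed

section \<open>The order of the pipes along horizontal lines\<close>

lemma present_iff:
  assumes P: "label_field n V H" and E: "exits \<pi> H" and p: "1 \<le> p"
  shows "(\<exists>j. V i j = p) \<longleftrightarrow> \<pi> p \<le> i"
proof -
  have ex: "\<pi> p = Suc k" if "\<exists>j. V (Suc k) j = p" "\<not> (\<exists>j. V k j = p)" for k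
  proof -
    obtain j where "V (Suc k) j = p" using \<open>\<exists>j. V (Suc k) j = p\<close> by auto
    then have 1: "\<forall>m\<ge>j. H (Suc k) m = p" using V_traverse[OF P, of k j p] p that(2) by auto
    obtain m where 2: "\<forall>j\<ge>m. H (\<pi> p) j = p" using E p by (auto simp: exits_def)
    have "H (Suc k) (j + m) = p" "H (\<pi> p) (j + m) = p" using 1 2 by auto
    then show ?thesis using H_inj[OF P, of "\<pi> p" "j + m" "Suc k"] p by auto
  qed
  have mono: "\<exists>j. V (Suc k) j = p" if "\<exists>j. V k j = p" for k
    using V_below[OF P] that p by (metis not_one_le_zero)
  have mono': "\<exists>j. V l j = p" if "\<exists>j. V k j = p" "k \<le> l" for k l
    using that(2,1)
  proof (induction l rule: dec_induct)
    case (step l)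
    then show ?case using mono[of l] by blast
  qed simp
  have top: "\<exists>j. V (n + p) j = p" using label_fieldD(6)[OF P, of "n + p" p] p by auto
  show ?thesis
  proof
    assume i: "\<exists>j. V i j = p"
    then have "i \<noteq> 0" using label_fieldD(1)[OF P] p by (metis not_one_le_zero)
    have "\<exists>k<i. (\<exists>j. V (Suc k) j = p) \<and> \<not> (\<exists>j. V k j = p)"
    proof (rule ccontr)
      assume *: "\<not> ?thesis"
      have "\<exists>j. V (i - k) j = p" if "k \<le> i" for k
        using that
      proof (induction k)
        case (Suc k)
        then have "Suc (i - Suc k) = i - k" "i - Suc k < i" by auto
        then show ?case using * Suc by (metis Suc_leD)
      qed (use i in simp)
      from this[of i] show False using label_fieldD(1)[OF P] p by auto
    qed
    then show "\<pi> p \<le> i" using ex by (metis Suc_leI)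
  next
    assume *: "\<pi> p \<le> i"
    show "\<exists>j. V i j = p"
    proof (rule ccontr)
      assume i: "\<not> ?thesis"
      have "\<not> (\<exists>j. V k j = p)" if "i \<le> k" for k
        using that
      proof (induction k rule: dec_induct)
        case (step k)
        then show ?case using ex[of k] * by force
      qed (use i in simp)
      moreover have "i \<le> i + (n + p)" by simp
      moreover have "\<exists>j. V (i + (n + p)) j = p" using mono'[OF top] by simp
      ultimately show False by blast
    qed
  qed
qed

text \<open>The order of the pipes between the rows \<open>i\<close> and \<open>i + 1\<close>, for pipes traced upwards: first those still on the
  way, by column, then those that have left the grid, by exit row. It changes exactly at crosses.\<close>

definition before :: "(nat \<Rightarrow> nat) \<Rightarrow> (nat \<Rightarrow> nat \<Rightarrow> nat) \<Rightarrow> nat \<Rightarrow> nat \<Rightarrow> nat \<Rightarrow> bool" where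
  "before \<pi> V i p q \<longleftrightarrow> (\<exists>j k. V i j = p \<and> V i k = q \<and> j < k) \<or>
     (\<pi> p \<le> i \<and> i < \<pi> q) \<or> (i < \<pi> p \<and> \<pi> p < \<pi> q)"

lemma exits_row:
  assumes P: "label_field n V H" and E: "exits \<pi> H" and p: "1 \<le> p" and "\<forall>m\<ge>j. H i m = p"
  shows "\<pi> p = i"
proof -
  obtain m where "\<forall>j\<ge>m. H (\<pi> p) j = p" using E p unfolding exits_def by blast
  then have "H (\<pi> p) (j + m) = p" "H i (j + m) = p" using assms(4) le_add1 le_add2 by blast+
  then show ?thesis using H_inj[OF P, of "\<pi> p" "j + m" i] p by auto
qed

lemma labels_distinct:
  assumes P: "label_field n V H" and "V i j \<noteq> 0" "1 \<le> j"
  shows "H i (j - 1) \<noteq> V i j"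
proof
  assume "H i (j - 1) = V i j"
  then obtain k where "k \<le> j - 1" "V i k = V i j" using H_traverse_back[OF P _ assms(2)] by blast
  then show False using V_inj[OF P, of i k j] assms by auto
qed

lemma before_asym:
  assumes P: "label_field n V H" and E: "exits \<pi> H" and pq: "1 \<le> p" "1 \<le> q"
    and "before \<pi> V i p q"
  shows "\<not> before \<pi> V i q p"
proof (cases "\<exists>j k. V i j = p \<and> V i k = q \<and> j < k")
  case True
  then obtain j k where jk: "V i j = p" "V i k = q" "j < k" by auto
  then have "\<pi> p \<le> i" "\<pi> q \<le> i" using present_iff[OF P E] pq by metis+
  moreover have "j' = j" "k' = k" if "V i j' = p" "V i k' = q" for j' k'
    using V_inj[OF P] that jk pq by (metis not_one_le_zero)+
  ultimately show ?thesis using jk(3) unfolding before_def by fastforce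
next
  case False
  then have *: "(\<pi> p \<le> i \<and> i < \<pi> q) \<or> (i < \<pi> p \<and> \<pi> p < \<pi> q)" using assms unfolding before_def by auto
  then have "\<not> (\<exists>j. V i j = q)" using present_iff[OF P E pq(2), of i] by auto
  then show ?thesis using * unfolding before_def by auto
qed

text \<open>The left one of two pipes can get past the right one only by running horizontally
  through the column in which the right one comes up. A pipe that leaves in this row becomes the
  first of those outside, so leaving alone changes no order.\<close>

lemma before_step:
  assumes P: "label_field n V H" and E: "exits \<pi> H" and pq: "1 \<le> p" "1 \<le> q"
    and B: "before \<pi> V (Suc i) p q"
    and no: "\<And>k. 1 \<le> k \<Longrightarrow> \<not> (H (Suc i) (k - 1) = p \<and> V (Suc i) k = q)"
  shows "before \<pi> V i p q"
proof (cases "\<exists>j k. V (Suc i) j = p \<and> V (Suc i) k = q \<and> j < k")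
  case True
  then obtain j k where jk: "V (Suc i) j = p" "V (Suc i) k = q" "j < k" by auto
  have pq0: "p \<noteq> 0" "q \<noteq> 0" using pq by auto
  have p: "\<exists>l. l < k \<and> V i l = p"
    using V_traverse[OF P jk(1) pq0(1)]
  proof (elim disjE exE conjE)
    fix l assume l: "j \<le> l" "V i l = p" "\<forall>m. j \<le> m \<and> m < l \<longrightarrow> H (Suc i) m = p"
    have "l < k"
    proof (rule ccontr)
      assume "\<not> l < k"
      then have "j \<le> k - 1 \<and> k - 1 < l" using jk(3) by linarith
      then have "H (Suc i) (k - 1) = p" using l(3) by blast
      then show False using no[of k] jk by auto
    qed
    then show ?thesis using l by auto
  next
    assume *: "\<forall>m\<ge>j. H (Suc i) m = p"
    then have "H (Suc i) (k - 1) = p" using jk by auto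
    then show ?thesis using no[of k] jk by auto
  qed
  show ?thesis
    using V_traverse[OF P jk(2) pq0(2)]
  proof (elim disjE exE conjE)
    fix l assume l: "k \<le> l" "V i l = q"
    obtain l' where "l' < k" "V i l' = p" using p by auto
    then have "V i l' = p \<and> V i l = q \<and> l' < l" using l by simp
    then show ?thesis unfolding before_def by blast
  next
    assume "\<forall>m\<ge>k. H (Suc i) m = q"
    then have "\<pi> q = Suc i" using exits_row[OF P E pq(2)] by blast
    moreover have "\<pi> p \<le> i" using p present_iff[OF P E pq(1)] by blast
    ultimately show ?thesis unfolding before_def by auto
  qed
next
  case False
  then show ?thesis using B unfolding before_def by (auto simp: le_Suc_eq)
qed

text \<open>The horizontal pipe comes from the left of the vertical one and continues to its
  right.\<close>

lemma cross_before:
  assumes P: "label_field n V H" and E: "exits \<pi> H" and N: "nobump (0, 0) V H"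
    and pq: "1 \<le> p" "1 \<le> q" and k: "1 \<le> k" "H (Suc i) (k - 1) = p" "V (Suc i) k = q"
  shows "before \<pi> V (Suc i) p q" "before \<pi> V i q p"
proof -
  obtain j where "j \<le> k - 1" "V (Suc i) j = p"
    using H_traverse_back[OF P k(2)] pq by auto
  then have "j < k" "V (Suc i) j = p" using k by auto
  then show "before \<pi> V (Suc i) p q" using k unfolding before_def by auto
  have L: "paired q p (V i k) (H (Suc i) k)" using label_fieldD(5)[OF P, of "Suc i" k] k by simp
  have "p \<noteq> q" using labels_distinct[OF P, of "Suc i" k] k pq by auto
  moreover have "V i k = q" using N k pq unfolding nobump_def by force
  ultimately have vh: "V i k = q" "H (Suc i) k = p" using L by (auto simp: paired_def)
  have p0: "p \<noteq> 0" using pq by auto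
  have "\<pi> q \<le> i" using vh present_iff[OF P E pq(2)] by blast
  show "before \<pi> V i q p"
    using H_traverse[OF P vh(2) p0]
  proof (elim disjE exE conjE)
    fix l assume "k < l" "V (Suc i - 1) l = p"
    then show ?thesis using vh unfolding before_def by auto
  next
    assume "\<forall>m\<ge>k. H (Suc i) m = p"
    then have "\<pi> p = Suc i" using exits_row[OF P E pq(1)] by blast
    then show ?thesis using \<open>\<pi> q \<le> i\<close> unfolding before_def by auto
  qed
qed

lemma before_far:
  assumes P: "label_field n V H" and "n + p + q \<le> i" "p < q" "1 \<le> p"
  shows "before \<pi> V i p q"
  using label_fieldD(6)[OF P, of i p] label_fieldD(6)[OF P, of i q] assms unfolding before_def by auto

lemma before_0: 
  assumes P: "label_field n V H" and E: "exits \<pi> H" and pq: "1 \<le> p" "1 \<le> q" and B: "before \<pi> V 0 p q"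
  shows "\<pi> p < \<pi> q"
  using B label_fieldD(1)[OF P] pq unfolding before_def by auto

definition crosses_in_row :: "(nat \<Rightarrow> nat \<Rightarrow> nat) \<Rightarrow> (nat \<Rightarrow> nat \<Rightarrow> nat) \<Rightarrow> nat \<Rightarrow> nat \<Rightarrow> nat \<Rightarrow> bool" where
  "crosses_in_row V H i p q \<longleftrightarrow> (\<exists>k\<ge>1. H i (k - 1) = p \<and> V i k = q)"

lemma before_persists:
  assumes P: "label_field n V H" and E: "exits \<pi> H" and pq: "1 \<le> p" "1 \<le> q"
    and "before \<pi> V i p q" "l \<le> i" "\<And>k. l < k \<Longrightarrow> k \<le> i \<Longrightarrow> \<not> crosses_in_row V H k p q"
  shows "before \<pi> V l p q"
  using assms(6)
proof (induction l rule: inc_induct)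
  case (step l)
  then show ?case using before_step[OF P E pq step.IH] assms(7)[of "Suc l"]
    unfolding crosses_in_row_def by auto
qed (use assms in simp)

lemma crosses_in_row_pair:
  "1 \<le> i \<Longrightarrow> crosses_in_row V H i p q \<Longrightarrow> 1 \<le> p \<Longrightarrow> 1 \<le> q \<Longrightarrow> (p, q) \<in> cross_pairs (0, 0) V H"
  unfolding crosses_in_row_def cross_pairs_def by auto

lemma cross_pairs_row:
  "(p, q) \<in> cross_pairs (0, 0) V H \<Longrightarrow> \<exists>i\<ge>1. crosses_in_row V H i p q \<and> 1 \<le> p \<and> 1 \<le> q"
  unfolding crosses_in_row_def cross_pairs_def by fastforce

text \<open>Once the larger label stands first, only a cross with the larger label horizontal could
  restore the order, and ascending crosses exclude it.\<close>

lemma ascending_persists: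
  assumes P: "label_field n V H" and E: "exits \<pi> H" and A: "ascending (cross_pairs (0, 0) V H)"
    and pq: "1 \<le> p" "p < q" and "before \<pi> V i q p" "l \<le> i"
  shows "before \<pi> V l q p"
proof (rule before_persists[OF P E _ _ assms(6,7)])
  fix k assume "l < k" "k \<le> i"
  show "\<not> crosses_in_row V H k q p"
  proof
    assume "crosses_in_row V H k q p"
    then have "(q, p) \<in> cross_pairs (0, 0) V H"
      using pq \<open>l < k\<close> by (intro crosses_in_row_pair) auto
    then show False using A pq by (auto simp: ascending_def)
  qed
qed (use pq in auto)

text \<open>The order is that of the labels at the bottom and that of the exit rows at the top, and
  a cross reverses it for good.\<close>

lemma ascending_cross_iff:
  assumes P: "label_field n V H" and E: "exits \<pi> H" and N: "nobump (0, 0) V H"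
    and A: "ascending (cross_pairs (0, 0) V H)" and pq: "1 \<le> p" "p < q"
  shows "(p, q) \<in> cross_pairs (0, 0) V H \<longleftrightarrow> \<pi> q < \<pi> p"
proof
  assume "(p, q) \<in> cross_pairs (0, 0) V H"
  then obtain i where i: "i \<ge> 1" "crosses_in_row V H i p q" using cross_pairs_row by blast
  then obtain i' k where "i = Suc i'" "1 \<le> k" "H (Suc i') (k - 1) = p" "V (Suc i') k = q"
    unfolding crosses_in_row_def by (cases i) auto
  then have "before \<pi> V i' q p" using cross_before[OF P E N] pq by auto
  then have "before \<pi> V 0 q p" using ascending_persists[OF P E A pq] by blast
  then show "\<pi> q < \<pi> p" using before_0[OF P E] pq by auto
next
  assume lt: "\<pi> q < \<pi> p"
  show "(p, q) \<in> cross_pairs (0, 0) V H"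
  proof (rule ccontr)
    assume "\<not> ?thesis"
    then have "\<not> crosses_in_row V H k p q" if "0 < k" for k
      using crosses_in_row_pair[of k V H p q] that pq by auto
    then have "before \<pi> V 0 p q"
      using before_persists[OF P E _ _ before_far[OF P order_refl pq(2,1)], of 0] pq by auto
    then show False using before_0[OF P E, of p q] pq lt by auto
  qed
qed

text \<open>Above the lower of two such crosses the larger label stays first, whereas the upper one
  would need it second.\<close>

lemma ascending_single:
  assumes P: "label_field n V H" and E: "exits \<pi> H" and N: "nobump (0, 0) V H"
    and A: "ascending (cross_pairs (0, 0) V H)"
    and c: "1 \<le> i" "1 \<le> j" "H i (j - 1) = p" "V i j = q" "1 \<le> p" "1 \<le> q"
    and c': "1 \<le> i'" "1 \<le> j'" "H i' (j' - 1) = p" "V i' j' = q"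
  shows "(i, j) = (i', j')"
proof -
  have "(p, q) \<in> cross_pairs (0, 0) V H" using c unfolding cross_pairs_def by auto
  then have pq: "p < q" using A by (auto simp: ascending_def)
  have *: "\<not> i' < i" if "H i (j - 1) = p" "V i j = q" "1 \<le> i" "1 \<le> j" "H i' (j' - 1) = p" "V i' j' = q" "1 \<le> i'" "1 \<le> j'"
    for i i' j j'
  proof
    assume "i' < i"
    obtain k where k: "i = Suc k" using \<open>1 \<le> i\<close> by (cases i) auto
    obtain k' where k': "i' = Suc k'" using \<open>1 \<le> i'\<close> by (cases i') auto
    have "before \<pi> V k q p" using cross_before(2)[OF P E N, of p q j k] that c k by auto
    then have "before \<pi> V i' q p" using ascending_persists[OF P E A c(5) pq] \<open>i' < i\<close> k by auto
    moreover have "before \<pi> V i' p q" using cross_before(1)[OF P E N, of p q j' k'] that c k' by auto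
    ultimately show False using before_asym[OF P E] c by blast
  qed
  have "i = i'" using *[of i j i' j'] *[of i' j' i j] c c' by auto
  moreover have "j = j'" using V_inj[OF P, of i j j'] c c' \<open>i = i'\<close> by auto
  ultimately show ?thesis by simp
qed

text \<open>A cross out of decreasing order presupposes that the order has been reversed further
  down, since at the bottom it is that of the labels.\<close>

lemma descending_double:
  assumes P: "label_field n V H" and E: "exits \<pi> H" and N: "nobump (0, 0) V H"
    and c: "1 \<le> i" "crosses_in_row V H i p q" "1 \<le> q" "q < p"
  shows "\<exists>k>i. crosses_in_row V H k q p"
proof (rule ccontr)
  assume *: "\<not> ?thesis"
  obtain i' k where k: "i = Suc i'" "1 \<le> k" "H (Suc i') (k - 1) = p" "V (Suc i') k = q"
    using c unfolding crosses_in_row_def by (cases i) auto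
  have "before \<pi> V i p q" using cross_before(1)[OF P E N, of p q k i'] k c by auto
  moreover have "before \<pi> V (n + q + p + i) q p" using before_far[OF P] c by auto
  then have "before \<pi> V i q p"
    by (rule before_persists[OF P E, rotated 2]) (use c * in auto)
  ultimately show False using before_asym[OF P E, of p q i] c by auto
qed

lemma passes_field:
  assumes P: "label_field n V H"
  shows "passes (field_tiling V H) p (i, j) \<longleftrightarrow> p \<noteq> 0 \<and> (V i j = p \<or> (j \<noteq> 0 \<and> H i (j - 1) = p))"
proof
  assume "passes (field_tiling V H) p (i, j)"
  then obtain d where "((i, j), d) \<in> edges_of V H p"
    by (auto simp: passes_def bpd_pipe_field[OF P])
  then show "p \<noteq> 0 \<and> (V i j = p \<or> (j \<noteq> 0 \<and> H i (j - 1) = p))" by (cases d) auto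
next
  assume "p \<noteq> 0 \<and> (V i j = p \<or> (j \<noteq> 0 \<and> H i (j - 1) = p))"
  then have "((i, j), North) \<in> edges_of V H p \<or> ((i, j), East) \<in> edges_of V H p" by auto
  then show "passes (field_tiling V H) p (i, j)" unfolding passes_def bpd_pipe_field[OF P] by blast
qed

lemma field_tiling_eq_Cross:
  "field_tiling V H (i, j) = Cross \<longleftrightarrow>
     1 \<le> i \<and> 1 \<le> j \<and> V i j \<noteq> 0 \<and> H i (j - 1) \<noteq> 0 \<and> V (i - 1) j = V i j"
  by (auto simp: tile_at_def)

lemma crossing_field:
  assumes P: "label_field n V H"
  shows "crossing (field_tiling V H) p q (i, j) \<longleftrightarrow>
    1 \<le> i \<and> 1 \<le> j \<and> V (i - 1) j = V i j \<and> p \<noteq> q \<and> p \<noteq> 0 \<and> q \<noteq> 0 \<and>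
    (H i (j - 1) = p \<and> V i j = q \<or> H i (j - 1) = q \<and> V i j = p)"
  unfolding crossing_def passes_field[OF P] field_tiling_eq_Cross by auto

lemma ascending_iff_single_crossing:
  assumes P: "label_field n V H" and E: "exits \<pi> H" and N: "nobump (0, 0) V H"
  shows "ascending (cross_pairs (0, 0) V H) \<longleftrightarrow>
    (\<forall>p q c c'. crossing (field_tiling V H) p q c \<longrightarrow> crossing (field_tiling V H) p q c' \<longrightarrow> c = c')"
    (is "_ \<longleftrightarrow> ?S")
proof
  assume A: "ascending (cross_pairs (0, 0) V H)"
  show ?S
  proof (intro allI impI)
    fix p q c c'
    assume c: "crossing (field_tiling V H) p q c" "crossing (field_tiling V H) p q c'"
    obtain i j i' j' where ij: "c = (i, j)" "c' = (i', j')" by (metis prod.exhaust)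
    have asc: "w < s" if "H i (j - 1) = w" "V i j = s" "1 \<le> i" "1 \<le> j" "w \<noteq> 0" "s \<noteq> 0" for w s i j
    proof -
      have "(w, s) \<in> cross_pairs (0, 0) V H"
        unfolding cross_pairs_def using that by (intro CollectI case_prodI exI[of _ i] exI[of _ j]) auto
      then show ?thesis using A unfolding ascending_def by blast
    qed
    have c1: "1 \<le> i" "1 \<le> j" "p \<noteq> 0" "q \<noteq> 0" "H i (j - 1) = p \<and> V i j = q \<or> H i (j - 1) = q \<and> V i j = p"
      and c2: "1 \<le> i'" "1 \<le> j'" "H i' (j' - 1) = p \<and> V i' j' = q \<or> H i' (j' - 1) = q \<and> V i' j' = p"
      using c unfolding ij crossing_field[OF P] by blast+
    have ge: "1 \<le> p" "1 \<le> q" using c1 by auto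
    show "c = c'"
    proof (cases "p < q")
      case True
      then have "H i (j - 1) = p \<and> V i j = q" "H i' (j' - 1) = p \<and> V i' j' = q"
        using c1 c2 asc[of i j q p] asc[of i' j' q p] by (metis less_asym)+
      then show ?thesis using ascending_single[OF P E N A c1(1,2) _ _ ge c2(1,2)] ij by blast
    next
      case False
      then have "H i (j - 1) = q \<and> V i j = p" "H i' (j' - 1) = q \<and> V i' j' = p"
        using c1 c2 asc[of i j p q] asc[of i' j' p q] by metis+
      then show ?thesis using ascending_single[OF P E N A c1(1,2) _ _ ge(2,1) c2(1,2)] ij by blast
    qed
  qed
next
  assume S: ?S
  show "ascending (cross_pairs (0, 0) V H)"
    unfolding ascending_def
  proof (clarify, rule ccontr)
    fix p q assume pq: "(p, q) \<in> cross_pairs (0, 0) V H" "\<not> p < q"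
    then obtain i j where c: "1 \<le> i" "1 \<le> j" "V i j = q" "H i (j - 1) = p" "p \<noteq> 0" "q \<noteq> 0"
      unfolding cross_pairs_def by auto
    have "p \<noteq> q" using labels_distinct[OF P, of i j] c by auto
    then have "q < p" using pq by auto
    moreover have "crosses_in_row V H i p q" using c unfolding crosses_in_row_def by auto
    ultimately obtain k l where k: "k > i" "1 \<le> l" "H k (l - 1) = q" "V k l = p"
      using descending_double[OF P E N, of i p q] c unfolding crosses_in_row_def by auto
    have n: "V (k - 1) l = V k l" "V (i - 1) j = V i j"
      using N[unfolded nobump_def, rule_format, of k l] N[unfolded nobump_def, rule_format, of i j] c k
      by auto
    have "crossing (field_tiling V H) p q (i, j)" "crossing (field_tiling V H) p q (k, l)"
      unfolding crossing_field[OF P] using n c k \<open>p \<noteq> q\<close> by auto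
    then have "(i, j) = (k, l)" using S by blast
    then show False using k by simp
  qed
qed

section \<open>Bumpless pipe dreams as reduced labellings\<close>

definition reduced_field :: "nat \<Rightarrow> (nat \<Rightarrow> nat) \<Rightarrow> (nat \<Rightarrow> nat \<Rightarrow> nat) \<Rightarrow> (nat \<Rightarrow> nat \<Rightarrow> nat) \<Rightarrow> bool" where
  "reduced_field n \<pi> V H \<longleftrightarrow> label_field n V H \<and> nobump (0, 0) V H \<and> exits \<pi> H \<and> ascending (cross_pairs (0, 0) V H)"

lemma reduced_fieldD:
  assumes "reduced_field n \<pi> V H"
  shows "label_field n V H" "nobump (0, 0) V H" "exits \<pi> H" "ascending (cross_pairs (0, 0) V H)"
  using assms by (auto simp: reduced_field_def)

lemma nobumpD:
  "nobump b V H \<Longrightarrow> i \<noteq> 0 \<Longrightarrow> j \<noteq> 0 \<Longrightarrow> (i, j) \<noteq> b \<Longrightarrow> V i j = 0 \<or> H i (j - 1) = 0 \<or> V (i - 1) j = V i j"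
  unfolding nobump_def by (metis One_nat_def Suc_leI gr0I)

lemma ex_direction: "(\<exists>d. P d) \<longleftrightarrow> P North \<or> P East \<or> P South \<or> P West"
  by (metis direction.exhaust)

lemma has_simps [simp]:
  "has_south t \<longleftrightarrow> t \<in> {Cross, Vertical, RTile, Bump}"
  "has_west t \<longleftrightarrow> t \<in> {Cross, Horizontal, JTile, Bump}"
  "has_north t \<longleftrightarrow> t \<in> {Cross, Vertical, JTile, Bump}"
  "has_east t \<longleftrightarrow> t \<in> {Cross, Horizontal, RTile, Bump}"
  by (cases t; simp add: has_south_def has_west_def has_north_def has_east_def ex_direction)+

lemma field_tiling_edges:
  assumes P: "label_field n V H"
  shows "has_south (field_tiling V H (i, j)) \<longleftrightarrow> V i j \<noteq> 0"
    "has_east (field_tiling V H (i, j)) \<longleftrightarrow> H i j \<noteq> 0"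
    "has_north (field_tiling V H (Suc i, j)) \<longleftrightarrow> V i j \<noteq> 0"
    "has_west (field_tiling V H (i, Suc j)) \<longleftrightarrow> H i j \<noteq> 0"
proof -
  have L: "paired (V i j) (H i (j - 1)) (V (i - 1) j) (H i j)" if "i \<noteq> 0" "j \<noteq> 0" for i j
    using label_fieldD(5)[OF P, of i j] that by simp
  note Z = label_fieldD(1-4)[OF P]
  show "has_south (field_tiling V H (i, j)) \<longleftrightarrow> V i j \<noteq> 0"
    using Z L[of i j] by (cases "i = 0 \<or> j = 0") (auto simp: tile_at_def paired_def)
  show "has_east (field_tiling V H (i, j)) \<longleftrightarrow> H i j \<noteq> 0"
    using Z L[of i j] by (cases "i = 0 \<or> j = 0") (auto simp: tile_at_def paired_def)
  show "has_north (field_tiling V H (Suc i, j)) \<longleftrightarrow> V i j \<noteq> 0"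
    using Z L[of "Suc i" j] by (cases "j = 0") (auto simp: tile_at_def paired_def)
  show "has_west (field_tiling V H (i, Suc j)) \<longleftrightarrow> H i j \<noteq> 0"
    using Z L[of i "Suc j"] by (cases "i = 0") (auto simp: tile_at_def paired_def)
qed

lemma far_row:
  assumes P: "label_field n V H" and "n < i"
  shows "H i j = (if i \<le> j then i else 0)"
proof (induction j)
  case 0
  then show ?case using label_fieldD(3)[OF P] assms by auto
next
  case (Suc j)
  have "paired (V i (Suc j)) (H i j) (V (i - 1) (Suc j)) (H i (Suc j))"
    using label_fieldD(5)[OF P, of i "Suc j"] assms by auto
  moreover have "n \<le> i - 1" using assms by simp
  then have "V i (Suc j) = (if Suc j \<le> i then Suc j else 0)"
    "V (i - 1) (Suc j) = (if Suc j \<le> i - 1 then Suc j else 0)"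
    using label_fieldD(6)[OF P, of i "Suc j"] label_fieldD(6)[OF P, of "i - 1" "Suc j"] assms by auto
  ultimately show ?case using Suc assms by (auto simp: paired_def split: if_splits)
qed

lemma field_drawn_in:
  assumes P: "label_field n V H"
  shows "drawn_in n (field_tiling V H)"
  unfolding drawn_in_def
proof (intro allI impI)
  fix i j assume ij: "1 \<le> i" "1 \<le> j" "n < i \<or> n < j"
  show "field_tiling V H (i, j) = (if i = j then RTile else if i < j then Horizontal else Vertical)"
  proof (cases "n < i")
    case True
    then have "n \<le> i - 1" by simp
    then have "V i j = (if j \<le> i then j else 0)" "V (i - 1) j = (if j \<le> i - 1 then j else 0)"
      using label_fieldD(6)[OF P, of i j] label_fieldD(6)[OF P, of "i - 1" j] ij True by auto
    then show ?thesis using far_row[OF P True] ij by (auto simp: tile_at_def)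
  next
    case False
    then have "V i j = 0" "V (i - 1) j = 0" "H i (j - 1) \<noteq> 0"
      using label_fieldD(6)[OF P, of i j] label_fieldD(6)[OF P, of "i - 1" j] label_fieldD(7)[OF P, of i "j - 1"] ij by auto
    then show ?thesis using ij False by (auto simp: tile_at_def)
  qed
qed

lemma field_in_BPD:
  assumes B: "reduced_field n \<pi> V H"
  shows "field_tiling V H \<in> BPD \<pi>"
proof -
  note P = reduced_fieldD(1)[OF B] and N = reduced_fieldD(2)[OF B] and E = reduced_fieldD(3)[OF B]
  let ?D = "field_tiling V H"
  have "?D c \<noteq> Bump" for c
  proof -
    obtain i j where c: "c = (i, j)" by (cases c)
    show ?thesis
    proof (cases "i = 0 \<or> j = 0")
      case False
      then have "V i j = 0 \<or> H i (j - 1) = 0 \<or> V (i - 1) j = V i j" using nobumpD[OF N, of i j] by simp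
      then show ?thesis using False unfolding c by (elim disjE) (simp_all add: tile_at_def)
    qed (simp add: c)
  qed
  moreover have "?D c = Blank" if "\<not> in_grid c" for c
    using that by (cases c) (auto simp: in_grid_def)
  moreover have "\<exists>m. \<forall>j\<ge>m. ((\<pi> p, j), East) \<in> bpd_pipe ?D p" if p: "1 \<le> p" for p
  proof -
    obtain m where m: "\<forall>j\<ge>m. H (\<pi> p) j = p" using E p unfolding exits_def by blast
    have "((\<pi> p, j), East) \<in> bpd_pipe ?D p" if "j \<ge> Suc m" for j
      using m that p by (simp add: bpd_pipe_field[OF P])
    then show ?thesis by blast
  qed
  moreover have "\<forall>p q c c'. crossing ?D p q c \<longrightarrow> crossing ?D p q c' \<longrightarrow> c = c'"
    using ascending_iff_single_crossing[OF P E N] reduced_fieldD(4)[OF B] by blast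
  moreover have "\<exists>n. drawn_in n ?D" using field_drawn_in[OF P] by blast
  moreover have "has_north (?D (Suc i, j)) = has_south (?D (i, j))" for i j
    unfolding field_tiling_edges[OF P] ..
  moreover have "has_east (?D (i, j)) = has_west (?D (i, Suc j))" for i j
    unfolding field_tiling_edges[OF P] ..
  ultimately show ?thesis unfolding BPD_def by blast
qed

text \<open>\<open>True\<close> selects the south edge of the cell, \<open>False\<close> the east edge; the recursion follows the pipe
  backwards.\<close>

function edge_label :: "(cell \<Rightarrow> tile) \<Rightarrow> nat \<Rightarrow> bool \<Rightarrow> nat \<Rightarrow> nat \<Rightarrow> nat" where
  "edge_label D n True i j =
     (if n \<le> i then (if 1 \<le> j \<and> j \<le> i then j else 0)
      else if D (Suc i, j) = Vertical \<or> D (Suc i, j) = Cross then edge_label D n True (Suc i) j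
      else if D (Suc i, j) = JTile then edge_label D n False (Suc i) (j - 1) else 0)"
| "edge_label D n False i j =
     (if j = 0 then 0
      else if D (i, j) = Horizontal \<or> D (i, j) = Cross then edge_label D n False i (j - 1)
      else if D (i, j) = RTile then edge_label D n True i j else 0)"
  by pat_completeness auto
termination
  by (relation "measure (\<lambda>(D, n, south, i, j). 2 * ((n - i) + j) + (if south then 0 else 1))") auto

declare edge_label.simps [simp del]

text \<open>Every used edge is labelled by tracing it back to its entry column. The trace never gets
  stuck, because edges of adjacent tiles match and no pipe touches the north or west
  boundary.\<close>

lemma BPD_imp_field:
  assumes D: "D \<in> BPD \<pi>"
  shows "\<exists>n V H. reduced_field n \<pi> V H \<and> D = field_tiling V H"
proof -
  obtain n where dr: "drawn_in n D" using D by (auto simp: BPD_def)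
  have out: "D (0, j) = Blank" "D (i, 0) = Blank" for i j
    using D by (auto simp: BPD_def in_grid_def)
  have nb: "D c \<noteq> Bump" for c using D unfolding BPD_def by blast
  have NS: "has_north (D (Suc i, j)) = has_south (D (i, j))" for i j using D unfolding BPD_def by blast
  have EW: "has_east (D (i, j)) = has_west (D (i, Suc j))" for i j using D unfolding BPD_def by blast
  have far: "D (i, j) = (if i = j then RTile else if i < j then Horizontal else Vertical)"
    if "1 \<le> i" "1 \<le> j" "n < i \<or> n < j" for i j using dr that unfolding drawn_in_def by blast
  \<comment> \<open>The summand 1 makes the step from an east edge to the south edge of the same
    cell decrease.\<close>
  have *: "edge_label D n b i j \<noteq> 0 \<longleftrightarrow> (if b then has_south (D (i, j)) else has_east (D (i, j)))"
    for b i j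
  proof (induction "2 * ((n - i) + j) + (if b then 0 else 1)" arbitrary: b i j rule: less_induct)
    case less
    show ?case
    proof (cases b)
      case b: True
      show ?thesis
      proof (cases "n \<le> i")
        case True
        have "has_south (D (i, j)) \<longleftrightarrow> 1 \<le> j \<and> j \<le> i"
          unfolding NS[symmetric] using out far[of "Suc i" j] True by (cases "j = 0") auto
        then show ?thesis using b True by (simp add: edge_label.simps(1))
      next
        case False
        have S: "has_south (D (i, j)) = has_north (D (Suc i, j))" using NS by simp
        consider "D (Suc i, j) = Vertical \<or> D (Suc i, j) = Cross" | "D (Suc i, j) = JTile"
          | "D (Suc i, j) \<notin> {Vertical, Cross, JTile}" by blast
        then show ?thesis
        proof cases
          case 1
          then show ?thesis using less[of "Suc i" j True] False b S by (auto simp: edge_label.simps(1)[of D n i])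
        next
          case 2
          then have j: "j \<noteq> 0" using out by (cases j) auto
          then have "has_east (D (Suc i, j - 1))" using EW[of "Suc i" "j - 1"] 2 by auto
          then show ?thesis using less[of "Suc i" "j - 1" False] False b S 2 j
            by (auto simp: edge_label.simps(1)[of D n i])
        next
          case 3
          then show ?thesis using nb[of "(Suc i, j)"] b S False by (auto simp: edge_label.simps(1)[of D n i])
        qed
      qed
    next
      case b: False
      show ?thesis
      proof (cases "j = 0")
        case True
        then show ?thesis using b out by (simp add: edge_label.simps(2))
      next
        case False
        consider "D (i, j) = Horizontal \<or> D (i, j) = Cross" | "D (i, j) = RTile"
          | "D (i, j) \<notin> {Horizontal, Cross, RTile}" by blast
        then show ?thesis
        proof cases
          case 1
          then have "has_east (D (i, j - 1))" using EW[of i "j - 1"] False by auto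
          then show ?thesis using less[of i "j - 1" False] 1 False b by (auto simp: edge_label.simps(2)[of D n i])
        next
          case 2
          then show ?thesis using less[of i j True] False b by (auto simp: edge_label.simps(2)[of D n i])
        next
          case 3
          then show ?thesis using nb[of "(i, j)"] b False by (auto simp: edge_label.simps(2)[of D n i])
        qed
      qed
    qed
  qed
  define V where "V = edge_label D n True"
  define H where "H = edge_label D n False"
  have Vn: "V i j \<noteq> 0 \<longleftrightarrow> has_south (D (i, j))" and Hn: "H i j \<noteq> 0 \<longleftrightarrow> has_east (D (i, j))" for i j
    using * by (auto simp: V_def H_def)
  have V: "V i j =
     (if n \<le> i then (if 1 \<le> j \<and> j \<le> i then j else 0)
      else if D (Suc i, j) = Vertical \<or> D (Suc i, j) = Cross then V (Suc i) j
      else if D (Suc i, j) = JTile then H (Suc i) (j - 1) else 0)" for i j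
    unfolding V_def H_def by (subst edge_label.simps) simp
  have H: "H i j = (if j = 0 then 0
      else if D (i, j) = Horizontal \<or> D (i, j) = Cross then H i (j - 1)
      else if D (i, j) = RTile then V i j else 0)" for i j
    unfolding V_def H_def by (subst edge_label.simps) simp
  have W: "H i (j - 1) \<noteq> 0 \<longleftrightarrow> has_west (D (i, j))" if "1 \<le> j" for i j
    using Hn[of i "j - 1"] EW[of i "j - 1"] that by simp
  have Vup: "V (i - 1) j = (if D (i, j) = Vertical \<or> D (i, j) = Cross then V i j
      else if D (i, j) = JTile then H i (j - 1) else 0)" if ij: "1 \<le> i" "1 \<le> j" for i j
  proof (cases "n \<le> i - 1")
    case True
    then have "n < i" using ij by simp
    then have "D (i, j) = (if i = j then RTile else if i < j then Horizontal else Vertical)" "V i j = (if j \<le> i then j else 0)"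
      "V (i - 1) j = (if j \<le> i - 1 then j else 0)"
      using far[of i j] ij V[of i j] V[of "i - 1" j] by auto
    then show ?thesis using ij by auto
  next
    case False
    then show ?thesis using V[of "i - 1" j] ij by auto
  qed
  have tiles: "D (i, j) = tile_at (V i j) (H i (j - 1)) (V (i - 1) j) (H i j) \<and>
      paired (V i j) (H i (j - 1)) (V (i - 1) j) (H i j) \<and>
      (V i j = 0 \<or> H i (j - 1) = 0 \<or> V (i - 1) j = V i j)" if ij: "1 \<le> i" "1 \<le> j" for i j
    using Vn[of i j] Hn[of i j] W[of j i] Vup[OF ij] H[of i j] ij nb[of "(i, j)"]
    by (cases "D (i, j)") (simp_all add: tile_at_def paired_def)
  have P: "label_field n V H"
    unfolding label_field_def
  proof (intro conjI allI impI)
    show "V 0 j = 0" "V i 0 = 0" "H i 0 = 0" "H 0 j = 0" for i j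
      using Vn[of 0 j] Vn[of i 0] Hn[of i 0] Hn[of 0 j] out by auto
    show "paired (V i j) (H i (j - 1)) (V (i - 1) j) (H i j)" if "1 \<le> i" "1 \<le> j" for i j
      using tiles[OF that] by blast
    show "V i j = (if 1 \<le> j \<and> j \<le> i then j else 0)" if "n \<le> i \<or> n < j" for i j
    proof (cases "n \<le> i")
      case True
      then show ?thesis using V[of i j] by simp
    next
      case False
      then have "\<not> has_south (D (i, j))" using far[of i j] that out by (cases "i = 0") auto
      then show ?thesis using Vn[of i j] False that by auto
    qed
    show "H i j \<noteq> 0" if "1 \<le> i" "n \<le> j" "i \<le> j" for i j
      using that far[of i "Suc j"] Hn[of i j] EW[of i j] by auto
  qed
  have eq: "D = field_tiling V H"
  proof
    fix c show "D c = field_tiling V H c"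
      using tiles[of "fst c" "snd c"] out by (cases c) auto
  qed
  have N: "nobump (0, 0) V H" unfolding nobump_def using tiles by blast
  have E: "exits \<pi> H"
    unfolding exits_def
  proof (intro allI impI)
    fix p :: nat assume p: "1 \<le> p"
    then obtain m where m: "\<forall>j\<ge>m. ((\<pi> p, j), East) \<in> bpd_pipe D p" using D unfolding BPD_def by blast
    have "H (\<pi> p) j = p" if "j \<ge> m" for j
      using m[rule_format, of "Suc j"] that by (simp add: eq bpd_pipe_field[OF P])
    then show "\<exists>m. \<forall>j\<ge>m. H (\<pi> p) j = p" by blast
  qed
  have "\<forall>p q c c'. crossing D p q c \<longrightarrow> crossing D p q c' \<longrightarrow> c = c'" using D unfolding BPD_def by blast
  then have "ascending (cross_pairs (0, 0) V H)"
    using ascending_iff_single_crossing[OF P E N] unfolding eq by blast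
  then show ?thesis using P N E eq unfolding reduced_field_def by blast
qed

definition south_columns :: "(cell \<Rightarrow> tile) \<Rightarrow> nat \<Rightarrow> nat set" where
  "south_columns D i = {j. has_south (D (i, j))}"

lemma south_columns_field: "label_field n V H \<Longrightarrow> south_columns (field_tiling V H) i = {j. V i j \<noteq> 0}"
  unfolding south_columns_def field_tiling_edges ..

text \<open>The used east edges follow from the used south edges by counting, cell by cell from the
  left, and a cell with all four edges used can only be a cross.\<close>

lemma BPD_eqI:
  assumes "D \<in> BPD \<pi>" "D' \<in> BPD \<pi>'" "\<And>i. south_columns D i = south_columns D' i"
  shows "D = D'"
proof -
  obtain n V H where f: "reduced_field n \<pi> V H" "D = field_tiling V H" using BPD_imp_field[OF assms(1)] by blast
  obtain n' V' H' where f': "reduced_field n' \<pi>' V' H'" "D' = field_tiling V' H'" using BPD_imp_field[OF assms(2)] by blast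
  note P = reduced_fieldD(1)[OF f(1)] and P' = reduced_fieldD(1)[OF f'(1)]
  have VV: "V i j \<noteq> 0 \<longleftrightarrow> V' i j \<noteq> 0" for i j
    using assms(3)[of i] unfolding f(2) f'(2) south_columns_field[OF P] south_columns_field[OF P'] by blast
  have HH: "H i j \<noteq> 0 \<longleftrightarrow> H' i j \<noteq> 0" for i j
  proof (induction j)
    case 0
    then show ?case using label_fieldD(3)[OF P] label_fieldD(3)[OF P'] by simp
  next
    case (Suc j)
    show ?case
    proof (cases "i = 0")
      case True
      then show ?thesis using label_fieldD(4)[OF P] label_fieldD(4)[OF P'] by simp
    next
      case False
      then have "paired (V i (Suc j)) (H i j) (V (i - 1) (Suc j)) (H i (Suc j))"
        "paired (V' i (Suc j)) (H' i j) (V' (i - 1) (Suc j)) (H' i (Suc j))"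
        using label_fieldD(5)[OF P, of i "Suc j"] label_fieldD(5)[OF P', of i "Suc j"] by auto
      then show ?thesis using VV[of i "Suc j"] VV[of "i - 1" "Suc j"] Suc by (auto simp: paired_def)
    qed
  qed
  have "field_tiling V H (i, j) = field_tiling V' H' (i, j)" for i j
  proof (cases "i = 0 \<or> j = 0")
    case False
    have "V i j \<noteq> 0 \<and> H i (j - 1) \<noteq> 0 \<Longrightarrow> V (i - 1) j = V i j"
      "V' i j \<noteq> 0 \<and> H' i (j - 1) \<noteq> 0 \<Longrightarrow> V' (i - 1) j = V' i j"
      using nobumpD[OF reduced_fieldD(2)[OF f(1)], of i j] nobumpD[OF reduced_fieldD(2)[OF f'(1)], of i j] False by auto
    then show ?thesis using False VV[of i j] HH[of i "j - 1"] VV[of "i - 1" j] HH[of i j]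
      by (simp add: tile_at_def)
  qed auto
  then show ?thesis unfolding f f' by (intro ext) (metis surj_pair)
qed

section \<open>Column moves\<close>

definition moveV :: "nat \<Rightarrow> nat \<Rightarrow> nat \<Rightarrow> (nat \<Rightarrow> nat \<Rightarrow> nat) \<Rightarrow> nat \<Rightarrow> nat \<Rightarrow> nat" where
  "moveV y x x' V i j = (if x \<le> i \<and> i < x' then V i (transpose y (Suc y) j) else V i j)"

text \<open>Only east edges of column \<open>y\<close> change. Strictly between the rows
  \<open>x\<close> and \<open>x'\<close> the pipe arriving from the left now goes straight through
  \<open>p\<close> in column \<open>y\<close> and turns, if at all, in column
  \<open>y + 1\<close>.\<close>

definition moveH :: "nat \<Rightarrow> nat \<Rightarrow> nat \<Rightarrow> nat \<Rightarrow> (nat \<Rightarrow> nat \<Rightarrow> nat) \<Rightarrow> nat \<Rightarrow> nat \<Rightarrow> nat" where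
  "moveH y x x' p H i j =
     (if j = y then (if i = x then p else if i = x' then 0 else if x < i \<and> i < x' then H i (y - 1) else H i y)
      else H i j)"

text \<open>The mirror image: with \<open>p\<close> back in column \<open>y + 1\<close>, a label on
  the east side of that column must have come straight through it.\<close>

definition unmoveH :: "nat \<Rightarrow> nat \<Rightarrow> nat \<Rightarrow> nat \<Rightarrow> (nat \<Rightarrow> nat \<Rightarrow> nat) \<Rightarrow> nat \<Rightarrow> nat \<Rightarrow> nat" where
  "unmoveH y x x' p H i j =
     (if j = y then (if i = x then 0 else if i = x' then p else if x < i \<and> i < x' then H i (Suc y) else H i y)
      else H i j)"

lemma moveV_simps:
  "x \<le> i \<Longrightarrow> i < x' \<Longrightarrow> moveV y x x' V i y = V i (Suc y)"
  "x \<le> i \<Longrightarrow> i < x' \<Longrightarrow> moveV y x x' V i (Suc y) = V i y"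
  "j \<noteq> y \<Longrightarrow> j \<noteq> Suc y \<Longrightarrow> moveV y x x' V i j = V i j"
  "i < x \<or> x' \<le> i \<Longrightarrow> moveV y x x' V i j = V i j"
  by (auto simp: moveV_def transpose_def)

lemma moveV_pred:
  "i < x \<or> x' < i \<Longrightarrow> moveV y x x' V (i - Suc 0) j = V (i - Suc 0) j"
  "1 \<le> x \<Longrightarrow> moveV y x x' V (x - Suc 0) j = V (x - Suc 0) j"
  "x < i \<Longrightarrow> i \<le> x' \<Longrightarrow> moveV y x x' V (i - Suc 0) y = V (i - Suc 0) (Suc y)"
  "x < i \<Longrightarrow> i \<le> x' \<Longrightarrow> moveV y x x' V (i - Suc 0) (Suc y) = V (i - Suc 0) y"
  by (auto simp: moveV_def transpose_def)

lemma ascendingD: "ascending X \<Longrightarrow> (w, s) \<in> X \<Longrightarrow> w < s"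
  unfolding ascending_def by blast

locale column_swap =
  fixes n y x x' p :: nat and V H :: "nat \<Rightarrow> nat \<Rightarrow> nat"
  assumes P: "label_field n V H"
    and N: "nobump (x', Suc y) V H"
    and A: "ascending (cross_pairs (x', Suc y) V H)"
    and xy: "1 \<le> x" "1 \<le> y" "y < n" "x < x'" "p \<noteq> 0"
begin

lemma x'_pred: "x \<le> x' - 1" "x' - 1 < x'" "x' \<noteq> 0"
  using xy by auto

end

lemma cross_pairsI:
  "1 \<le> i \<Longrightarrow> 1 \<le> j \<Longrightarrow> (i, j) \<noteq> b \<Longrightarrow> V i j = s \<Longrightarrow> H i (j - 1) = w \<Longrightarrow> s \<noteq> 0 \<Longrightarrow> w \<noteq> 0 \<Longrightarrow> (w, s) \<in> cross_pairs b V H"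
  unfolding cross_pairs_def by (intro CollectI case_prodI exI[of _ i] exI[of _ j]) auto

text \<open>The last assumption covers both kinds of bottom tile: \<open>V x' (Suc y) = 0\<close> at a j-tile and
  \<open>V x' (Suc y) \<noteq> 0\<close> at a bump.\<close>

locale forward_move = column_swap +
  assumes blank: "V x y = 0" "V (x - 1) y = 0" "H x (y - 1) = 0" "H x y = 0"
    and col: "\<And>i. x \<le> i \<Longrightarrow> i < x' \<Longrightarrow> V i (Suc y) = p"
    and bottom: "H x' y = p" "H x' (Suc y) = V x' (Suc y)"
begin

abbreviation "V' \<equiv> moveV y x x' V"
abbreviation "H' \<equiv> moveH y x x' p H"

lemma cell: "1 \<le> i \<Longrightarrow> 1 \<le> j \<Longrightarrow> paired (V i j) (H i (j - 1)) (V (i - 1) j) (H i j)"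
  using label_fieldD(5)[OF P] .

lemma no_bump: "1 \<le> i \<Longrightarrow> 1 \<le> j \<Longrightarrow> (i, j) \<noteq> (x', Suc y) \<Longrightarrow>
    V i j = 0 \<or> H i (j - 1) = 0 \<or> V (i - 1) j = V i j"
  by (rule nobumpD[OF N]) auto

lemma inner_right: 
  assumes "x < i" "i < x'" shows "H i (Suc y) = H i y"
  using cell[of i "Suc y"] col[of i] col[of "i - 1"] assms xy by (auto simp: paired_def)

text \<open>The blank at \<open>(x, y)\<close> blocks column \<open>y\<close>, so a pipe in it must
  turn right below the blank and then runs through \<open>p\<close>.\<close>

lemma col_left_label: "x \<le> i \<Longrightarrow> i < x' \<Longrightarrow> V i y \<noteq> 0 \<Longrightarrow> (V i y, p) \<in> cross_pairs (x', Suc y) V H"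
proof (induction i rule: dec_induct)
  case base
  then show ?case using blank by simp
next
  case (step i)
  let ?q = "V (Suc i) y"
  have "paired ?q (H (Suc i) (y - 1)) (V i y) (H (Suc i) y)" using cell[of "Suc i" y] xy by simp
  then consider "V i y = ?q" | "H (Suc i) y = ?q" by (auto simp: paired_def)
  then show ?case
  proof cases
    case 1
    then show ?thesis using step by simp
  next
    case 2
    then show ?thesis
      using cross_pairsI[of "Suc i" "Suc y" "(x', Suc y)" V p H ?q] col[of "Suc i"] step xy by simp
  qed
qed

text \<open>A pipe \<open>q\<close> there runs horizontally through \<open>p\<close> further up, and
  \<open>p\<close> would run horizontally through \<open>q\<close> at \<open>(x', y)\<close>. The
  first cross requires \<open>q < p\<close>, the second \<open>p < q\<close>.\<close>

lemma above_bottom: "V (x' - 1) y = 0"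
proof (rule ccontr)
  assume q: "V (x' - 1) y \<noteq> 0"
  then have lt: "V (x' - 1) y < p"
    using col_left_label[of "x' - 1"] ascendingD[OF A] x'_pred by blast
  have "paired (V x' y) (H x' (y - 1)) (V (x' - 1) y) p" using cell[of x' y] bottom xy by simp
  moreover have "V x' y = 0 \<or> H x' (y - 1) = 0 \<or> V (x' - 1) y = V x' y" using no_bump[of x' y] xy by auto
  ultimately have "V x' y = V (x' - 1) y" "H x' (y - 1) = p" using q xy by (auto simp: paired_def)
  then have "(p, V (x' - 1) y) \<in> cross_pairs (x', Suc y) V H"
    using cross_pairsI[of x' y "(x', Suc y)" V _ H p] q xy by auto
  then show False using lt ascendingD[OF A] by fastforce
qed

lemma x'_le: "x' \<le> n"
proof (rule ccontr)
  assume "\<not> x' \<le> n"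
  then have "V (x' - 1) y = y" using label_fieldD(6)[OF P, of "x' - 1" y] xy by auto
  then show False using above_bottom xy by auto
qed

lemma label_field': "label_field n V' H'"
  unfolding label_field_def
proof (intro conjI allI impI)
  note Z = label_fieldD(1-4)[OF P]
  show "V' 0 j = 0" "V' i 0 = 0" "H' i 0 = 0" "H' 0 j = 0" for i j
    using Z xy by (auto simp: moveV_def moveH_def transpose_def)
  show "paired (V' i j) (H' i (j - 1)) (V' (i - 1) j) (H' i j)" if ij: "1 \<le> i" "1 \<le> j" for i j
  proof -
    consider "j \<noteq> y" "j \<noteq> Suc y" | "j = y" | "j = Suc y" by blast
    then show ?thesis
    proof cases
      case 1
      then have "j - 1 \<noteq> y" using ij by auto
      then show ?thesis using cell[OF ij] 1 by (simp add: moveV_simps moveV_pred moveH_def)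
    next
      case j: 2
      have y1: "y - 1 \<noteq> y" using xy by simp
      consider "i < x" | "i = x" | "x < i" "i < x'" | "i = x'" | "x' < i" by linarith
      then show ?thesis
      proof cases
        case 3
        then show ?thesis using j y1 col[of i] col[of "i - 1"]
          by (simp add: moveV_simps moveV_pred moveH_def paired_def)
      next
        case 4
        then show ?thesis using cell[of x' y] j y1 xy above_bottom bottom col[of "x' - 1"]
          by (auto simp: moveV_simps moveV_pred moveH_def paired_def)
      qed (use cell[of i y] ij j y1 xy blank col[of x] in \<open>auto simp: moveV_simps moveV_pred moveH_def paired_def\<close>)
    next
      case j: 3
      consider "i < x" | "i = x" | "x < i" "i < x'" | "i = x'" | "x' < i" by linarith
      then show ?thesis
      proof cases
        case 3
        then show ?thesis using cell[of i y] j inner_right[of i] xy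
          by (auto simp: moveV_simps moveV_pred moveH_def)
      next
        case 4
        then show ?thesis using cell[of x' "Suc y"] j xy above_bottom bottom
          by (auto simp: moveV_simps moveV_pred moveH_def paired_def)
      qed (use cell[of i "Suc y"] ij j xy blank col[of x] in \<open>auto simp: moveV_simps moveV_pred moveH_def paired_def\<close>)
    qed
  qed
  show "V' i j = (if 1 \<le> j \<and> j \<le> i then j else 0)" if "n \<le> i \<or> n < j" for i j
  proof -
    have "V' i j = V i j"
      using that x'_le xy by (cases "n \<le> i") (auto simp: moveV_def transpose_def)
    then show ?thesis using label_fieldD(6)[OF P that] by simp
  qed
  show "H' i j \<noteq> 0" if "1 \<le> i" "n \<le> j" "i \<le> j" for i j
    using label_fieldD(7)[OF P that] that xy by (auto simp: moveH_def)
qed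

text \<open>No new pair of labels comes to cross. A pipe that now crosses \<open>p\<close> in column
  \<open>y\<close> either ran straight on before and crossed \<open>p\<close> in column
  \<open>y + 1\<close>, or it turned up in column \<open>y\<close> and met \<open>p\<close> higher
  up. The crosses of column \<open>y\<close> reappear in column \<open>y + 1\<close>.\<close>

lemma new_cross:
  assumes ij: "1 \<le> i" "1 \<le> j" "V' i j \<noteq> 0" "H' i (j - 1) \<noteq> 0"
  shows "(H' i (j - 1), V' i j) \<in> cross_pairs (x', Suc y) V H \<and> V' (i - 1) j = V' i j"
proof -
  have old: "(H i (j - 1), V i j) \<in> cross_pairs (x', Suc y) V H \<and> V (i - 1) j = V i j"
    if "1 \<le> i" "1 \<le> j" "V i j \<noteq> 0" "H i (j - 1) \<noteq> 0" "(i, j) \<noteq> (x', Suc y)" for i j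
    using cross_pairsI[of i j "(x', Suc y)" V "V i j" H "H i (j - 1)"] no_bump[of i j] that by auto
  consider "j \<noteq> y" "j \<noteq> Suc y" | "j = y" | "j = Suc y" by blast
  then show ?thesis
  proof cases
    case 1
    then have "j - 1 \<noteq> y" using ij by auto
    then show ?thesis using old[of i j] ij 1 by (auto simp: moveV_simps moveV_pred moveH_def)
  next
    case j: 2
    have y1: "y - 1 \<noteq> y" using xy by simp
    consider "i < x \<or> x' < i" | "i = x" | "x < i" "i < x'" | "i = x'" by linarith
    then show ?thesis
    proof cases
      case 1
      then show ?thesis using old[of i j] ij j y1 by (auto simp: moveV_simps moveV_pred moveH_def)
    next
      case 2
      then show ?thesis using ij j y1 blank by (auto simp: moveH_def)
    next
      case i: 3
      then have u: "H i (y - 1) \<noteq> 0" "V' i j = p" "H' i (j - 1) = H i (y - 1)" "V' (i - 1) j = p"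
        using ij j y1 col[of i] col[of "i - 1"] by (auto simp: moveV_simps moveV_pred moveH_def)
      have "paired (V i y) (H i (y - 1)) (V (i - 1) y) (H i y)" using cell[of i y] ij j by simp
      then consider "H i y = H i (y - 1)" | "V (i - 1) y = H i (y - 1)" by (auto simp: paired_def)
      then show ?thesis
      proof cases
        case 1
        then show ?thesis using old[of i "Suc y"] i u col[of i] xy by auto
      next
        case 2
        then show ?thesis using col_left_label[of "i - 1"] i u by auto
      qed
    next
      case 4
      have "paired (V x' y) (H x' (y - 1)) 0 p" using cell[of x' y] xy above_bottom bottom by simp
      then have "V x' y = 0 \<or> H x' (y - 1) = 0" by (auto simp: paired_def)
      then show ?thesis using ij j y1 4 by (auto simp: moveV_simps moveV_pred moveH_def)
    qed
  next
    case j: 3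
    consider "i < x \<or> x' < i" | "i = x" | "x < i" "i < x'" | "i = x'" by linarith
    then show ?thesis
    proof cases
      case 1
      then have "V' (i - 1) j = V (i - 1) j" by (auto simp: moveV_simps moveV_pred)
      then show ?thesis using 1 old[of i j] ij j xy by (auto simp: moveV_simps moveV_pred moveH_def)
    next
      case 2
      then show ?thesis using ij j blank xy by (auto simp: moveV_simps moveV_pred)
    next
      case 3
      then show ?thesis using old[of i y] ij j xy by (auto simp: moveV_simps moveV_pred moveH_def)
    next
      case 4
      then show ?thesis using ij j xy by (auto simp: moveH_def)
    qed
  qed
qed

lemma nobump': "nobump (0, 0) V' H'"
  unfolding nobump_def using new_cross by blast

lemma cross_pairs': "cross_pairs (0, 0) V' H' \<subseteq> cross_pairs (x', Suc y) V H"
  unfolding cross_pairs_def[of "(0, 0)"] using new_cross by blast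

lemma ascending': "ascending (cross_pairs (0, 0) V' H')"
  using A cross_pairs' unfolding ascending_def by blast

lemma exits': "exits \<pi> H \<Longrightarrow> exits \<pi> H'"
  unfolding exits_def
proof (intro allI impI)
  fix p' :: nat assume "\<forall>p\<ge>1. \<exists>m. \<forall>j\<ge>m. H (\<pi> p) j = p" "1 \<le> p'"
  then obtain m where "\<forall>j\<ge>m. H (\<pi> p') j = p'" by blast
  then have "H' (\<pi> p') j = p'" if "j \<ge> max m (Suc y)" for j using that by (auto simp: moveH_def)
  then show "\<exists>m. \<forall>j\<ge>m. H' (\<pi> p') j = p'" by blast
qed

end

text \<open>The configuration left by a forward move: \<open>p\<close> runs in column
  \<open>y\<close> up to its r-turn in row \<open>x\<close>, and column \<open>y + 1\<close> is
  empty just above row \<open>x'\<close>. A bump can appear only in the result, so the given field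
  satisfies its conditions at all cells.\<close>

locale backward_move = column_swap +
  assumes top: "V (x - 1) y = 0"
    and col: "\<And>i. x \<le> i \<Longrightarrow> i < x' \<Longrightarrow> V i y = p"
    and bottom: "V (x' - 1) (Suc y) = 0" "H x' y = 0" "H x' (Suc y) = V x' (Suc y)"
    and N0: "nobump (0, 0) V H"
    and A0: "ascending (cross_pairs (0, 0) V H)"
begin

abbreviation "V' \<equiv> moveV y x x' V"
abbreviation "H' \<equiv> unmoveH y x x' p H"

lemma cell: "1 \<le> i \<Longrightarrow> 1 \<le> j \<Longrightarrow> paired (V i j) (H i (j - 1)) (V (i - 1) j) (H i j)"
  using label_fieldD(5)[OF P] .

lemma no_bump: "1 \<le> i \<Longrightarrow> 1 \<le> j \<Longrightarrow> V i j = 0 \<or> H i (j - 1) = 0 \<or> V (i - 1) j = V i j"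
  by (rule nobumpD[OF N0]) auto

lemma inner_left: 
  assumes "x < i" "i < x'" shows "H i y = H i (y - 1)"
  using cell[of i y] col[of i] col[of "i - 1"] assms xy by (auto simp: paired_def)

text \<open>Column \<open>y + 1\<close> is empty just above row \<open>x'\<close>, so a pipe in it
  has entered from the left, through the vertical pipe \<open>p\<close> in column
  \<open>y\<close>.\<close>

lemma col_right_label: "x \<le> i \<Longrightarrow> i \<le> x' - 1 \<Longrightarrow> V i (Suc y) \<noteq> 0 \<Longrightarrow> (V i (Suc y), p) \<in> cross_pairs (0, 0) V H"
proof (rotate_tac 1, induction i rule: inc_induct)
  case base
  then show ?case using bottom by simp
next
  case (step i)
  let ?q = "V i (Suc y)"
  have "paired (V (Suc i) (Suc y)) (H (Suc i) y) ?q (H (Suc i) (Suc y))" using cell[of "Suc i" "Suc y"] by simp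
  then consider "V (Suc i) (Suc y) = ?q" | "H (Suc i) y = ?q" by (auto simp: paired_def)
  then show ?case
  proof cases
    case 1
    then show ?thesis using step by simp
  next
    case 2
    then show ?thesis
      using cross_pairsI[of "Suc i" y "(0, 0)" V p H ?q] col[of "Suc i"] step xy inner_left[of "Suc i"]
      by simp
  qed
qed

text \<open>A pipe in column \<open>y + 1\<close> at this height has crossed \<open>p\<close>
  further down and would be crossed a second time by \<open>p\<close> right after its turn at
  \<open>(x, y)\<close>.\<close>

lemma top_row: "H x y = p" "H x (y - 1) = 0" "V x (Suc y) = 0"
proof -
  have "paired p (H x (y - 1)) 0 (H x y)" using cell[of x y] xy top col[of x] by simp
  then show "H x y = p" "H x (y - 1) = 0" using xy by (auto simp: paired_def)
  show "V x (Suc y) = 0"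
  proof (rule ccontr)
    assume q: "V x (Suc y) \<noteq> 0"
    then have "(V x (Suc y), p) \<in> cross_pairs (0, 0) V H" using col_right_label[of x] xy by simp
    moreover have "(p, V x (Suc y)) \<in> cross_pairs (0, 0) V H"
      using cross_pairsI[of x "Suc y" "(0, 0)" V _ H p] q xy \<open>H x y = p\<close> by simp
    ultimately show False using ascendingD[OF A0] less_asym by blast
  qed
qed

lemma x'_le: "x' \<le> n"
proof (rule ccontr)
  assume "\<not> x' \<le> n"
  then have "V (x' - 1) (Suc y) = Suc y" using label_fieldD(6)[OF P, of "x' - 1" "Suc y"] xy by auto
  then show False using bottom by auto
qed

lemma label_field': "label_field n V' H'"
  unfolding label_field_def
proof (intro conjI allI impI)
  note Z = label_fieldD(1-4)[OF P]
  show "V' 0 j = 0" "V' i 0 = 0" "H' i 0 = 0" "H' 0 j = 0" for i j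
    using Z xy by (auto simp: moveV_def unmoveH_def transpose_def)
  show "paired (V' i j) (H' i (j - 1)) (V' (i - 1) j) (H' i j)" if ij: "1 \<le> i" "1 \<le> j" for i j
  proof -
    consider "j \<noteq> y" "j \<noteq> Suc y" | "j = y" | "j = Suc y" by blast
    then show ?thesis
    proof cases
      case 1
      then have "j - 1 \<noteq> y" using ij by auto
      then show ?thesis using cell[OF ij] 1 by (simp add: moveV_simps moveV_pred unmoveH_def)
    next
      case j: 2
      have y1: "y - 1 \<noteq> y" using xy by simp
      consider "i < x" | "i = x" | "x < i" "i < x'" | "i = x'" | "x' < i" by linarith
      then show ?thesis
      proof cases
        case 3
        then show ?thesis using cell[of i "Suc y"] j y1 inner_left[of i]
          by (auto simp: moveV_simps moveV_pred unmoveH_def)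
      next
        case 4
        then show ?thesis using cell[of x' y] j y1 xy bottom col[of "x' - 1"]
          by (auto simp: moveV_simps moveV_pred unmoveH_def paired_def)
      qed (use cell[of i y] ij j y1 xy top top_row col[of x] in \<open>auto simp: moveV_simps moveV_pred unmoveH_def paired_def\<close>)
    next
      case j: 3
      consider "i < x" | "i = x" | "x < i" "i < x'" | "i = x'" | "x' < i" by linarith
      then show ?thesis
      proof cases
        case 3
        then show ?thesis using j col[of i] col[of "i - 1"] xy
          by (auto simp: moveV_simps moveV_pred unmoveH_def paired_def)
      next
        case 4
        then show ?thesis using j xy bottom col[of "x' - 1"]
          by (auto simp: moveV_simps moveV_pred unmoveH_def paired_def)
      qed (use cell[of i "Suc y"] ij j xy top top_row col[of x] in \<open>auto simp: moveV_simps moveV_pred unmoveH_def paired_def\<close>)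
    qed
  qed
  show "V' i j = (if 1 \<le> j \<and> j \<le> i then j else 0)" if "n \<le> i \<or> n < j" for i j
  proof -
    have "V' i j = V i j"
      using that x'_le xy by (cases "n \<le> i") (auto simp: moveV_def transpose_def)
    then show ?thesis using label_fieldD(6)[OF P that] by simp
  qed
  show "H' i j \<noteq> 0" if "1 \<le> i" "n \<le> j" "i \<le> j" for i j
    using label_fieldD(7)[OF P that] that xy by (auto simp: unmoveH_def)
qed

text \<open>A pipe that now crosses \<open>p\<close> in column \<open>y + 1\<close> either ran
  straight on before and crossed \<open>p\<close> in column \<open>y\<close>, or it turned right out
  of column \<open>y + 1\<close> and had crossed \<open>p\<close> further down.\<close>

lemma new_cross:
  assumes ij: "1 \<le> i" "1 \<le> j" "V' i j \<noteq> 0" "H' i (j - 1) \<noteq> 0" "(i, j) \<noteq> (x', Suc y)"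
  shows "(H' i (j - 1), V' i j) \<in> cross_pairs (0, 0) V H \<and> V' (i - 1) j = V' i j"
proof -
  have old: "(H i (j - 1), V i j) \<in> cross_pairs (0, 0) V H \<and> V (i - 1) j = V i j"
    if "1 \<le> i" "1 \<le> j" "V i j \<noteq> 0" "H i (j - 1) \<noteq> 0" for i j
    using cross_pairsI[of i j "(0, 0)" V "V i j" H "H i (j - 1)"] no_bump[of i j] that by auto
  consider "j \<noteq> y" "j \<noteq> Suc y" | "j = y" | "j = Suc y" by blast
  then show ?thesis
  proof cases
    case 1
    then have "j - 1 \<noteq> y" using ij by auto
    then show ?thesis using old[of i j] ij 1 by (auto simp: moveV_simps moveV_pred unmoveH_def)
  next
    case j: 2
    have y1: "y - 1 \<noteq> y" using xy by simp
    consider "i < x \<or> x' < i" | "i = x" | "x < i" "i < x'" | "i = x'" by linarith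
    then show ?thesis
    proof cases
      case 1
      then show ?thesis using old[of i j] ij j y1 by (auto simp: moveV_simps moveV_pred unmoveH_def)
    next
      case 2
      then show ?thesis using ij j y1 top_row by (auto simp: unmoveH_def)
    next
      case 3
      then show ?thesis using old[of i "Suc y"] ij j y1 inner_left[of i] by (auto simp: moveV_simps moveV_pred unmoveH_def)
    next
      case 4
      have "paired (V x' y) (H x' (y - 1)) p 0" using cell[of x' y] xy bottom col[of "x' - 1"] by simp
      then have "V x' y = 0 \<or> H x' (y - 1) = 0" using xy by (auto simp: paired_def)
      then show ?thesis using ij j y1 4 by (auto simp: moveV_simps moveV_pred unmoveH_def)
    qed
  next
    case j: 3
    consider "i < x \<or> x' < i" | "i = x" | "x < i" "i < x'" | "i = x'" by linarith
    then show ?thesis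
    proof cases
      case 1
      then have "V' (i - 1) j = V (i - 1) j" by (auto simp: moveV_simps moveV_pred)
      then show ?thesis using 1 old[of i j] ij j xy by (auto simp: moveV_simps moveV_pred unmoveH_def)
    next
      case 2
      then show ?thesis using ij j by (auto simp: unmoveH_def)
    next
      case i: 3
      then have u: "H i (Suc y) \<noteq> 0" "V' i j = p" "H' i (j - 1) = H i (Suc y)" "V' (i - 1) j = p"
        using ij j col[of i] col[of "i - 1"] by (auto simp: moveV_simps moveV_pred unmoveH_def)
      have "paired (V i (Suc y)) (H i y) (V (i - 1) (Suc y)) (H i (Suc y))" using cell[of i "Suc y"] ij j by simp
      then consider "H i y = H i (Suc y)" | "V i (Suc y) = H i (Suc y)" by (auto simp: paired_def)
      then show ?thesis
      proof cases
        case 1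
        then show ?thesis using old[of i y] inner_left[of i] i u col[of i] xy by auto
      next
        case 2
        then show ?thesis using col_right_label[of i] i u by auto
      qed
    next
      case 4
      then show ?thesis using ij j by simp
    qed
  qed
qed

lemma nobump': "nobump (x', Suc y) V' H'"
  unfolding nobump_def using new_cross by blast

lemma cross_pairs': "cross_pairs (x', Suc y) V' H' \<subseteq> cross_pairs (0, 0) V H"
  unfolding cross_pairs_def[of "(x', Suc y)"] using new_cross by blast

lemma ascending': "ascending (cross_pairs (x', Suc y) V' H')"
  using A0 cross_pairs' unfolding ascending_def by blast

lemma exits': "exits \<pi> H \<Longrightarrow> exits \<pi> H'"
  unfolding exits_def
proof (intro allI impI)
  fix p' :: nat assume "\<forall>p\<ge>1. \<exists>m. \<forall>j\<ge>m. H (\<pi> p) j = p" "1 \<le> p'"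
  then obtain m where "\<forall>j\<ge>m. H (\<pi> p') j = p'" by blast
  then have "H' (\<pi> p') j = p'" if "j \<ge> max m (Suc y)" for j using that by (auto simp: unmoveH_def)
  then show "\<exists>m. \<forall>j\<ge>m. H' (\<pi> p') j = p'" by blast
qed

end

section \<open>Exchanging two labels beyond a cell\<close>

definition relabelV :: "nat \<Rightarrow> nat \<Rightarrow> (nat \<Rightarrow> nat \<Rightarrow> nat) \<Rightarrow> nat \<Rightarrow> nat \<Rightarrow> nat" where
  "relabelV y x' V i j = (if i < x' then simple_transposition y (V i j) else V i j)"

text \<open>The exchange starts in the cell \<open>(x', y + 1)\<close>: it affects all edges above
  row \<open>x'\<close> and, in that row, the east edges from column \<open>y + 1\<close> on. The
  edges leading into the cell keep their labels.\<close>

definition relabelH :: "nat \<Rightarrow> nat \<Rightarrow> (nat \<Rightarrow> nat \<Rightarrow> nat) \<Rightarrow> nat \<Rightarrow> nat \<Rightarrow> nat" where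
  "relabelH y x' H i j =
     (if i < x' \<or> (i = x' \<and> y < j) then simple_transposition y (H i j) else H i j)"

lemma simple_transposition_simps [simp]:
  "simple_transposition y y = Suc y" "simple_transposition y (Suc y) = y"
  "simple_transposition y (simple_transposition y j) = j"
  "simple_transposition y i = simple_transposition y j \<longleftrightarrow> i = j"
  "j \<noteq> y \<Longrightarrow> j \<noteq> Suc y \<Longrightarrow> simple_transposition y j = j"
  by (auto simp: simple_transposition_def transpose_def)

lemma simple_transposition_0:
  "1 \<le> y \<Longrightarrow> simple_transposition y 0 = 0"
  "1 \<le> y \<Longrightarrow> simple_transposition y j = 0 \<longleftrightarrow> j = 0"
  by (auto simp: simple_transposition_def transpose_def)

lemma paired_simple_transposition:
  "paired (simple_transposition y s) (simple_transposition y w) (simple_transposition y n) (simple_transposition y e)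
     \<longleftrightarrow> paired s w n e"
  by (auto simp: paired_def)

text \<open>Pipes \<open>y\<close> and \<open>y + 1\<close> run straight up to row
  \<open>x'\<close>, where \<open>y\<close> turns right into the cell of \<open>y + 1\<close>.
  Whether this cell is a cross or a bump is left open, so the locale serves the last step of
  \<open>nabla\<close> and its inverse.\<close>

locale exchange_labels =
  fixes n y x' :: nat and V H :: "nat \<Rightarrow> nat \<Rightarrow> nat"
  assumes P: "label_field n V H"
    and N: "nobump (x', Suc y) V H"
    and xy: "1 \<le> x'" "1 \<le> y" "y < n"
    and cols: "\<And>i. x' \<le> i \<Longrightarrow> V i y = y" "\<And>i. x' \<le> i \<Longrightarrow> V i (Suc y) = Suc y"
    and bottom: "H x' y = y" and top: "V (x' - 1) y = 0"
begin

abbreviation "\<sigma> \<equiv> simple_transposition y"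
abbreviation "V' \<equiv> relabelV y x' V"
abbreviation "H' \<equiv> relabelH y x' H"

lemma cell: "1 \<le> i \<Longrightarrow> 1 \<le> j \<Longrightarrow> paired (V i j) (H i (j - 1)) (V (i - 1) j) (H i j)"
  using label_fieldD(5)[OF P] .

lemma \<sigma>0: "\<sigma> 0 = 0" "\<sigma> j = 0 \<longleftrightarrow> j = 0" "0 < \<sigma> j \<longleftrightarrow> 0 < j"
  using simple_transposition_0[OF xy(2)] by (simp_all flip: neq0_conv)

lemma V_label: "x' \<le> i \<Longrightarrow> j \<noteq> y \<Longrightarrow> j \<noteq> Suc y \<Longrightarrow> V i j \<noteq> y \<and> V i j \<noteq> Suc y"
  using V_inj[OF P, of i j y] V_inj[OF P, of i j "Suc y"] cols[of i] xy by auto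

lemma \<sigma>_V: "x' \<le> i \<Longrightarrow> j \<noteq> y \<Longrightarrow> j \<noteq> Suc y \<Longrightarrow> \<sigma> (V i j) = V i j"
  using V_label by simp

lemma V_unique: "x' \<le> i \<Longrightarrow> V i j = y \<Longrightarrow> j = y" "x' \<le> i \<Longrightarrow> V i j = Suc y \<Longrightarrow> j = Suc y"
  using V_inj[OF P, of i j y] V_inj[OF P, of i j "Suc y"] cols[of i] xy by auto

text \<open>Neither of the two pipes rises out of row \<open>x'\<close> at or left of column
  \<open>y\<close>, so there the exchange above the row agrees with the unchanged labels in
  it.\<close>

lemma V_above_left: 
  assumes "j \<le> y" shows "\<sigma> (V (x' - 1) j) = V (x' - 1) j"
proof (cases "V (x' - 1) j = 0 \<or> j = y")
  case True
  then have "V (x' - 1) j = 0" using top by blast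
  then show ?thesis using \<sigma>0(1) by simp
next
  case False
  then obtain k where "k \<le> j" "V (Suc (x' - 1)) k = V (x' - 1) j"
    using V_below[OF P, of "x' - 1" j] by blast
  then have "V (x' - 1) j \<noteq> y" "V (x' - 1) j \<noteq> Suc y"
    using V_unique[of x' k] xy False assms by auto
  then show ?thesis by simp
qed

lemma x'_le: "x' \<le> n"
proof (rule ccontr)
  assume "\<not> x' \<le> n"
  then have "V (x' - 1) y = y" using label_fieldD(6)[OF P, of "x' - 1" y] xy by auto
  then show False using top xy by auto
qed

lemma label_field': "label_field n V' H'"
  unfolding label_field_def
proof (intro conjI allI impI)
  note Z = label_fieldD(1-4)[OF P]
  show "V' 0 j = 0" "V' i 0 = 0" "H' i 0 = 0" "H' 0 j = 0" for i j
    using Z by (auto simp: relabelV_def relabelH_def \<sigma>0)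
  show "paired (V' i j) (H' i (j - 1)) (V' (i - 1) j) (H' i j)" if ij: "1 \<le> i" "1 \<le> j" for i j
  proof -
    consider "i < x'" | "i = x'" | "x' < i" by linarith
    then show ?thesis
    proof cases
      case 1
      then have "i - 1 < x'" by simp
      then show ?thesis using 1 cell[OF ij] by (simp add: relabelV_def relabelH_def paired_simple_transposition)
    next
      case 2
      have i1: "x' - 1 < x'" using xy by simp
      consider "j \<le> y" | "j = Suc y" | "Suc y < j" by linarith
      then show ?thesis
      proof cases
        case 1
        then have "\<not> y < j - 1" by auto
        then show ?thesis using cell[OF ij] 1 2 i1 V_above_left[OF 1]
          by (simp add: relabelV_def relabelH_def)
      next
        case j: 2
        have "paired (Suc y) y (V (x' - 1) (Suc y)) (H x' (Suc y))"
          using cell[of x' "Suc y"] xy cols[of x'] bottom by simp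
        then have "paired (Suc y) y (\<sigma> (V (x' - 1) (Suc y))) (\<sigma> (H x' (Suc y)))" by (auto simp: paired_def)
        then show ?thesis using j 2 i1 cols[of x'] bottom by (simp add: relabelV_def relabelH_def)
      next
        case 3
        then have "y < j - 1" "y < j" by auto
        then have "V' i j = \<sigma> (V x' j)" "H' i (j - 1) = \<sigma> (H x' (j - 1))"
          "V' (i - 1) j = \<sigma> (V (x' - 1) j)" "H' i j = \<sigma> (H x' j)"
          using 2 3 i1 \<sigma>_V[of x' j] by (auto simp: relabelV_def relabelH_def)
        then show ?thesis using cell[OF ij] 2 by (simp only: paired_simple_transposition)
      qed
    next
      case 3
      then have "\<not> i - 1 < x'" by simp
      then show ?thesis using 3 cell[OF ij] by (simp add: relabelV_def relabelH_def)
    qed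
  qed
  show "V' i j = (if 1 \<le> j \<and> j \<le> i then j else 0)" if "n \<le> i \<or> n < j" for i j
  proof -
    have "V' i j = V i j"
      using that x'_le label_fieldD(6)[OF P that] by (cases "n \<le> i") (auto simp: relabelV_def \<sigma>0)
    then show ?thesis using label_fieldD(6)[OF P that] by simp
  qed
  show "H' i j \<noteq> 0" if "1 \<le> i" "n \<le> j" "i \<le> j" for i j
    using label_fieldD(7)[OF P that] by (simp add: relabelH_def \<sigma>0)
qed

lemma new_cross:
  assumes ij: "1 \<le> i" "1 \<le> j" "V' i j \<noteq> 0" "H' i (j - 1) \<noteq> 0" "(i, j) \<noteq> (x', Suc y)"
  shows "((H' i (j - 1), V' i j) \<in> cross_pairs (x', Suc y) V H \<or>
      (\<sigma> (H' i (j - 1)), \<sigma> (V' i j)) \<in> cross_pairs (x', Suc y) V H) \<and> V' (i - 1) j = V' i j"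
proof -
  have old: "(H i (j - 1), V i j) \<in> cross_pairs (x', Suc y) V H \<and> V (i - 1) j = V i j"
    if "V i j \<noteq> 0" "H i (j - 1) \<noteq> 0"
    using cross_pairsI[of i j "(x', Suc y)" V "V i j" H "H i (j - 1)"] nobumpD[OF N, of i j] ij that by auto
  consider "i < x'" | "i = x'" | "x' < i" by linarith
  then show ?thesis
  proof cases
    case 1
    then have "i - 1 < x'" by simp
    then have e: "V' i j = \<sigma> (V i j)" "H' i (j - 1) = \<sigma> (H i (j - 1))" "V' (i - 1) j = \<sigma> (V (i - 1) j)"
      using 1 by (auto simp: relabelV_def relabelH_def)
    then have "V i j \<noteq> 0" "H i (j - 1) \<noteq> 0" using ij(3,4) \<sigma>0(2) by metis+
    then show ?thesis using old e by simp
  next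
    case 2
    have i1: "x' - 1 < x'" using xy by simp
    consider "j \<le> y" | "Suc y < j" using 2 ij(5) by fastforce
    then show ?thesis
    proof cases
      case 1
      then have "\<not> y < j - 1" by auto
      then have "V' i j = V i j" "H' i (j - 1) = H i (j - 1)" "V' (i - 1) j = V (i - 1) j"
        using 2 i1 V_above_left[OF 1] by (auto simp: relabelV_def relabelH_def)
      then show ?thesis using old ij by simp
    next
      case 3: 2
      then have "y < j - 1" by auto
      then have e: "V' i j = \<sigma> (V i j)" "H' i (j - 1) = \<sigma> (H i (j - 1))" "V' (i - 1) j = \<sigma> (V (i - 1) j)"
        using 2 3 i1 \<sigma>_V[of x' j] by (auto simp: relabelV_def relabelH_def)
      then have "V i j \<noteq> 0" "H i (j - 1) \<noteq> 0" using ij(3,4) \<sigma>0(2) by metis+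
      then show ?thesis using old e by simp
    qed
  next
    case 3
    then have "\<not> i - 1 < x'" by simp
    then have "V' i j = V i j" "H' i (j - 1) = H i (j - 1)" "V' (i - 1) j = V (i - 1) j"
      using 3 by (auto simp: relabelV_def relabelH_def)
    then show ?thesis using old ij by simp
  qed
qed

lemma nobump': "nobump (x', Suc y) V' H'"
  unfolding nobump_def using new_cross by blast

text \<open>The transposition preserves the order of every pair except \<open>(y, y + 1)\<close>,
  hence the hypothesis that this pair crosses nowhere else.\<close>

lemma ascending':
  assumes A: "ascending (cross_pairs (x', Suc y) V H)" and no: "(y, Suc y) \<notin> cross_pairs (x', Suc y) V H"
  shows "ascending (cross_pairs (x', Suc y) V' H')"
  unfolding ascending_def
proof (clarify)
  fix w s assume "(w, s) \<in> cross_pairs (x', Suc y) V' H'"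
  then have "(w, s) \<in> cross_pairs (x', Suc y) V H \<or> (\<sigma> w, \<sigma> s) \<in> cross_pairs (x', Suc y) V H"
    unfolding cross_pairs_def[of _ V'] using new_cross by blast
  then show "w < s"
  proof
    assume *: "(\<sigma> w, \<sigma> s) \<in> cross_pairs (x', Suc y) V H"
    then have "(\<sigma> w, \<sigma> s) \<noteq> (y, Suc y)" using no by auto
    then show ?thesis using simple_transposition_mono[OF ascendingD[OF A *], of y] by simp
  qed (rule ascendingD[OF A])
qed

lemma exits':
  assumes E: "exits \<pi> H" shows "exits (\<pi> \<circ> \<sigma>) H'"
  unfolding exits_def
proof (intro allI impI)
  fix p :: nat assume p: "1 \<le> p"
  have q: "1 \<le> \<sigma> p" using p \<sigma>0(2)[of p] by linarith
  then obtain m where m: "\<forall>j\<ge>m. H (\<pi> (\<sigma> p)) j = \<sigma> p" using E unfolding exits_def by blast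
  have "H' (\<pi> (\<sigma> p)) j = p" if j: "j \<ge> max m (Suc y)" for j
  proof (cases "\<pi> (\<sigma> p) \<le> x'")
    case True
    then show ?thesis using m j by (auto simp: relabelH_def)
  next
    case False
    \<comment> \<open>Both exchanged pipes are present at line \<open>x'\<close> and therefore leave
      in row \<open>x'\<close> or higher, so a pipe that leaves further down keeps its
      label.\<close>
    have "\<pi> y \<le> x'" "\<pi> (Suc y) \<le> x'"
      using present_iff[OF P E, of y x'] present_iff[OF P E, of "Suc y" x'] cols[of x'] xy by auto
    then have "\<sigma> p \<noteq> y" "\<sigma> p \<noteq> Suc y" using False by auto
    then have "p \<noteq> y" "p \<noteq> Suc y" by auto
    then show ?thesis using m j False by (auto simp: relabelH_def)
  qed
  then show "\<exists>m. \<forall>j\<ge>m. H' ((\<pi> \<circ> \<sigma>) p) j = p" by (intro exI[of _ "max m (Suc y)"]) simp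
qed

lemma zero_iff: "V' i j = 0 \<longleftrightarrow> V i j = 0" "H' i j = 0 \<longleftrightarrow> H i j = 0"
  by (auto simp: relabelV_def relabelH_def \<sigma>0)

end

section \<open>Blank cells and edge sets under a move\<close>

lemma blank_cells_field:
  "blank_cells (field_tiling V H) = {(i, j). 1 \<le> i \<and> 1 \<le> j \<and> V i j = 0 \<and> H i (j - 1) = 0}"
  by (auto simp: blank_cells_def in_grid_def tile_at_def split: if_splits)

lemma finite_blank_cells:
  assumes P: "label_field n V H"
  shows "finite (blank_cells (field_tiling V H))"
proof (rule finite_subset)
  show "blank_cells (field_tiling V H) \<subseteq> {..n} \<times> {..n}"
  proof (rule subrelI)
    fix i j assume ij: "(i, j) \<in> blank_cells (field_tiling V H)"
    then have B: "1 \<le> i" "1 \<le> j" "field_tiling V H (i, j) = Blank"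
      using ij unfolding blank_cells_def in_grid_def by (simp_all del: field_tiling.simps)
    have "\<not> (n < i \<or> n < j)"
    proof
      assume "n < i \<or> n < j"
      then have "field_tiling V H (i, j) = (if i = j then RTile else if i < j then Horizontal else Vertical)"
        using field_drawn_in[OF P] B(1,2) unfolding drawn_in_def by blast
      then show False using B(3) by (simp del: field_tiling.simps split: if_splits)
    qed
    then show "(i, j) \<in> {..n} \<times> {..n}" by simp
  qed
qed simp

definition blank_rows :: "(cell \<Rightarrow> tile) \<Rightarrow> nat multiset" where
  "blank_rows D = image_mset fst (mset_set (blank_cells D))"

lemma joins_edges_of:
  "joins (edges_of V H) (i, j) North North \<longleftrightarrow> V i j \<noteq> 0 \<and> V (i - 1) j = V i j"
  "joins (edges_of V H) (i, j) East East \<longleftrightarrow> j \<noteq> 0 \<and> H i (j - 1) \<noteq> 0 \<and> H i j = H i (j - 1)"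
  "joins (edges_of V H) (i, j) North East \<longleftrightarrow> V i j \<noteq> 0 \<and> H i j = V i j"
  "joins (edges_of V H) (i, j) East North \<longleftrightarrow> j \<noteq> 0 \<and> H i (j - 1) \<noteq> 0 \<and> V (i - 1) j = H i (j - 1)"
  by (auto simp: joins_def)

lemma paired_cases:
  assumes "paired s w n e" "s = 0 \<or> w = 0 \<or> n = s"
  obtains "s = 0" "w = 0" "n = 0" "e = 0"
    | "s \<noteq> 0" "w = 0" "n = s" "e = 0"
    | "s \<noteq> 0" "w = 0" "n = 0" "e = s"
    | "s = 0" "w \<noteq> 0" "n = 0" "e = w"
    | "s = 0" "w \<noteq> 0" "n = w" "e = 0"
    | "s \<noteq> 0" "w \<noteq> 0" "n = s" "e = w"
  using assms unfolding paired_def by (cases "s = 0"; cases "w = 0"; fastforce)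

lemma tiling_of_edges_of:
  assumes P: "label_field n V H" and N: "nobump (0, 0) V H"
  shows "tiling_of (edges_of V H) = field_tiling V H"
proof
  fix c :: cell
  obtain i j where c: "c = (i, j)" by (cases c)
  show "tiling_of (edges_of V H) c = field_tiling V H c"
  proof (cases "i = 0 \<or> j = 0")
    case True
    then show ?thesis using label_fieldD(1-4)[OF P] by (auto simp: c tiling_of_def joins_edges_of)
  next
    case False
    then have L: "paired (V i j) (H i (j - 1)) (V (i - 1) j) (H i j)" using label_fieldD(5)[OF P, of i j] by simp
    have "V i j = 0 \<or> H i (j - 1) = 0 \<or> V (i - 1) j = V i j" using nobumpD[OF N, of i j] False by simp
    with L show ?thesis
      by (cases rule: paired_cases) (use False in \<open>simp_all add: c tiling_of_def joins_edges_of tile_at_def\<close>)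
  qed
qed

lemma in_droop:
  "((i, j), North) \<in> droop (a, y) (b, Suc y) P \<longleftrightarrow>
    (((i, j), North) \<in> P \<and> \<not> (j = y \<and> a \<le> i \<and> i < b)) \<or> (j = Suc y \<and> a \<le> i \<and> i < b)"
  "((i, j), East) \<in> droop (a, y) (b, Suc y) P \<longleftrightarrow>
    (((i, j), East) \<in> P \<and> \<not> (i = a \<and> j = Suc y)) \<or> (i = b \<and> j = Suc y)"
  "((i, j), South) \<in> droop (a, y) (b, Suc y) P \<longleftrightarrow> ((i, j), South) \<in> P"
  "((i, j), West) \<in> droop (a, y) (b, Suc y) P \<longleftrightarrow> ((i, j), West) \<in> P"
  by (auto simp: droop_def)

lemma in_undroop:
  "((i, j), North) \<in> undroop (a, y) (b, Suc y) P \<longleftrightarrow>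
    (((i, j), North) \<in> P \<and> \<not> (j = Suc y \<and> a \<le> i \<and> i < b)) \<or> (j = y \<and> a \<le> i \<and> i < b)"
  "((i, j), East) \<in> undroop (a, y) (b, Suc y) P \<longleftrightarrow>
    (((i, j), East) \<in> P \<and> \<not> (i = b \<and> j = Suc y)) \<or> (i = a \<and> j = Suc y)"
  "((i, j), South) \<in> undroop (a, y) (b, Suc y) P \<longleftrightarrow> ((i, j), South) \<in> P"
  "((i, j), West) \<in> undroop (a, y) (b, Suc y) P \<longleftrightarrow> ((i, j), West) \<in> P"
  by (auto simp: undroop_def)

lemma edge_set_eqI:
  assumes "\<And>i j. ((i, j), North) \<in> A \<longleftrightarrow> ((i, j), North) \<in> B"
    "\<And>i j. ((i, j), East) \<in> A \<longleftrightarrow> ((i, j), East) \<in> B"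
    "\<And>i j. ((i, j), South) \<in> A \<longleftrightarrow> ((i, j), South) \<in> B"
    "\<And>i j. ((i, j), West) \<in> A \<longleftrightarrow> ((i, j), West) \<in> B"
  shows "A = (B :: edge set)"
proof (rule set_eqI)
  fix e :: edge
  obtain i j d where "e = ((i, j), d)" by (metis prod.exhaust)
  then show "e \<in> A \<longleftrightarrow> e \<in> B" using assms by (cases d) auto
qed

context forward_move
begin

text \<open>Strictly between the rows \<open>x\<close> and \<open>x'\<close> the blanks of the two
  columns change places. The blank at \<open>(x, y)\<close> disappears and comes back at
  \<open>(x', y + 1)\<close>, unless a bump was there, which turns into an r-tile.\<close>

lemma blank_rows_move:
  "blank_rows (field_tiling V H) + (if V x' (Suc y) = 0 then {#x'#} else {#}) =
     blank_rows (field_tiling V' H') + {#x#}"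
proof -
  let ?B = "blank_cells (field_tiling V H)" and ?B' = "blank_cells (field_tiling V' H')"
  define \<tau> :: "cell \<Rightarrow> cell" where "\<tau> = (\<lambda>(i, j). if x < i \<and> i < x' then (i, transpose y (Suc y) j) else (i, j))"
  let ?S = "\<tau> ` (?B - {(x, y)})"
  have \<tau>2: "\<tau> (\<tau> c) = c" for c by (cases c) (auto simp: \<tau>_def)
  have fst\<tau>: "fst (\<tau> c) = fst c" for c by (cases c) (auto simp: \<tau>_def)
  have in_S: "c \<in> ?S \<longleftrightarrow> \<tau> c \<in> ?B \<and> \<tau> c \<noteq> (x, y)" for c
    by (metis (no_types, lifting) Diff_iff \<tau>2 image_iff singletonD singletonI)
  have eq: "?B' = ?S \<union> (if V x' (Suc y) = 0 then {(x', Suc y)} else {})" (is "_ = ?S \<union> ?E")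
  proof (rule set_eqI)
    fix c :: cell
    obtain i j where c: "c = (i, j)" by (cases c)
    have "(i, j) \<in> ?B' \<longleftrightarrow> \<tau> (i, j) \<in> ?B \<and> \<tau> (i, j) \<noteq> (x, y) \<or> (i, j) \<in> ?E"
    proof (cases "1 \<le> i \<and> 1 \<le> j")
      case False
      have "\<tau> (i, j) \<in> ?B \<Longrightarrow> 1 \<le> i \<and> 1 \<le> j" 
        using xy by (auto simp: \<tau>_def blank_cells_field transpose_def split: if_splits)
      then show ?thesis using False xy by (auto simp: blank_cells_field)
    next
      case ij: True
      consider "j \<noteq> y" "j \<noteq> Suc y" | "j = y" | "j = Suc y" by blast
      then show ?thesis
      proof cases
        case 1
        then have "j - 1 \<noteq> y" using ij by auto
        then show ?thesis using ij 1
          by (auto simp: \<tau>_def blank_cells_field moveV_simps moveH_def)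
      next
        case j: 2
        have y1: "y - 1 \<noteq> y" using xy by simp
        consider "i < x \<or> x' \<le> i" | "i = x" | "x < i" "i < x'" by linarith
        then show ?thesis
          by cases (use ij j y1 xy blank col[of i] in
            \<open>auto simp: \<tau>_def blank_cells_field moveV_simps moveH_def\<close>)
      next
        case j: 3
        consider "i < x \<or> x' < i" | "i = x" | "x < i" "i < x'" | "i = x'" by linarith
        then show ?thesis
          by cases (use ij j xy blank bottom col[of i] in
            \<open>auto simp: \<tau>_def blank_cells_field moveV_simps moveH_def\<close>)
      qed
    qed
    then show "c \<in> ?B' \<longleftrightarrow> c \<in> ?S \<union> ?E" unfolding c Un_iff in_S .
  qed
  have fin: "finite ?B" using finite_blank_cells[OF P] .
  have xB: "(x, y) \<in> ?B" using blank xy by (simp add: blank_cells_field)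
  have disj: "?S \<inter> ?E = {}"
  proof -
    have "(x', Suc y) \<notin> ?S" unfolding in_S using xy bottom by (auto simp: \<tau>_def blank_cells_field)
    then show ?thesis by auto
  qed
  have "inj_on \<tau> (?B - {(x, y)})" by (rule inj_onI) (metis \<tau>2)
  then have S: "image_mset fst (mset_set ?S) = image_mset fst (mset_set (?B - {(x, y)}))"
    by (simp add: image_mset_mset_set[symmetric] multiset.map_comp comp_def fst\<tau>)
  have "blank_rows (field_tiling V' H') = image_mset fst (mset_set ?S) + image_mset fst (mset_set ?E)"
    unfolding blank_rows_def eq using fin disj by (subst mset_set_Union) auto
  also have "image_mset fst (mset_set ?E) = (if V x' (Suc y) = 0 then {#x'#} else {#})" by simp
  finally have 1: "blank_rows (field_tiling V' H') =
      image_mset fst (mset_set (?B - {(x, y)})) + (if V x' (Suc y) = 0 then {#x'#} else {#})"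
    unfolding S .
  have "mset_set ?B = add_mset (x, y) (mset_set (?B - {(x, y)}))"
    using mset_set.remove[OF fin xB] .
  then have "blank_rows (field_tiling V H) = add_mset x (image_mset fst (mset_set (?B - {(x, y)})))"
    unfolding blank_rows_def by simp
  then show ?thesis unfolding 1 by simp
qed

lemma left_col_up:
  assumes "x \<le> k" "k < x'" "V k y = q" "q \<noteq> 0"
  shows "\<exists>z. x < z \<and> z \<le> k \<and> H z y = q \<and> (\<forall>m. z \<le> m \<and> m \<le> k \<longrightarrow> V m y = q)"
  using assms
proof (induction k rule: dec_induct)
  case base
  then show ?case using blank by simp
next
  case (step k)
  have "paired q (H (Suc k) (y - 1)) (V k y) (H (Suc k) y)" using cell[of "Suc k" y] xy step by simp
  then consider "V k y = q" | "H (Suc k) y = q" by (auto simp: paired_def)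
  then show ?case
  proof cases
    case 1
    then obtain z where "x < z \<and> z \<le> k \<and> H z y = q \<and> (\<forall>m. z \<le> m \<and> m \<le> k \<longrightarrow> V m y = q)"
      using step by auto
    then show ?thesis using step.prems by (intro exI[of _ z]) (auto simp: le_Suc_eq)
  next
    case 2
    then show ?thesis using step by (intro exI[of _ "Suc k"]) auto
  qed
qed

lemma r_turn:
  assumes "V z y = q" "H z y = q" "q \<noteq> 0" "1 \<le> z"
  shows "H z (y - 1) = 0" "V (z - 1) y = 0" "field_tiling V H (z, y) = RTile"
proof -
  have L: "paired q (H z (y - 1)) (V (z - 1) y) q" using cell[of z y] xy assms by simp
  have "H z (y - 1) \<noteq> q" using labels_distinct[OF P, of z y] assms xy by auto
  then have n: "V (z - 1) y = H z (y - 1)" using L by (auto simp: paired_def)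
  show w: "H z (y - 1) = 0"
    using no_bump[of z y] assms xy n \<open>H z (y - 1) \<noteq> q\<close> by auto
  show "V (z - 1) y = 0" using n w by simp
  then show "field_tiling V H (z, y) = RTile" using assms w xy by (simp add: tile_at_def)
qed

text \<open>A pipe turning right in column \<open>y\<close> within the strip runs into column
  \<open>y + 1\<close>, where \<open>p\<close> is vertical. It is not \<open>p\<close> itself, which
  would then occupy two columns of one line.\<close>

lemma to_droop_iff:
  "to_droop (field_tiling V H) p x y x' q z \<longleftrightarrow>
     x < z \<and> z < x' \<and> q \<noteq> 0 \<and> V z y = q \<and> H z y = q" (is "?L \<longleftrightarrow> ?R")
proof
  assume L: ?L
  then have z: "x < z" "z < x'" unfolding to_droop_def by auto
  have c: "V z (Suc y) = p" using col z by simp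
  have "p \<noteq> q" "q \<noteq> 0" "H z y = q \<or> H z y = p \<and> q = p"
    using L c unfolding to_droop_def by (auto simp: crossing_field[OF P])
  moreover have "field_tiling V H (z, y) = RTile" using L unfolding to_droop_def by blast
  then have "V z y \<noteq> 0" "H z (y - 1) = 0" "V (z - 1) y = 0"
    using xy z by (auto simp: tile_at_def split: if_splits)
  moreover have "paired (V z y) (H z (y - 1)) (V (z - 1) y) (H z y)" using cell[of z y] xy z by simp
  ultimately show ?R using z by (auto simp: paired_def)
next
  assume R: ?R
  then have c: "V z (Suc y) = p" "V (z - 1) (Suc y) = p" using col by auto
  have "q \<noteq> p"
  proof
    assume "q = p"
    then have "V z y = V z (Suc y)" using R c by simp
    then show False using V_inj[OF P, of z y "Suc y"] R by simp
  qed
  then have "crossing (field_tiling V H) p q (z, Suc y)"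
    using R c xy by (auto simp: crossing_field[OF P])
  moreover have "field_tiling V H (z, y) = RTile" using r_turn(3)[of z q] R xy by simp
  ultimately show ?L using R unfolding to_droop_def by simp
qed

text \<open>By \<open>above_bottom\<close> column \<open>y\<close> is empty just above row
  \<open>x'\<close>, so the vertical run of \<open>q\<close> must begin with a j-turn inside the
  strip.\<close>

lemma j_turn_below:
  assumes "x < z" "z < x'" "q \<noteq> 0" "V z y = q"
  shows "\<exists>z'. z < z' \<and> z' < x' \<and> H z' (y - 1) = q \<and> V z' y = 0 \<and>
    (\<forall>k. z \<le> k \<and> k < z' \<longrightarrow> V k y = q) \<and> field_tiling V H (z', y) = JTile"
proof -
  define z' where "z' = (LEAST k. z < k \<and> V k y \<noteq> q)"
  have "z < x' - 1" using above_bottom assms x'_pred by (metis le_neq_implies_less less_Suc_eq_le Suc_pred' gr0I)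
  then have ex: "z < x' - 1 \<and> V (x' - 1) y \<noteq> q" using above_bottom assms by simp
  have z': "z < z' \<and> V z' y \<noteq> q" unfolding z'_def by (rule LeastI[of _ "x' - 1"]) (rule ex)
  have "z' \<le> x' - 1" unfolding z'_def by (rule Least_le) (rule ex)
  then have lt: "z' < x'" using x'_pred by linarith
  have between: "V k y = q" if "z \<le> k" "k < z'" for k
    using not_less_Least[of k "\<lambda>k. z < k \<and> V k y \<noteq> q"] that assms(4) unfolding z'_def
    by (cases "k = z") auto
  have "paired (V z' y) (H z' (y - 1)) q (H z' y)" using cell[of z' y] between[of "z' - 1"] z' xy by auto
  then have w: "H z' (y - 1) = q" "H z' y = V z' y" using z' by (auto simp: paired_def)
  have "V (z' - 1) y = q" using between[of "z' - 1"] z' by auto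
  then have "V z' y = 0" using no_bump[of z' y] z' w xy assms by auto
  moreover from this have "field_tiling V H (z', y) = JTile"
    using w z' xy assms \<open>V (z' - 1) y = q\<close> by (simp add: tile_at_def)
  ultimately show ?thesis using z' lt w between by blast
qed

text \<open>Droops are described pipe by pipe and labels edge by edge, so the edge sets are compared
  for each pipe. In the strip a pipe has at most one vertical run in column \<open>y\<close>: the
  run ends in an r-turn, hence in an east edge of this column, and each label has only one such
  edge.\<close>

lemma column_move_eq: "column_move (field_tiling V H) p x y x' = field_tiling V' H'"
proof -
  let ?D = "field_tiling V H"
  define F where "F = (\<lambda>q.
     if q = p then undroop (x, y) (x', y + 1) (bpd_pipe ?D p)
     else if \<exists>z. to_droop ?D p x y x' q z then
       (let z = (THE z. to_droop ?D p x y x' q z);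
            z' = (THE z'. ?D (z', y) = JTile \<and> passes ?D q (z', y))
        in droop (z, y) (z', y + 1) (bpd_pipe ?D q))
     else bpd_pipe ?D q)"
  have "F q = edges_of V' H' q" for q
  proof -
    consider "q = 0" | "q = p" | z where "q \<noteq> 0" "q \<noteq> p" "to_droop ?D p x y x' q z"
      | "q \<noteq> 0" "q \<noteq> p" "\<nexists>z. to_droop ?D p x y x' q z" by blast
    then show ?thesis
    proof cases
      case 1
      then have "\<nexists>z. to_droop ?D p x y x' q z" unfolding to_droop_iff by simp
      moreover have "q \<noteq> p" using 1 xy by simp
      ultimately have "F q = bpd_pipe ?D q" unfolding F_def by argo
      then show ?thesis using 1 by (simp add: bpd_pipe_field[OF P] edges_of_def)
    next
      case 2
      have north: "V i y \<noteq> p" if "x \<le> i" "i < x'" for i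
        using V_inj[OF P, of i y "Suc y"] col[of i] that xy by auto
      have east: "H i y \<noteq> p" "H i (y - 1) \<noteq> p" if "x < i" "i < x'" for i
      proof -
        show 1: "H i y \<noteq> p" using H_inj[OF P, of i y x'] bottom that xy by auto
        have "paired (V i y) (H i (y - 1)) (V (i - 1) y) (H i y)" using cell[of i y] xy that by simp
        moreover have "x \<le> i - 1" "i - 1 < x'" using that by auto
        ultimately show "H i (y - 1) \<noteq> p" using 1 north[of "i - 1"] by (auto simp: paired_def)
      qed
      have "F q = undroop (x, y) (x', Suc y) (edges_of V H p)"
        using 2 unfolding F_def bpd_pipe_field[OF P] by simp
      also have "\<dots> = edges_of V' H' p"
      proof (rule edge_set_eqI)
        fix i j
        show "((i, j), North) \<in> undroop (x, y) (x', Suc y) (edges_of V H p) \<longleftrightarrow> ((i, j), North) \<in> edges_of V' H' p"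
          unfolding in_undroop using north[of i] col[of i] xy by (auto simp: moveV_def transpose_def)
        show "((i, j), East) \<in> undroop (x, y) (x', Suc y) (edges_of V H p) \<longleftrightarrow> ((i, j), East) \<in> edges_of V' H' p"
          unfolding in_undroop using east[of i] bottom blank xy by (cases j) (auto simp: moveH_def)
      qed (simp_all add: in_undroop)
      finally show ?thesis using 2 by simp
    next
      case (3 z)
      then have z: "x < z" "z < x'" "V z y = q" "H z y = q" unfolding to_droop_iff by auto
      have THE_z: "(THE z. to_droop ?D p x y x' q z) = z"
      proof (rule the_equality)
        fix k assume "to_droop ?D p x y x' q k"
        then show "k = z" using H_inj[OF P, of k y z] z 3(1) unfolding to_droop_iff by auto
      qed (fact 3(3))
      obtain z' where z': "z < z'" "z' < x'" "H z' (y - 1) = q" "V z' y = 0"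
        "\<And>k. z \<le> k \<Longrightarrow> k < z' \<Longrightarrow> V k y = q" "?D (z', y) = JTile"
        using j_turn_below[OF z(1,2) 3(1) z(3)] by blast
      have THE_z': "(THE z'. ?D (z', y) = JTile \<and> passes ?D q (z', y)) = z'"
      proof (rule the_equality)
        show "?D (z', y) = JTile \<and> passes ?D q (z', y)"
          using z' 3 xy by (simp add: passes_field[OF P])
        fix k assume k: "?D (k, y) = JTile \<and> passes ?D q (k, y)"
        then have "V k y = 0" by (auto simp: tile_at_def split: if_splits)
        then have "H k (y - 1) = q" using k 3 by (auto simp: passes_field[OF P] simp del: field_tiling.simps)
        then show "k = z'" using H_inj[OF P, of k "y - 1" z'] z' 3 by auto
      qed
      have F: "F q = droop (z, y) (z', Suc y) (edges_of V H q)"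
        unfolding F_def Let_def THE_z THE_z' bpd_pipe_field[OF P] using 3(2,3) by auto
      have north: "V i y = q \<longleftrightarrow> z \<le> i \<and> i < z'" if i: "x \<le> i" "i < x'" for i
      proof
        assume "V i y = q"
        then obtain k where k: "x < k" "k \<le> i" "H k y = q" "\<forall>m. k \<le> m \<and> m \<le> i \<longrightarrow> V m y = q"
          using left_col_up[OF i] 3 by blast
        have "k = z" using H_inj[OF P, of k y z] k z 3 by auto
        moreover have "i < z'" using k z' \<open>k = z\<close> 3 by (metis less_imp_le not_less)
        ultimately show "z \<le> i \<and> i < z'" using k by simp
      qed (use z' in blast)
      have east: "H i y = q \<longleftrightarrow> i = z" "H i (y - 1) = q \<longleftrightarrow> i = z'" for i
        using H_inj[OF P, of i y z] H_inj[OF P, of i "y - 1" z'] z z' 3 by auto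
      have "droop (z, y) (z', Suc y) (edges_of V H q) = edges_of V' H' q"
      proof (rule edge_set_eqI)
        fix i j
        show "((i, j), North) \<in> droop (z, y) (z', Suc y) (edges_of V H q) \<longleftrightarrow> ((i, j), North) \<in> edges_of V' H' q"
        proof (cases "(j = y \<or> j = Suc y) \<and> x \<le> i \<and> i < x'")
          case True
          then show ?thesis
            unfolding in_droop using north[of i] col[of i] xy 3 by (auto simp: moveV_def)
        next
          case False
          then show ?thesis
            unfolding in_droop using z z' by (auto simp: moveV_def transpose_def)
        qed
        show "((i, j), East) \<in> droop (z, y) (z', Suc y) (edges_of V H q) \<longleftrightarrow> ((i, j), East) \<in> edges_of V' H' q"
          unfolding in_droop using east[of i] bottom blank xy 3 z z' by (cases j) (auto simp: moveH_def)
      qed (simp_all add: in_droop)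
      then show ?thesis using F by simp
    next
      case 4
      \<comment> \<open>A vertical run of \<open>q\<close> in column \<open>y\<close> would end in
        an r-turn, and \<open>q\<close> would have to droop. So \<open>q\<close> goes straight
        through this column or avoids it.\<close>
      have north: "V i y \<noteq> q" if i: "x \<le> i" "i < x'" for i
      proof
        assume "V i y = q"
        then obtain z where "x < z" "z \<le> i" "H z y = q" "V z y = q" using left_col_up[OF i] 4(1) by blast
        then show False using 4 i unfolding to_droop_iff by auto
      qed
      have east: "H i (y - 1) = q \<longleftrightarrow> H i y = q" if "x < i" "i < x'" for i
      proof -
        have "paired (V i y) (H i (y - 1)) (V (i - 1) y) (H i y)" using cell[of i y] xy that by simp
        moreover have "x \<le> i - 1" "i - 1 < x'" using that by auto
        ultimately show ?thesis using north[of i] north[of "i - 1"] that by (auto simp: paired_def)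
      qed
      have "edges_of V H q = edges_of V' H' q"
      proof (rule edge_set_eqI)
        fix i j
        show "((i, j), North) \<in> edges_of V H q \<longleftrightarrow> ((i, j), North) \<in> edges_of V' H' q"
          using north[of i] col[of i] xy 4 by (auto simp: moveV_def transpose_def)
        show "((i, j), East) \<in> edges_of V H q \<longleftrightarrow> ((i, j), East) \<in> edges_of V' H' q"
          using east[of i] bottom blank xy 4 by (cases j) (auto simp: moveH_def)
      qed simp_all
      moreover have "F q = bpd_pipe ?D q" unfolding F_def using 4(2,3) by argo
      ultimately show ?thesis by (simp add: bpd_pipe_field[OF P])
    qed
  qed
  then have "F = edges_of V' H'" by blast
  then show ?thesis
    using tiling_of_edges_of[OF label_field' nobump'] unfolding column_move_def F_def by simp
qed

end

section \<open>The operator nabla\<close>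

lemma nobump_any: "nobump (0, 0) V H \<Longrightarrow> nobump b V H"
  unfolding nobump_def by auto

lemma cross_pairs_any: "cross_pairs b V H \<subseteq> cross_pairs (0, 0) V H"
  unfolding cross_pairs_def by fastforce

lemma ascending_any: "ascending (cross_pairs (0, 0) V H) \<Longrightarrow> ascending (cross_pairs b V H)"
  using cross_pairs_any unfolding ascending_def by blast

lemma field_Blank_iff:
  assumes P: "label_field n V H" and ij: "1 \<le> i" "1 \<le> j"
  shows "field_tiling V H (i, j) = Blank \<longleftrightarrow> V i j = 0 \<and> H i (j - 1) = 0"
  using ij by (auto simp: tile_at_def)

lemma field_BlankD:
  assumes P: "label_field n V H" and ij: "1 \<le> i" "1 \<le> j" and "field_tiling V H (i, j) = Blank"
  shows "V i j = 0" "H i (j - 1) = 0" "V (i - 1) j = 0" "H i j = 0" "i \<le> n" "j < n"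
proof -
  show 1: "V i j = 0" "H i (j - 1) = 0" using assms(4) field_Blank_iff[OF P ij] by auto
  have "paired (V i j) (H i (j - 1)) (V (i - 1) j) (H i j)" using label_fieldD(5)[OF P ij] .
  then show 2: "V (i - 1) j = 0" "H i j = 0" using 1 by (auto simp: paired_def)
  have "\<not> (n < i \<or> n < j)"
  proof
    assume "n < i \<or> n < j"
    then have "field_tiling V H (i, j) = (if i = j then RTile else if i < j then Horizontal else Vertical)"
      using field_drawn_in[OF P] ij unfolding drawn_in_def by blast
    then show False using assms(4) by (simp del: field_tiling.simps split: if_splits)
  qed
  then have le: "i \<le> n" "j \<le> n" by auto
  then show "i \<le> n" by simp
  show "j < n"
  proof (rule ccontr)
    assume "\<not> j < n"
    then have "j = n" using le by simp
    then show False using label_fieldD(7)[OF P ij(1), of j] le 2 by simp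
  qed
qed

text \<open>Two different labels on consecutive south edges would need a turn out of the column and
  a turn into it in the same cell, that is, a bump.\<close>

lemma reduced_field_column_label:
  assumes B: "reduced_field n \<pi> V H" and V: "V i j \<noteq> 0" "V (Suc i) j \<noteq> 0"
  shows "V (Suc i) j = V i j"
proof -
  have j: "1 \<le> j" using V label_fieldD(2)[OF reduced_fieldD(1)[OF B]] by (cases j) auto
  then have "paired (V (Suc i) j) (H (Suc i) (j - 1)) (V i j) (H (Suc i) j)"
    using label_fieldD(5)[OF reduced_fieldD(1)[OF B], of "Suc i" j] by simp
  moreover have "H (Suc i) (j - 1) = 0 \<or> V i j = V (Suc i) j"
    using nobumpD[OF reduced_fieldD(2)[OF B], of "Suc i" j] V j by auto
  ultimately show ?thesis using V unfolding paired_def by argo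
qed

section \<open>A single step at a marked blank\<close>

locale marked =
  fixes n :: nat and \<pi> :: "nat \<Rightarrow> nat" and V H :: "nat \<Rightarrow> nat \<Rightarrow> nat" and x y :: nat
  assumes B: "reduced_field n \<pi> V H"
    and xy: "1 \<le> x" "1 \<le> y"
    and blank: "field_tiling V H (x, y) = Blank"
    and right: "field_tiling V H (x, Suc y) \<noteq> Blank"
begin

abbreviation "D \<equiv> field_tiling V H"
text \<open>The tile right of the blank has no west edge and is not blank itself, so the pipe
  entering it from the south is the only one through it.\<close>

definition "p = V x (Suc y)"

lemmas P = reduced_fieldD(1)[OF B] and N = reduced_fieldD(2)[OF B] and E = reduced_fieldD(3)[OF B] and A = reduced_fieldD(4)[OF B]
lemmas zeros = field_BlankD[OF P xy blank]

lemma cell: "1 \<le> i \<Longrightarrow> 1 \<le> j \<Longrightarrow> paired (V i j) (H i (j - 1)) (V (i - 1) j) (H i j)"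
  using label_fieldD(5)[OF P] .

lemma p_pos: "p \<noteq> 0"
  using right field_Blank_iff[OF P xy(1), of "Suc y"] zeros by (auto simp: p_def)

lemma pipe_through_eq: "pipe_through D (x, Suc y) = p"
  unfolding pipe_through_def passes_field[OF P] using p_pos zeros by (auto simp: p_def)

lemma at_last_step_iff: "at_last_step (D, (x, y)) \<longleftrightarrow> p = Suc y"
  using pipe_through_eq by (simp del: field_tiling.simps)

lemmas column_label = reduced_field_column_label[OF B]

lemma column_const:
  assumes "x \<le> i" "\<And>k. x < k \<Longrightarrow> k \<le> i \<Longrightarrow> V k (Suc y) \<noteq> 0"
  shows "V i (Suc y) = p"
  using assms
proof (induction i rule: dec_induct)
  case (step i)
  then have "V i (Suc y) = p" by simp
  moreover have "V (Suc i) (Suc y) \<noteq> 0" using step.prems[of "Suc i"] step.hyps by simp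
  ultimately show ?case using column_label[of i "Suc y"] p_pos by simp
qed (simp add: p_def)

definition "jrow = (LEAST k. x < k \<and> V k (Suc y) = 0)"

lemma jrow:
  assumes "p \<noteq> Suc y"
  shows "x < jrow" "V jrow (Suc y) = 0" "\<And>i. x \<le> i \<Longrightarrow> i < jrow \<Longrightarrow> V i (Suc y) = p"
    "H jrow y = p" "H jrow (Suc y) = 0"
proof -
  \<comment> \<open>Otherwise \<open>p\<close> would occupy column \<open>y + 1\<close> all the way
    down, where its label is \<open>y + 1\<close>.\<close>
  have "\<exists>k. x < k \<and> V k (Suc y) = 0"
  proof (rule ccontr)
    assume "\<not> ?thesis"
    then have "V (x + n + Suc y) (Suc y) = p" by (intro column_const) auto
    then show False using label_fieldD(6)[OF P, of "x + n + Suc y" "Suc y"] assms by simp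
  qed
  from LeastI_ex[OF this] show b: "x < jrow" "V jrow (Suc y) = 0" unfolding jrow_def by auto
  show col: "V i (Suc y) = p" if "x \<le> i" "i < jrow" for i
  proof (rule column_const[OF that(1)])
    fix k assume k: "x < k" "k \<le> i"
    then have "k < jrow" using that by simp
    then show "V k (Suc y) \<noteq> 0" using not_less_Least[of k "\<lambda>k. x < k \<and> V k (Suc y) = 0"] k
      unfolding jrow_def by auto
  qed
  have "paired 0 (H jrow y) p (H jrow (Suc y))"
    using cell[of jrow "Suc y"] b col[of "jrow - 1"] by simp
  then show "H jrow y = p" "H jrow (Suc y) = 0" using p_pos by (auto simp: paired_def)
qed

lemma forward_move_jrow:
  assumes "p \<noteq> Suc y" shows "forward_move n y x jrow p V H"
proof
  note b = jrow[OF assms]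
  show "label_field n V H" "nobump (jrow, Suc y) V H" "ascending (cross_pairs (jrow, Suc y) V H)"
    by (fact P nobump_any[OF N] ascending_any[OF A])+
  show "V x y = 0" "V (x - 1) y = 0" "H x (y - 1) = 0" "H x y = 0" by (fact zeros)+
  show "V i (Suc y) = p" if "x \<le> i" "i < jrow" for i using b(3)[OF that] .
  show "H jrow y = p" by (fact b)
  show "H jrow (Suc y) = V jrow (Suc y)" using b by simp
  show "1 \<le> x" "1 \<le> y" "y < n" "x < jrow" "p \<noteq> 0" by (fact xy zeros b p_pos)+
qed

lemma move_step_eq:
  assumes "p \<noteq> Suc y"
  shows "move_step (D, (x, y)) = (field_tiling (moveV y x jrow V) (moveH y x jrow p H), (jrow, Suc y))"
proof -
  note b = jrow[OF assms]
  have "(THE x'. x < x' \<and> D (x', Suc y) = JTile \<and> passes D p (x', Suc y)) = jrow"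
  proof (rule the_equality)
    have "V (jrow - 1) (Suc y) = p" using b(3)[of "jrow - 1"] b(1) by simp
    then have "D (jrow, Suc y) = JTile" using b p_pos by (simp add: tile_at_def)
    then show "x < jrow \<and> D (jrow, Suc y) = JTile \<and> passes D p (jrow, Suc y)"
      unfolding passes_field[OF P] using b p_pos by simp
  next
    fix k assume k: "x < k \<and> D (k, Suc y) = JTile \<and> passes D p (k, Suc y)"
    then have "V k (Suc y) = 0" by (auto simp: tile_at_def split: if_splits)
    then have "H k y = p" using k p_pos unfolding passes_field[OF P] by simp
    then show "k = jrow" using H_inj[OF P, of k y jrow] b p_pos by simp
  qed
  moreover have "column_move D p x y jrow = field_tiling (moveV y x jrow V) (moveH y x jrow p H)"
    by (rule forward_move.column_move_eq[OF forward_move_jrow[OF assms]])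
  ultimately show ?thesis
    unfolding move_step.simps Let_def add.right_neutral add_Suc_right One_nat_def pipe_through_eq by simp
qed

lemma move_reduced_field:
  assumes "p \<noteq> Suc y"
  shows "reduced_field n \<pi> (moveV y x jrow V) (moveH y x jrow p H)"
proof -
  interpret F: forward_move n y x jrow p V H using forward_move_jrow[OF assms] .
  show ?thesis unfolding reduced_field_def using F.label_field' F.nobump' F.exits'[OF E] F.ascending' by blast
qed

text \<open>Pipe \<open>y + 1\<close> never moves west of its starting column, so it cannot have
  entered this column from the left.\<close>

lemma straight:
  assumes "p = Suc y" "x \<le> i" shows "V i (Suc y) = Suc y"
  using assms(2)
proof (induction i rule: dec_induct)
  case (step i)
  have "paired (V (Suc i) (Suc y)) (H (Suc i) y) (Suc y) (H (Suc i) (Suc y))"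
    using cell[of "Suc i" "Suc y"] step by simp
  moreover have "H (Suc i) y \<noteq> Suc y" using label_le_column(2)[OF P, of "Suc i" y] by auto
  ultimately show ?case by (auto simp: paired_def)
qed (use assms in \<open>simp add: p_def\<close>)

definition "crow = (LEAST k. x < k \<and> (\<forall>i\<ge>k. V i y = y))"

text \<open>Pipe \<open>y\<close> comes up its own column and has to leave it under the blank at
  \<open>(x, y)\<close>; at the top of its straight part it turns right into column
  \<open>y + 1\<close>.\<close>

lemma crow:
  shows "x < crow" "\<And>i. crow \<le> i \<Longrightarrow> V i y = y" "V (crow - 1) y = 0" "H crow y = y"
proof -
  have "x < x + n + y" using xy by simp
  moreover have "V i y = y" if "x + n + y \<le> i" for i using label_fieldD(6)[OF P, of i y] that xy by simp
  ultimately have "x < x + n + y \<and> (\<forall>i\<ge>x + n + y. V i y = y)" by (intro conjI allI impI)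
  then have "x < crow \<and> (\<forall>i\<ge>crow. V i y = y)" unfolding crow_def by (rule LeastI)
  then have l: "x < crow" "\<forall>i\<ge>crow. V i y = y" by (rule conjunct1, rule conjunct2)
  then show "x < crow" "\<And>i. crow \<le> i \<Longrightarrow> V i y = y" by blast+
  have "V (crow - 1) y \<noteq> y"
  proof
    assume v: "V (crow - 1) y = y"
    have "x \<noteq> crow - 1"
    proof
      assume "x = crow - 1"
      then have "V x y = y" using v by (rule ssubst)
      then show False using zeros(1) xy(2) by linarith
    qed
    moreover have "\<forall>i\<ge>crow - 1. V i y = y"
    proof (intro allI impI)
      fix i assume "crow - 1 \<le> i"
      then consider "i = crow - 1" | "crow \<le> i" by linarith
      then show "V i y = y" by cases (use v l(2) in blast)+
    qed
    moreover have "x < crow - 1" using \<open>x \<noteq> crow - 1\<close> l(1) by linarith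
    ultimately have "x < crow - 1 \<and> (\<forall>i\<ge>crow - 1. V i y = y)" by blast
    then have "crow \<le> crow - 1" unfolding crow_def by (rule Least_le)
    then show False using l(1) by linarith
  qed
  moreover have L: "paired y (H crow (y - 1)) (V (crow - 1) y) (H crow y)"
    using cell[of crow y] l(1) l(2)[rule_format, of crow] xy by simp
  moreover have "H crow (y - 1) = 0 \<or> V (crow - 1) y = y"
    using nobumpD[OF N, of crow y] l(1) l(2)[rule_format, of crow] xy by auto
  ultimately show "V (crow - 1) y = 0" "H crow y = y" by (auto simp: paired_def)
qed

lemma exchange_crow:
  assumes "p = Suc y" shows "exchange_labels n y crow V H"
proof
  show "label_field n V H" "nobump (crow, Suc y) V H" by (fact P nobump_any[OF N])+
  show "1 \<le> crow" using crow(1) by simp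
  show "1 \<le> y" "y < n" by (fact xy zeros)+
  show "V i y = y" "V i (Suc y) = Suc y" if "crow \<le> i" for i
    using crow(1,2) that straight[OF assms, of i] by auto
  show "H crow y = y" "V (crow - 1) y = 0" by (fact crow)+
qed

abbreviation "V1 \<equiv> relabelV y crow V"
abbreviation "H1 \<equiv> relabelH y crow H"

lemma last_cross:
  assumes "p = Suc y"
  shows "V crow (Suc y) = Suc y" "V (crow - 1) (Suc y) = Suc y" "H crow (Suc y) = y"
proof -
  show 1: "V crow (Suc y) = Suc y" "V (crow - 1) (Suc y) = Suc y"
    using straight[OF assms] crow(1) by auto
  have "paired (Suc y) y (Suc y) (H crow (Suc y))" using cell[of crow "Suc y"] crow 1 by simp
  then show "H crow (Suc y) = y" by (auto simp: paired_def)
qed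

lemma last_cross_unique:
  assumes "p = Suc y" shows "(y, Suc y) \<notin> cross_pairs (crow, Suc y) V H"
proof
  assume "(y, Suc y) \<in> cross_pairs (crow, Suc y) V H"
  then obtain i j where ij: "1 \<le> i" "1 \<le> j" "(i, j) \<noteq> (crow, Suc y)" "V i j = Suc y" "H i (j - 1) = y"
    unfolding cross_pairs_def by auto
  have "(i, j) = (crow, Suc y)"
    by (rule ascending_single[OF P E N A ij(1,2,5,4)])
      (use xy crow last_cross[OF assms] in auto)
  then show False using ij by simp
qed

lemma last_descent:
  assumes "p = Suc y" shows "\<pi> (Suc y) < \<pi> y"
proof -
  have "(y, Suc y) \<in> cross_pairs (0, 0) V H"
    using cross_pairsI[of crow "Suc y" "(0, 0)" V "Suc y" H y] crow last_cross[OF assms] xy by auto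
  then show ?thesis using ascending_cross_iff[OF P E N A, of y "Suc y"] xy by simp
qed

text \<open>Once the labels beyond the bump have been exchanged, the j-turn of the bump belongs to
  \<open>y\<close>, and this pipe runs up column \<open>y + 1\<close> to row \<open>x\<close>: an
  ordinary move with \<open>p = y\<close>.\<close>

lemma forward_move_last:
  assumes "p = Suc y" shows "forward_move n y x crow y V1 H1"
proof -
  interpret R: exchange_labels n y crow V H using exchange_crow[OF assms] .
  show ?thesis
  proof
    show "label_field n V1 H1" "nobump (crow, Suc y) V1 H1" using R.label_field' R.nobump' by auto
    show "ascending (cross_pairs (crow, Suc y) V1 H1)"
      using R.ascending'[OF ascending_any[OF A] last_cross_unique[OF assms]] .
    show "V1 x y = 0" "V1 (x - 1) y = 0" "H1 x (y - 1) = 0" "H1 x y = 0"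
      unfolding R.zero_iff using zeros by auto
    show "V1 i (Suc y) = y" if "x \<le> i" "i < crow" for i
      using straight[OF assms that(1)] that by (simp add: relabelV_def)
    show "H1 crow y = y" using crow by (simp add: relabelH_def)
    show "H1 crow (Suc y) = V1 crow (Suc y)"
      using last_cross[OF assms] by (simp add: relabelH_def relabelV_def)
    show "1 \<le> x" "1 \<le> y" "y < n" "x < crow" by (fact xy zeros crow)+
    show "y \<noteq> 0" using xy by simp
  qed
qed

lemma bumped_tiling:
  assumes "p = Suc y" shows "D((crow, Suc y) := Bump) = field_tiling V1 H1"
proof
  interpret R: exchange_labels n y crow V H using exchange_crow[OF assms] .
  fix c :: cell
  obtain i j where c: "c = (i, j)" by (cases c)
  show "(D((crow, Suc y) := Bump)) c = field_tiling V1 H1 c"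
  proof (cases "c = (crow, Suc y)")
    case True
    have "V1 crow (Suc y) = Suc y" "V1 (crow - 1) (Suc y) = y" "H1 crow y = y"
      using last_cross[OF assms] crow xy by (auto simp: relabelV_def relabelH_def)
    then show ?thesis using True crow xy by (auto simp: tile_at_def)
  next
    case False
    have "V i j = 0 \<or> H i (j - 1) = 0 \<or> V (i - 1) j = V i j"
      "V1 i j = 0 \<or> H1 i (j - 1) = 0 \<or> V1 (i - 1) j = V1 i j" if "i \<noteq> 0" "j \<noteq> 0"
      using nobumpD[OF R.N that] nobumpD[OF R.nobump' that] False c by auto
    moreover note z = R.zero_iff(1)[of i j] R.zero_iff(2)[of i "j - 1"] R.zero_iff(1)[of "i - 1" j] R.zero_iff(2)[of i j]
    ultimately have "i \<noteq> 0 \<and> j \<noteq> 0 \<longrightarrow> tile_at (V i j) (H i (j - 1)) (V (i - 1) j) (H i j) =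
       tile_at (V1 i j) (H1 i (j - 1)) (V1 (i - 1) j) (H1 i j)"
      unfolding tile_at_def by (simp only: z) argo
    then show ?thesis using False c by auto
  qed
qed

lemma last_step_eq:
  assumes "p = Suc y"
  shows "last_step (D, (x, y)) = field_tiling (moveV y x crow V1) (moveH y x crow y H1)"
proof -
  have "(THE x'. x < x' \<and> crossing D y (Suc y) (x', Suc y)) = crow"
  proof (rule the_equality)
    show "x < crow \<and> crossing D y (Suc y) (crow, Suc y)"
      unfolding crossing_field[OF P] using crow last_cross[OF assms] xy by auto
  next
    fix k assume k: "x < k \<and> crossing D y (Suc y) (k, Suc y)"
    then have "V k (Suc y) = Suc y" using straight[OF assms] by simp
    then have "H k y = y" using k unfolding crossing_field[OF P] by auto
    then show "k = crow" using H_inj[OF P, of k y crow] crow xy by simp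
  qed
  then show ?thesis
    using forward_move.column_move_eq[OF forward_move_last[OF assms]]
    unfolding last_step.simps Let_def Suc_eq_plus1[symmetric] bumped_tiling[OF assms, symmetric] by simp
qed

lemma last_reduced_field:
  assumes "p = Suc y"
  shows "reduced_field n (\<pi> \<circ> simple_transposition y) (moveV y x crow V1) (moveH y x crow y H1)"
proof -
  interpret R: exchange_labels n y crow V H using exchange_crow[OF assms] .
  interpret F: forward_move n y x crow y V1 H1 using forward_move_last[OF assms] .
  show ?thesis unfolding reduced_field_def using F.label_field' F.nobump' F.exits'[OF R.exits'[OF E]] F.ascending' by blast
qed

lemma last_blank_rows:
  assumes "p = Suc y"
  shows "blank_rows D = blank_rows (last_step (D, (x, y))) + {#x#}"
proof -
  interpret R: exchange_labels n y crow V H using exchange_crow[OF assms] .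
  interpret F: forward_move n y x crow y V1 H1 using forward_move_last[OF assms] .
  have "blank_rows D = blank_rows (field_tiling V1 H1)"
    unfolding blank_rows_def blank_cells_field R.zero_iff ..
  moreover have "V1 crow (Suc y) \<noteq> 0" using last_cross[OF assms] by (simp add: relabelV_def)
  ultimately show ?thesis using F.blank_rows_move unfolding last_step_eq[OF assms] by simp
qed

end

section \<open>Used columns and the shape of the first rows\<close>

lemma south_columns_move:
  assumes "label_field n V H" "label_field n' (moveV y x x' V) H'"
  shows "south_columns (field_tiling (moveV y x x' V) H') i =
    (if x \<le> i \<and> i < x' then transpose y (Suc y) ` south_columns (field_tiling V H) i
     else south_columns (field_tiling V H) i)"
proof -
  have "{j. V i (transpose y (Suc y) j) \<noteq> 0} = transpose y (Suc y) ` {j. V i j \<noteq> 0}"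
    by (auto simp: image_iff) (metis transpose_involutory)
  then show ?thesis
    unfolding south_columns_field[OF assms(1)] south_columns_field[OF assms(2)]
    by (cases "x \<le> i \<and> i < x'") (simp_all only: moveV_def if_True if_False simp_thms)
qed

lemma slide_mark_correct:
  assumes P: "label_field n V H" and xy: "1 \<le> x" "1 \<le> y" and blank: "field_tiling V H (x, y) = Blank"
  obtains y2 where "slide_mark (field_tiling V H, (x, y)) = (field_tiling V H, (x, y2))" "y \<le> y2"
    "\<And>j. y \<le> j \<Longrightarrow> j \<le> y2 \<Longrightarrow> field_tiling V H (x, j) = Blank" "field_tiling V H (x, Suc y2) \<noteq> Blank"
proof -
  let ?D = "field_tiling V H"
  let ?Q = "\<lambda>y'. y \<le> y' \<and> (\<forall>j\<in>{y..y'}. ?D (x, j) = Blank)"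
  define y2 where "y2 = (GREATEST y'. ?Q y')"
  have Qy: "?Q y" using blank by (simp del: field_tiling.simps)
  \<comment> \<open>\<open>GREATEST\<close> needs a bound: blanks lie inside the square.\<close>
  have bnd: "k \<le> n" if "?Q k" for k
  proof -
    have "?D (x, k) = Blank" using that by auto
    then show ?thesis using field_BlankD(6)[OF P xy(1), of k] that xy by simp
  qed
  have Q2: "?Q y2" unfolding y2_def by (rule GreatestI_nat[of ?Q, OF Qy bnd])
  have "?D (x, Suc y2) \<noteq> Blank"
  proof
    assume "?D (x, Suc y2) = Blank"
    then have "?Q (Suc y2)" using Q2 by (auto simp: le_Suc_eq simp del: field_tiling.simps)
    then have "Suc y2 \<le> y2" unfolding y2_def by (rule Greatest_le_nat[of ?Q, OF _ bnd])
    then show False by simp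
  qed
  moreover have "slide_mark (?D, (x, y)) = (?D, (x, y2))" unfolding y2_def by (simp del: field_tiling.simps)
  ultimately show ?thesis using that Q2 by (simp del: field_tiling.simps)
qed

text \<open>From the left, nothing enters the first \<open>i - 1\<close> cells from the west, so the
  pipes above them come straight from below. The row must end with a pipe, which enters by an r-turn
  in some column \<open>m \<ge> i\<close>, and the blanks are the cells from column \<open>i\<close>
  up to that turn.\<close>

lemma row_shape:
  assumes B: "reduced_field n \<pi> V H" and i: "1 \<le> i" and above: "{j. V (i - 1) j \<noteq> 0} = {1..<i}"
  obtains m where "i \<le> m" "{j. V i j \<noteq> 0} = {1..<i} \<union> {m}"
    "\<And>j. 1 \<le> j \<Longrightarrow> field_tiling V H (i, j) = Blank \<longleftrightarrow> i \<le> j \<and> j < m"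
proof -
  note P = reduced_fieldD(1)[OF B] and N = reduced_fieldD(2)[OF B]
  have L: "paired (V i j) (H i (j - 1)) (V (i - 1) j) (H i j)" "V i j = 0 \<or> H i (j - 1) = 0 \<or> V (i - 1) j = V i j"
    if "1 \<le> j" for j
    using label_fieldD(5)[OF P i that] nobumpD[OF N, of i j] i that by auto
  have up: "V (i - 1) j \<noteq> 0 \<longleftrightarrow> 1 \<le> j \<and> j < i" for j using above by auto
  have left: "H i j = 0 \<and> (1 \<le> j \<longrightarrow> V i j \<noteq> 0)" if "j < i" for j
    using that
  proof (induction j)
    case 0
    then show ?case using label_fieldD(3)[OF P] by simp
  next
    case (Suc j)
    then have "V (i - 1) (Suc j) \<noteq> 0" using up by simp
    moreover have "H i j = 0" using Suc by simp
    ultimately show ?case using L(1)[of "Suc j"] by (auto simp: paired_def)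
  qed
  have ex: "\<exists>j\<ge>i. V i j \<noteq> 0"
  proof (rule ccontr)
    assume *: "\<not> ?thesis"
    have "H i j = 0" if "i - 1 \<le> j" for j
      using that
    proof (induction j rule: dec_induct)
      case base
      then show ?case using left[of "i - 1"] i by simp
    next
      case (step j)
      then have "V i (Suc j) = 0" "V (i - 1) (Suc j) = 0" using * up[of "Suc j"] i by auto
      then show ?case using L(1)[of "Suc j"] step by (auto simp: paired_def)
    qed
    then show False using label_fieldD(7)[OF P i, of "n + i"] by simp
  qed
  define m where "m = (LEAST j. i \<le> j \<and> V i j \<noteq> 0)"
  have m: "i \<le> m \<and> V i m \<noteq> 0" unfolding m_def by (rule LeastI_ex) (use ex in blast)
  have before: "V i j = 0" if "i \<le> j" "j < m" for j
    using not_less_Least[of j "\<lambda>j. i \<le> j \<and> V i j \<noteq> 0"] that unfolding m_def by auto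
  have mid: "H i j = 0" if "i - 1 \<le> j" "j < m" for j
    using that
  proof (induction j rule: dec_induct)
    case base
    then show ?case using left[of "i - 1"] i by simp
  next
    case (step j)
    then have "V i (Suc j) = 0" "V (i - 1) (Suc j) = 0" using before[of "Suc j"] up[of "Suc j"] i by auto
    then show ?case using L(1)[of "Suc j"] step by (auto simp: paired_def)
  qed
  have right: "H i j \<noteq> 0 \<and> (m < j \<longrightarrow> V i j = 0)" if "m \<le> j" for j
    using that
  proof (induction j rule: dec_induct)
    case base
    have "i - 1 \<le> m - 1" "m - 1 < m" "1 \<le> m" using m i by auto
    then have "H i (m - 1) = 0" "1 \<le> m" using mid[of "m - 1"] by auto
    moreover have "V (i - 1) m = 0" using up[of m] m by simp
    ultimately show ?case using L(1)[of m] m by (auto simp: paired_def)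
  next
    case (step j)
    have "V (i - 1) (Suc j) = 0" using up[of "Suc j"] m step by simp
    then show ?case using L[of "Suc j"] step by (auto simp: paired_def)
  qed
  have "{j. V i j \<noteq> 0} = {1..<i} \<union> {m}"
  proof (rule set_eqI)
    fix j
    consider "j = 0" | "1 \<le> j" "j < i" | "i \<le> j" "j < m" | "j = m" | "m < j" by linarith
    then show "j \<in> {j. V i j \<noteq> 0} \<longleftrightarrow> j \<in> {1..<i} \<union> {m}"
      by cases (use label_fieldD(2)[OF P] left before right m i in auto)
  qed
  moreover have "field_tiling V H (i, j) = Blank \<longleftrightarrow> i \<le> j \<and> j < m" if j: "1 \<le> j" for j
  proof -
    consider "j < i" | "i \<le> j" "j < m" | "j = m" | "m < j" by linarith
    then show ?thesis
    proof cases
      case 1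
      then have "V i j \<noteq> 0" using left[of j] j by simp
      then show ?thesis unfolding field_Blank_iff[OF P i j] using 1 by simp
    next
      case 2
      then have "V i j = 0" "H i (j - 1) = 0" using before[of j] mid[of "j - 1"] by auto
      then show ?thesis unfolding field_Blank_iff[OF P i j] using 2 by simp
    next
      case 3
      then have "V i j \<noteq> 0" using m by simp
      then show ?thesis unfolding field_Blank_iff[OF P i j] using 3 by simp
    next
      case 4
      then have "H i (j - 1) \<noteq> 0" using right[of "j - 1"] by simp
      then show ?thesis unfolding field_Blank_iff[OF P i j] using 4 by simp
    qed
  qed
  ultimately show ?thesis using that m by blast
qed

section \<open>The greedy path of the operator\<close>

text \<open>The exclusion from \<open>C (Suc i)\<close> determines the path downwards from the
  tiling before the step, the exclusion from \<open>C' i\<close> determines it upwards from the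
  tiling after the step.\<close>

definition greedy_move :: "(nat \<Rightarrow> nat set) \<Rightarrow> (nat \<Rightarrow> nat set) \<Rightarrow> (nat \<Rightarrow> nat) \<Rightarrow> nat \<Rightarrow> bool" where
  "greedy_move C C' f i \<longleftrightarrow> f i \<in> C i \<and> f i \<le> f (Suc i) \<and>
     (\<forall>j. f i \<le> j \<and> j < f (Suc i) \<longrightarrow> j \<notin> C (Suc i) \<and> j \<notin> C' i) \<and>
     C' i = transpose (f i - 1) (f i) ` C i"

text \<open>Above row \<open>r\<close> the used columns are those of the identity, and
  \<open>r < f r\<close> expresses that row \<open>r\<close> contains a blank.\<close>

definition nabla_relation :: "(nat \<Rightarrow> nat set) \<Rightarrow> (nat \<Rightarrow> nat set) \<Rightarrow> nat \<Rightarrow> nat \<Rightarrow> (nat \<Rightarrow> nat) \<Rightarrow> bool" where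
  "nabla_relation C C' r a f \<longleftrightarrow> 1 \<le> r \<and> r < f r \<and> C r = {1..<r} \<union> {f r} \<and>
     (\<forall>i<r. C i = {1..i} \<and> C' i = C i) \<and> (\<forall>i\<ge>r. greedy_move C C' f i) \<and> (\<exists>N. \<forall>i\<ge>N. f i = Suc a)"

text \<open>Without blanks the column \<open>m\<close> of \<open>row_shape\<close> is forced to
  equal the row number, in one row after the other.\<close>

lemma blank_row_structure:
  assumes B: "reduced_field n \<pi> V H" and no: "\<And>i j. 1 \<le> i \<Longrightarrow> i < r \<Longrightarrow> 1 \<le> j \<Longrightarrow> field_tiling V H (i, j) \<noteq> Blank"
  shows "i < r \<Longrightarrow> {j. V i j \<noteq> 0} = {1..i}"
proof (induction i)
  case 0
  then show ?case using label_fieldD(1)[OF reduced_fieldD(1)[OF B]] by simp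
next
  case (Suc i)
  then have "{j. V (Suc i - 1) j \<noteq> 0} = {1..<Suc i}" by (simp add: atLeastLessThanSuc_atLeastAtMost)
  then obtain m where m: "Suc i \<le> m" "{j. V (Suc i) j \<noteq> 0} = {1..<Suc i} \<union> {m}"
    "\<And>j. 1 \<le> j \<Longrightarrow> field_tiling V H (Suc i, j) = Blank \<longleftrightarrow> Suc i \<le> j \<and> j < m"
    using row_shape[OF B, of "Suc i"] by auto
  have "1 \<le> Suc i" by simp
  then have "\<not> (Suc i \<le> Suc i \<and> Suc i < m)"
    using no[OF _ Suc.prems, of "Suc i"] unfolding m(3)[OF \<open>1 \<le> Suc i\<close>, symmetric] by blast
  then have "m = Suc i" using m(1) by simp
  then show ?case unfolding m(2) by auto
qed

lemma first_blank_row_eq: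
  assumes B: "reduced_field n \<pi> V H" and D: "D = field_tiling V H" and r: "1 \<le> r" "r < m"
    and C: "\<And>i. i < r \<Longrightarrow> south_columns D i = {1..i}" "south_columns D r = {1..<r} \<union> {m}"
  shows "first_blank_row D = r" "(r, j) \<in> blank_cells D \<longleftrightarrow> r \<le> j \<and> j < m"
proof -
  note P = reduced_fieldD(1)[OF B]
  have C': "{j. V i j \<noteq> 0} = {1..i}" if "i < r" for i
    using C(1)[OF that] unfolding D south_columns_field[OF P] .
  have shape: "{j. V (i - 1) j \<noteq> 0} = {1..<i}" if "1 \<le> i" "i \<le> r" for i
    using C'[of "i - 1"] that by auto
  obtain k where k: "r \<le> k" "{j. V r j \<noteq> 0} = {1..<r} \<union> {k}"
    "\<And>j. 1 \<le> j \<Longrightarrow> field_tiling V H (r, j) = Blank \<longleftrightarrow> r \<le> j \<and> j < k"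
    using row_shape[OF B r(1) shape[OF r(1) order_refl]] by blast
  have "k = m"
  proof -
    have "{1..<r} \<union> {k} = {1..<r} \<union> {m}" using k(2) C(2) unfolding D south_columns_field[OF P] by simp
    then have "k \<in> {1..<r} \<union> {m}" by blast
    then show ?thesis using k(1) by auto
  qed
  then show blank: "(r, j) \<in> blank_cells D \<longleftrightarrow> r \<le> j \<and> j < m" for j
    using k(3)[of j] r unfolding D blank_cells_def in_grid_def by (cases "j = 0") (auto simp del: field_tiling.simps)
  have "(i, j) \<notin> blank_cells D" if ir: "i < r" for i j
  proof
    assume "(i, j) \<in> blank_cells D"
    then have ij: "1 \<le> i" "1 \<le> j" "field_tiling V H (i, j) = Blank" unfolding D blank_cells_def in_grid_def
      by (auto simp del: field_tiling.simps)
    obtain l where l: "i \<le> l" "{j. V i j \<noteq> 0} = {1..<i} \<union> {l}"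
      "\<And>j. 1 \<le> j \<Longrightarrow> field_tiling V H (i, j) = Blank \<longleftrightarrow> i \<le> j \<and> j < l"
      using row_shape[OF B ij(1) shape[OF ij(1) less_imp_le[OF ir]]] by blast
    have "l \<in> {1..i}" using l(2) C'[OF ir] by blast
    then have "l \<le> i" by simp
    moreover have "i \<le> j \<and> j < l" using l(3)[OF ij(2)] ij(3) by blast
    ultimately show False by linarith
  qed
  then show "first_blank_row D = r"
    unfolding first_blank_row_def using blank[of r] r
    by (intro Least_equality) (auto simp: not_less[symmetric])
qed

text \<open>The path is fixed only down to the current row \<open>x\<close>, from which on the used
  columns are still the original ones. By the last clause, the moves so far have carried one blank
  from row \<open>r\<close> to row \<open>x\<close>.\<close>

definition loop_invariant ::
  "nat \<Rightarrow> (nat \<Rightarrow> nat) \<Rightarrow> (cell \<Rightarrow> tile) \<Rightarrow> nat \<Rightarrow> nat \<Rightarrow> marked_tiling \<Rightarrow> bool" where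
  "loop_invariant n \<pi> D0 r m s \<longleftrightarrow> (\<exists>V H x y f. s = (field_tiling V H, (x, y)) \<and> marked n \<pi> V H x y \<and>
     r \<le> x \<and> f r = m \<and> f x = Suc y \<and>
     (\<forall>i. r \<le> i \<and> i < x \<longrightarrow> greedy_move (south_columns D0) (south_columns (field_tiling V H)) f i) \<and>
     (\<forall>i. i < r \<or> x \<le> i \<longrightarrow> south_columns (field_tiling V H) i = south_columns D0 i) \<and>
     blank_rows (field_tiling V H) + {#r#} = blank_rows D0 + {#x#})"

lemma loop_step:
  assumes "loop_invariant n \<pi> D0 r m s" "\<not> at_last_step s"
  shows "loop_invariant n \<pi> D0 r m (slide_mark (move_step s)) \<and>
    (\<lambda>(D, (x, y)). n - x) (slide_mark (move_step s)) < (\<lambda>(D, (x, y)). n - x) s"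
proof -
  obtain V H x y f where s: "s = (field_tiling V H, (x, y))" and M: "marked n \<pi> V H x y"
    and rx: "r \<le> x" "f r = m" "f x = Suc y"
    and g: "\<And>i. r \<le> i \<Longrightarrow> i < x \<Longrightarrow> greedy_move (south_columns D0) (south_columns (field_tiling V H)) f i"
    and same: "\<And>i. i < r \<or> x \<le> i \<Longrightarrow> south_columns (field_tiling V H) i = south_columns D0 i"
    and rows: "blank_rows (field_tiling V H) + {#r#} = blank_rows D0 + {#x#}"
    using assms(1) unfolding loop_invariant_def by blast
  interpret marked n \<pi> V H x y using M .
  have p: "p \<noteq> Suc y" using assms(2) at_last_step_iff unfolding s by simp
  note j = jrow[OF p]
  interpret F: forward_move n y x jrow p V H using forward_move_jrow[OF p] .
  let ?V = "moveV y x jrow V" and ?H = "moveH y x jrow p H"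
  have B': "reduced_field n \<pi> ?V ?H" using move_reduced_field[OF p] .
  note P' = reduced_fieldD(1)[OF B']
  have jr: "1 \<le> jrow" "1 \<le> Suc y" using j(1) by auto
  have "?V jrow (Suc y) = 0" "?H jrow y = 0" using j xy by (auto simp: moveV_def moveH_def)
  then have "field_tiling ?V ?H (jrow, Suc y) = Blank" using field_Blank_iff[OF P' jr] by simp
  then obtain y2 where y2: "slide_mark (field_tiling ?V ?H, (jrow, Suc y)) = (field_tiling ?V ?H, (jrow, y2))"
    "Suc y \<le> y2" "\<And>j. Suc y \<le> j \<Longrightarrow> j \<le> y2 \<Longrightarrow> field_tiling ?V ?H (jrow, j) = Blank"
    "field_tiling ?V ?H (jrow, Suc y2) \<noteq> Blank"
    using slide_mark_correct[OF P' jr] by blast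
  have s': "slide_mark (move_step s) = (field_tiling ?V ?H, (jrow, y2))"
    unfolding s move_step_eq[OF p] y2(1) ..
  have M': "marked n \<pi> ?V ?H jrow y2"
    by unfold_locales (use B' jr y2 in auto)
  have SC: "south_columns (field_tiling ?V ?H) i = (if x \<le> i \<and> i < jrow then transpose y (Suc y) ` south_columns (field_tiling V H) i
     else south_columns (field_tiling V H) i)" for i
    using south_columns_move[OF P P'] .
  \<comment> \<open>\<open>p\<close> occupies column \<open>y + 1\<close> from row \<open>x\<close>
    to row \<open>jrow - 1\<close>, and in row \<open>jrow\<close> the mark has slid to
    \<open>y2\<close>; the path is always one column right of the mark.\<close>
  define f' where "f' i = (if x \<le> i \<and> i < jrow then Suc y else if i = jrow then Suc y2 else f i)" for i
  have f'_old: "f' i = f i" if "i \<le> x" for i using that rx j(1) unfolding f'_def by auto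
  have g': "greedy_move (south_columns D0) (south_columns (field_tiling ?V ?H)) f' i" if i: "r \<le> i" "i < jrow" for i
  proof (cases "i < x")
    case True
    then have e: "south_columns (field_tiling ?V ?H) i = south_columns (field_tiling V H) i" "f' i = f i"
      "f' (Suc i) = f (Suc i)" using SC[of i] f'_old[of i] f'_old[of "Suc i"] by simp_all
    show ?thesis using g[OF i(1) True] unfolding greedy_move_def e .
  next
    case False
    then have fi: "f' i = Suc y" using i unfolding f'_def by simp
    have "Suc y \<in> south_columns D0 i"
      using same[of i] j(3)[of i] p_pos False i unfolding south_columns_field[OF P] by auto
    moreover have "Suc y \<le> f' (Suc i)" using i False y2(2) unfolding f'_def by auto
    moreover have "k \<notin> south_columns D0 (Suc i) \<and> k \<notin> south_columns (field_tiling ?V ?H) i"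
      if k: "Suc y \<le> k" "k < f' (Suc i)" for k
    proof -
      \<comment> \<open>Within the strip the path is constant. Columns are skipped only at its lower
        end, and they are those over which the mark slides.\<close>
      have ii: "Suc i = jrow" using k i False unfolding f'_def by (auto split: if_splits)
      then have "k \<le> y2" using k unfolding f'_def by simp
      then have bl: "field_tiling ?V ?H (jrow, k) = Blank" using y2(3) k by simp
      have "?V jrow k = 0" "?V (jrow - 1) k = 0" using field_BlankD[OF P' jr(1) _ bl] k by auto
      then have "k \<notin> south_columns (field_tiling ?V ?H) (Suc i)" "k \<notin> south_columns (field_tiling ?V ?H) i"
        unfolding south_columns_field[OF P'] using ii[symmetric] by simp_all
      moreover have "south_columns (field_tiling ?V ?H) (Suc i) = south_columns D0 (Suc i)"
        using SC[of "Suc i"] same[of "Suc i"] ii False by simp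
      ultimately show ?thesis by simp
    qed
    ultimately show ?thesis using SC[of i] same[of i] fi False i unfolding greedy_move_def by simp
  qed
  have same': "south_columns (field_tiling ?V ?H) i = south_columns D0 i" if "i < r \<or> jrow \<le> i" for i
    using SC[of i] same[of i] that rx j(1) by auto
  have "blank_rows (field_tiling V H) + {#jrow#} = blank_rows (field_tiling ?V ?H) + {#x#}"
    using F.blank_rows_move j(2) by simp
  then have "blank_rows (field_tiling ?V ?H) + {#r#} + {#x#} = blank_rows D0 + {#jrow#} + {#x#}"
    using rows by (metis (no_types, opaque_lifting) add.assoc add.commute)
  then have rows': "blank_rows (field_tiling ?V ?H) + {#r#} = blank_rows D0 + {#jrow#}" by simp
  have "f' r = m" "f' jrow = Suc y2" "r \<le> jrow"
    using f'_old[of r] rx j(1) by (auto simp: f'_def)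
  then have "loop_invariant n \<pi> D0 r m (slide_mark (move_step s))"
    unfolding loop_invariant_def s' using M' g' same' rows' by blast
  \<comment> \<open>The mark descends but stays inside the square, so the loop terminates.\<close>
  moreover have "n - jrow < n - x" using F.x'_le j(1) by simp
  moreover have "(\<lambda>(D, (x, y)). n - x) s = n - x" unfolding s by simp
  ultimately show ?thesis unfolding s' by simp
qed

lemma loop_end:
  assumes "loop_invariant n \<pi> D0 r m s" "at_last_step s"
  shows "\<exists>f. f r = m \<and> (\<forall>i. r \<le> i \<longrightarrow> greedy_move (south_columns D0) (south_columns (last_step s)) f i) \<and>
     (\<forall>i<r. south_columns (last_step s) i = south_columns D0 i) \<and>
     (\<exists>N. \<forall>i\<ge>N. f i = Suc (snd (snd s))) \<and>
     blank_rows D0 = blank_rows (last_step s) + {#r#} \<and>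
     last_step s \<in> BPD (\<pi> \<circ> simple_transposition (snd (snd s))) \<and>
     \<pi> (Suc (snd (snd s))) < \<pi> (snd (snd s)) \<and> 1 \<le> snd (snd s)"
proof -
  obtain V H x y f where s: "s = (field_tiling V H, (x, y))" and M: "marked n \<pi> V H x y"
    and rx: "r \<le> x" "f r = m" "f x = Suc y"
    and g: "\<And>i. r \<le> i \<Longrightarrow> i < x \<Longrightarrow> greedy_move (south_columns D0) (south_columns (field_tiling V H)) f i"
    and same: "\<And>i. i < r \<or> x \<le> i \<Longrightarrow> south_columns (field_tiling V H) i = south_columns D0 i"
    and rows: "blank_rows (field_tiling V H) + {#r#} = blank_rows D0 + {#x#}"
    using assms(1) unfolding loop_invariant_def by blast
  interpret marked n \<pi> V H x y using M .
  have p: "p = Suc y" using assms(2) at_last_step_iff unfolding s by simp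
  interpret R: exchange_labels n y crow V H using exchange_crow[OF p] .
  let ?V = "moveV y x crow V1" and ?H = "moveH y x crow y H1"
  have B': "reduced_field n (\<pi> \<circ> simple_transposition y) ?V ?H" using last_reduced_field[OF p] .
  note P' = reduced_fieldD(1)[OF B']
  have s': "last_step s = field_tiling ?V ?H" unfolding s last_step_eq[OF p] ..
  have SC0: "south_columns (field_tiling V1 H1) i = south_columns (field_tiling V H) i" for i
    unfolding south_columns_field[OF P] south_columns_field[OF R.label_field'] R.zero_iff ..
  \<comment> \<open>The last move ends above row \<open>crow\<close>. From there on both columns are
    used and exchanging them changes nothing, so the exchange may be stated for all rows from
    \<open>x\<close> on.\<close>
  have SC: "south_columns (field_tiling ?V ?H) i = (if x \<le> i then transpose y (Suc y) ` south_columns (field_tiling V H) i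
     else south_columns (field_tiling V H) i)" for i
  proof (cases "crow \<le> i")
    case True
    then have "y \<in> south_columns (field_tiling V H) i" "Suc y \<in> south_columns (field_tiling V H) i"
      using crow(1,2) straight[OF p, of i] xy unfolding south_columns_field[OF P] by auto
    then have "transpose y (Suc y) ` south_columns (field_tiling V H) i = south_columns (field_tiling V H) i"
      by (auto simp: transpose_def image_iff)
    then show ?thesis using south_columns_move[OF R.label_field' P', of i] SC0[of i] True by simp
  next
    case False
    then show ?thesis using south_columns_move[OF R.label_field' P', of i] SC0[of i] by simp
  qed
  define f' where "f' i = (if x \<le> i then Suc y else f i)" for i
  have f'_old: "f' i = f i" if "i \<le> x" for i using that rx unfolding f'_def by auto
  have g': "greedy_move (south_columns D0) (south_columns (last_step s)) f' i" if i: "r \<le> i" for i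
  proof (cases "i < x")
    case True
    then have e: "south_columns (last_step s) i = south_columns (field_tiling V H) i" "f' i = f i"
      "f' (Suc i) = f (Suc i)" using SC[of i] f'_old[of i] f'_old[of "Suc i"] unfolding s' by simp_all
    show ?thesis using g[OF i(1) True] unfolding greedy_move_def e .
  next
    case False
    have "Suc y \<in> south_columns (field_tiling V H) i"
      using straight[OF p, of i] False unfolding south_columns_field[OF P] by simp
    moreover have D0: "south_columns (field_tiling V H) i = south_columns D0 i" using same False by simp
    ultimately have "Suc y \<in> south_columns D0 i" by (rule subst[rotated])
    moreover have "f' i = Suc y" "f' (Suc i) = Suc y" using False unfolding f'_def by auto
    moreover have "south_columns (last_step s) i = transpose y (Suc y) ` south_columns D0 i"
      using SC[of i] False unfolding s' D0 by simp
    moreover have "\<not> (Suc y \<le> j \<and> j < Suc y)" for j by linarith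
    ultimately show ?thesis unfolding greedy_move_def by (metis diff_Suc_1 order_refl)
  qed
  have "\<forall>i<r. south_columns (last_step s) i = south_columns D0 i" using SC same rx(1) unfolding s' by simp
  moreover have "\<forall>i\<ge>x. f' i = Suc (snd (snd s))" unfolding f'_def s by simp
  moreover have "f' r = m" using f'_old rx by simp
  moreover have "blank_rows D0 = blank_rows (last_step s) + {#r#}"
    using last_blank_rows[OF p] rows unfolding s by simp
  moreover have "last_step s \<in> BPD (\<pi> \<circ> simple_transposition (snd (snd s)))"
    unfolding s' using field_in_BPD[OF B'] unfolding s by simp
  ultimately show ?thesis using g' last_descent[OF p] xy unfolding s by auto
qed

theorem nabla_correct:
  assumes D: "D \<in> BPD \<pi>" and ne: "blank_cells D \<noteq> {}" and pop: "pop D = (a, r)"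
  shows "\<exists>f. nabla_relation (south_columns D) (south_columns (nabla D)) r a f"
    "nabla D \<in> BPD (\<pi> \<circ> simple_transposition a)" "\<pi> (Suc a) < \<pi> a" "1 \<le> a"
    "blank_rows D = blank_rows (nabla D) + {#r#}"
proof -
  obtain n V H where B: "reduced_field n \<pi> V H" and DV: "D = field_tiling V H" using BPD_imp_field[OF D] by blast
  note P = reduced_fieldD(1)[OF B]
  have r: "r = first_blank_row D" using pop unfolding pop_def by simp
  have "\<exists>r j. (r, j) \<in> blank_cells D" using ne by auto
  then have ex: "\<exists>j. (r, j) \<in> blank_cells D" unfolding r first_blank_row_def by (rule LeastI_ex)
  have no: "(i, j) \<notin> blank_cells D" if "i < r" for i j
    using not_less_Least[of i "\<lambda>r. \<exists>j. (r, j) \<in> blank_cells D"] that unfolding r first_blank_row_def by blast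
  have bl: "(i, j) \<in> blank_cells D \<longleftrightarrow> 1 \<le> i \<and> 1 \<le> j \<and> field_tiling V H (i, j) = Blank" for i j
    unfolding blank_cells_def in_grid_def DV by (simp del: field_tiling.simps)
  have r1: "1 \<le> r" using ex bl by blast
  have noB: "field_tiling V H (i, j) \<noteq> Blank" if "1 \<le> i" "i < r" "1 \<le> j" for i j
  proof
    assume "field_tiling V H (i, j) = Blank"
    then have "(i, j) \<in> blank_cells D" unfolding bl using that by (intro conjI)
    then show False using no[OF that(2)] by (rule notE[rotated])
  qed
  have above: "{j. V i j \<noteq> 0} = {1..i}" if "i < r" for i
    by (rule blank_row_structure[OF B noB that])
  have "r - 1 < r" "{1..r - 1} = {1..<r}" using r1 by auto
  then have "{j. V (r - 1) j \<noteq> 0} = {1..<r}" using above[of "r - 1"] by simp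
  then obtain m where m: "r \<le> m" "{j. V r j \<noteq> 0} = {1..<r} \<union> {m}"
    "\<And>j. 1 \<le> j \<Longrightarrow> field_tiling V H (r, j) = Blank \<longleftrightarrow> r \<le> j \<and> j < m"
    using row_shape[OF B r1] by blast
  have blm: "(r, j) \<in> blank_cells D \<longleftrightarrow> r \<le> j \<and> j < m" for j
  proof (cases "j = 0")
    case True
    then show ?thesis using bl[of r j] r1 by simp
  next
    case False
    then show ?thesis using m(3)[of j] bl[of r j] r1 by (simp del: field_tiling.simps)
  qed
  have rm: "r < m" using ex unfolding blm by (metis le_less_trans)
  have "(GREATEST j. (r, j) \<in> blank_cells D) = m - 1"
    unfolding blm by (rule Greatest_equality) (use rm in auto)
  then have im: "initial_mark D = (r, m - 1)" unfolding initial_mark_def r[symmetric] by simp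
  have "1 \<le> m - 1" "r \<le> m - 1 \<and> m - 1 < m" using rm r1 by auto
  then have y1: "1 \<le> m - 1" "field_tiling V H (r, m - 1) = Blank" using m(3)[of "m - 1"] by blast+
  obtain y2 where sl: "slide_mark (field_tiling V H, (r, m - 1)) = (field_tiling V H, (r, y2))" "m - 1 \<le> y2"
    "\<And>j. m - 1 \<le> j \<Longrightarrow> j \<le> y2 \<Longrightarrow> field_tiling V H (r, j) = Blank" "field_tiling V H (r, Suc y2) \<noteq> Blank"
  proof (rule slide_mark_correct[OF P r1 y1], goal_cases)
    case (1 y2)
    show ?case by (rule 1(1)[OF 1(2-5)])
  qed
  have y2: "slide_mark (D, initial_mark D) = (D, (r, y2))" "m - 1 \<le> y2"
    "field_tiling V H (r, y2) = Blank" "field_tiling V H (r, Suc y2) \<noteq> Blank"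
  proof -
    show "slide_mark (D, initial_mark D) = (D, (r, y2))" unfolding DV im[unfolded DV] by (fact sl(1))
  qed (fact sl(2) sl(3)[OF sl(2) order_refl] sl(4))+
  have "1 \<le> y2" using y1(1) y2(2) by linarith
  then have "y2 < m" using m(3)[of y2] y2(3) by blast
  then have y2m: "Suc y2 = m" using y2(2) by linarith
  have Mk: "marked n \<pi> V H r y2" 
  proof
    show "1 \<le> y2" using y1(1) y2(2) by linarith
  qed (fact B r1 y2)+
  \<comment> \<open>Only the value at \<open>r\<close> is constrained yet, so a constant function
    will do.\<close>
  have init: "loop_invariant n \<pi> D r m (slide_mark (D, initial_mark D))"
    unfolding loop_invariant_def y2(1)
    by (rule exI[of _ V], rule exI[of _ H], rule exI[of _ r], rule exI[of _ y2], rule exI[of _ "\<lambda>_. m"])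
      (simp add: Mk y2m DV del: field_tiling.simps, intro allI impI, linarith)
  have L: "loop_invariant n \<pi> D r m (nabla_loop D) \<and> at_last_step (nabla_loop D)"
    unfolding nabla_loop_def
  proof (rule while_rule[where P = "loop_invariant n \<pi> D r m" and r = "measure (\<lambda>(D, (x, y)). n - x)"])
    show "loop_invariant n \<pi> D r m (slide_mark (D, initial_mark D))" by (rule init)
    show "loop_invariant n \<pi> D r m (slide_mark (move_step s))"
      if "loop_invariant n \<pi> D r m s" "\<not> at_last_step s" for s using loop_step[OF that] by blast
    show "(slide_mark (move_step s), s) \<in> measure (\<lambda>(D, (x, y)). n - x)"
      if "loop_invariant n \<pi> D r m s" "\<not> at_last_step s" for s using loop_step[OF that] by simp
  qed auto
  have a: "snd (snd (nabla_loop D)) = a" using pop unfolding pop_def by simp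
  obtain f where f: "f r = m" "\<forall>i. r \<le> i \<longrightarrow> greedy_move (south_columns D) (south_columns (nabla D)) f i"
    "\<forall>i<r. south_columns (nabla D) i = south_columns D i" "\<exists>N. \<forall>i\<ge>N. f i = Suc a"
    and rest: "blank_rows D = blank_rows (nabla D) + {#r#}" "nabla D \<in> BPD (\<pi> \<circ> simple_transposition a)"
     "\<pi> (Suc a) < \<pi> a" "1 \<le> a"
    using loop_end[OF conjunct1[OF L] conjunct2[OF L]] unfolding a nabla_def[symmetric] by blast
  have "south_columns D r = {1..<r} \<union> {m}" "\<And>i. i < r \<Longrightarrow> south_columns D i = {1..i}"
    using m(2) above unfolding DV south_columns_field[OF P] by auto
  then have "nabla_relation (south_columns D) (south_columns (nabla D)) r a f"
    unfolding nabla_relation_def using f r1 rm by auto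
  then show "\<exists>f. nabla_relation (south_columns D) (south_columns (nabla D)) r a f" by blast
  show "nabla D \<in> BPD (\<pi> \<circ> simple_transposition a)" "\<pi> (Suc a) < \<pi> a" "1 \<le> a"
    "blank_rows D = blank_rows (nabla D) + {#r#}" using rest by auto
qed

section \<open>Inverting nabla\<close>

lemma reduced_field_mono: "reduced_field n \<pi> V H \<Longrightarrow> n \<le> m \<Longrightarrow> reduced_field m \<pi> V H"
  unfolding reduced_field_def using label_field_mono by blast

lemma straight_top:
  assumes B: "reduced_field n \<pi> V H" and y: "1 \<le> y"
  obtains x where "1 \<le> x" "\<forall>i\<ge>x. V i y = y" "V (x - 1) y = 0" "H x y = y" "H x (y - 1) = 0"
proof -
  note P = reduced_fieldD(1)[OF B] and N = reduced_fieldD(2)[OF B]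
  let ?Q = "\<lambda>x. \<forall>i\<ge>x. V i y = y"
  define x where "x = (LEAST x. ?Q x)"
  have "V i y = y" if "n + y \<le> i" for i using label_fieldD(6)[OF P, of i y] that y by simp
  then have "?Q (n + y)" by (intro allI impI)
  then have Q: "?Q x" unfolding x_def by (rule LeastI)
  have Qx: "V x y = y" using Q by (rule allE[of _ x]) (erule mp, rule order_refl)
  have x: "1 \<le> x"
  proof (rule ccontr)
    assume "\<not> 1 \<le> x"
    then have "x = 0" by simp
    then have "V 0 y = y" using Qx by (rule subst)
    then show False using label_fieldD(1)[OF P, of y] y by linarith
  qed
  have ne: "V (x - 1) y \<noteq> y"
  proof
    assume v: "V (x - 1) y = y"
    have "?Q (x - 1)"
    proof (intro allI impI)
      fix i assume "x - 1 \<le> i"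
      then consider "i = x - 1" | "x \<le> i" by linarith
      then show "V i y = y" by cases (use v Q in blast)+
    qed
    then have "x \<le> x - 1" unfolding x_def by (rule Least_le)
    then show False using x by linarith
  qed
  have L: "paired y (H x (y - 1)) (V (x - 1) y) (H x y)" using label_fieldD(5)[OF P x y] Qx by simp
  have "H x (y - 1) = 0 \<or> V (x - 1) y = y" using nobumpD[OF N, of x y] x y Qx by auto
  then have w: "H x (y - 1) = 0" using ne by blast
  then have "V (x - 1) y = 0" "H x y = y" using L ne by (auto simp: paired_def)
  then show ?thesis using that x Q w by blast
qed

lemma backward_construction:
  assumes D': "D' \<in> BPD \<pi>'" and a: "1 \<le> a" "\<pi>' a < \<pi>' (Suc a)" and r: "1 \<le> r"
    and g: "\<And>i. r \<le> i \<Longrightarrow> g i \<in> south_columns D' i" "\<And>i. r \<le> i \<Longrightarrow> g i \<le> g (Suc i)"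
      "\<And>i j. r \<le> i \<Longrightarrow> g i < j \<Longrightarrow> j \<le> g (Suc i) \<Longrightarrow> j \<notin> south_columns D' i"
    and lim: "\<exists>N. \<forall>i\<ge>N. g i = a" and gr: "g r \<notin> south_columns D' (r - 1)"
  shows "\<exists>D\<in>BPD (\<pi>' \<circ> simple_transposition a).
    (\<forall>i\<ge>r. south_columns D i = transpose (g i) (Suc (g i)) ` south_columns D' i) \<and>
    (\<forall>i<r. south_columns D i = south_columns D' i) \<and>
    (\<forall>i\<ge>r. \<forall>j. g i < j \<and> j \<le> g (Suc i) \<longrightarrow> j \<notin> south_columns D (Suc i))"
proof -
  let ?C = "south_columns D'"
  let ?\<pi> = "\<pi>' \<circ> simple_transposition a"
  have gC: "g i = c" if "r \<le> i" "c \<in> ?C i" "g (Suc i) = c" for i c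
    using g(2,3)[OF that(1)] that(2,3) by (metis le_neq_implies_less order_refl)
  have g_run: "g i = c" if "r \<le> i" "i \<le> k" "\<And>l. i \<le> l \<Longrightarrow> l < k \<Longrightarrow> c \<in> ?C l" "g k = c" for i k c
    using that(2,1,3)
  proof (induction i rule: inc_induct)
    case base
    then show ?case using that(4) by simp
  next
    case (step i)
    have "g (Suc i) = c" using step.IH step.prems by simp
    then show ?case using gC[OF step.prems(1)] step.prems(2)[of i] step.hyps by simp
  qed
  obtain n0 V0 H0 where B0: "reduced_field n0 \<pi>' V0 H0" and D0: "D' = field_tiling V0 H0"
    using BPD_imp_field[OF D'] by blast
  \<comment> \<open>The square has to contain the columns \<open>a\<close> and
    \<open>a + 1\<close>.\<close>
  define n where "n = max n0 (Suc (Suc a))"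
  have B: "reduced_field n \<pi>' V0 H0" using reduced_field_mono[OF B0] unfolding n_def by simp
  have an: "Suc a < n" unfolding n_def by simp
  note P0 = reduced_fieldD(1)[OF B]
  have C0: "?C i = {j. V0 i j \<noteq> 0}" for i unfolding D0 south_columns_field[OF P0] ..
  \<comment> \<open>The rows from \<open>x\<close> on are already restored and the mark is at
    \<open>(x, g x)\<close>. The last clause is the greedy rule of the forward direction, from which
    the path of \<open>nabla\<close> will be recognised.\<close>
  define St where "St x \<longleftrightarrow> (\<exists>V H. reduced_field n ?\<pi> V H \<and> r \<le> x \<and> g x \<notin> ?C (x - 1) \<and>
     field_tiling V H (x, g x) = Blank \<and>
     (\<forall>i\<ge>x. {j. V i j \<noteq> 0} = transpose (g i) (Suc (g i)) ` ?C i) \<and> (\<forall>i<x. {j. V i j \<noteq> 0} = ?C i) \<and>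
     (\<forall>i\<ge>x. \<forall>j. g i < j \<and> j \<le> g (Suc i) \<longrightarrow> V (Suc i) j = 0))" for x
  have image_transpose: "{j. moveV y x x' V i j \<noteq> 0} =
      (if x \<le> i \<and> i < x' then transpose y (Suc y) ` {j. V i j \<noteq> 0} else {j. V i j \<noteq> 0})"
    for y x x' i and V :: "nat \<Rightarrow> nat \<Rightarrow> nat"
  proof (cases "x \<le> i \<and> i < x'")
    case True
    then have "moveV y x x' V i j = V i (transpose y (Suc y) j)" for j by (simp add: moveV_def)
    then show ?thesis using True by (auto simp: image_iff) (metis transpose_involutory)
  next
    case False
    then have "moveV y x x' V i j = V i j" for j by (simp only: moveV_def if_False)
    then show ?thesis by (simp only: if_not_P[OF False])
  qed
  have start: "\<exists>x. St x"
  proof -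
    obtain x where x: "1 \<le> x" "\<forall>i\<ge>x. V0 i a = a" "V0 (x - 1) a = 0" "H0 x a = a" "H0 x (a - 1) = 0"
      by (rule straight_top[OF B a(1)])
    obtain x' where x': "1 \<le> x'" "\<forall>i\<ge>x'. V0 i (Suc a) = Suc a" "V0 (x' - 1) (Suc a) = 0"
      "H0 x' (Suc a) = Suc a" "H0 x' (Suc a - 1) = 0"
      by (rule straight_top[OF B, of "Suc a"]) simp
    have nocross: "(a, Suc a) \<notin> cross_pairs (0, 0) V0 H0"
      using ascending_cross_iff[OF P0 reduced_fieldD(3)[OF B] reduced_fieldD(2)[OF B] reduced_fieldD(4)[OF B], of a "Suc a"] a
      by simp
    \<comment> \<open>If pipe \<open>a + 1\<close> were already straight in row \<open>x\<close>,
      pipe \<open>a\<close>, turning right there, would cross it, against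
      \<open>\<pi>' a < \<pi>' (Suc a)\<close>.\<close>
    have xx': "x < x'"
    proof (rule ccontr)
      assume "\<not> x < x'"
      then have "V0 x (Suc a) = Suc a" using x'(2) by simp
      then have "(a, Suc a) \<in> cross_pairs (0, 0) V0 H0"
        using cross_pairsI[of x "Suc a" "(0, 0)" V0 "Suc a" H0 a] x(1,4) a by simp
      then show False using nocross by blast
    qed
    \<comment> \<open>Moved to column \<open>a + 1\<close>, pipe \<open>a\<close> touches the turn
      of pipe \<open>a + 1\<close> in a bump at \<open>(x', a + 1)\<close>; exchanging the labels
      beyond it makes the bump a cross.\<close>
    interpret M: backward_move n a x x' a V0 H0
    proof
      show "label_field n V0 H0" "nobump (x', Suc a) V0 H0" "ascending (cross_pairs (x', Suc a) V0 H0)"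
        by (fact P0 nobump_any[OF reduced_fieldD(2)[OF B]] ascending_any[OF reduced_fieldD(4)[OF B]])+
      show "1 \<le> x" "1 \<le> a" "x < x'" "V0 (x - 1) a = 0" "V0 (x' - 1) (Suc a) = 0" by (fact x a xx' x')+
      show "a < n" "a \<noteq> 0" using an a by auto
      show "V0 i a = a" if "x \<le> i" "i < x'" for i using x(2) that(1) by blast
      show "H0 x' a = 0" using x'(5) by simp
      show "H0 x' (Suc a) = V0 x' (Suc a)" using x'(2,4) by simp
      show "nobump (0, 0) V0 H0" "ascending (cross_pairs (0, 0) V0 H0)"
        by (fact reduced_fieldD(2)[OF B] reduced_fieldD(4)[OF B])+
    qed
    let ?V1 = "moveV a x x' V0" and ?H1 = "unmoveH a x x' a H0"
    interpret R: exchange_labels n a x' ?V1 ?H1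
    proof
      show "label_field n ?V1 ?H1" "nobump (x', Suc a) ?V1 ?H1" by (fact M.label_field' M.nobump')+
      show "1 \<le> x'" "1 \<le> a" by (fact x' a)+
      show "a < n" using an by simp
      show "?V1 i a = a" "?V1 i (Suc a) = Suc a" if "x' \<le> i" for i
        using that x(2) x'(2) xx' by (simp_all add: moveV_simps)
      show "?H1 x' a = a" using xx' by (simp add: unmoveH_def)
      show "?V1 (x' - 1) a = 0" using x'(3) M.x'_pred by (simp add: moveV_simps)
    qed
    let ?V = "relabelV a x' ?V1" and ?H = "relabelH a x' ?H1"
    have b1: "?V x' (Suc a) = Suc a" "?H x' a = a"
      using R.cols(2)[of x'] R.bottom by (auto simp: relabelV_def relabelH_def)
    have b2: "?V (x' - 1) (Suc a) = Suc a"
      using M.x'_pred x(2) by (simp add: relabelV_def moveV_simps)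
    have N: "nobump (0, 0) ?V ?H"
      unfolding nobump_def
    proof (intro allI impI)
      fix i j :: nat assume ij: "1 \<le> i" "1 \<le> j"
      show "?V i j = 0 \<or> ?H i (j - 1) = 0 \<or> ?V (i - 1) j = ?V i j"
      proof (cases "(i, j) = (x', Suc a)")
        case True
        then have "i = x'" "j = Suc a" by auto
        then show ?thesis using b1 b2 by (simp only: simp_thms)
      next
        case False
        show ?thesis by (rule nobumpD[OF R.nobump' _ _ False]) (use ij in auto)
      qed
    qed
    have A: "ascending (cross_pairs (x', Suc a) ?V ?H)"
      by (rule R.ascending'[OF M.ascending']) (use nocross M.cross_pairs' in blast)
    have "ascending (cross_pairs (0, 0) ?V ?H)"
      unfolding ascending_def
    proof clarify
      fix w s assume "(w, s) \<in> cross_pairs (0, 0) ?V ?H"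
      then obtain i j where ij: "1 \<le> i" "1 \<le> j" "s = ?V i j" "w = ?H i (j - 1)" "s \<noteq> 0" "w \<noteq> 0"
        unfolding cross_pairs_def by blast
      show "w < s"
      proof (cases "(i, j) = (x', Suc a)")
        case True
        then show ?thesis using ij(3,4) b1 by simp
      next
        case False
        then have "(w, s) \<in> cross_pairs (x', Suc a) ?V ?H" using cross_pairsI[OF ij(1,2) False] ij by metis
        then show ?thesis by (rule ascendingD[OF A])
      qed
    qed
    then have BV: "reduced_field n ?\<pi> ?V ?H"
      unfolding reduced_field_def using R.label_field' N R.exits'[OF M.exits'[OF reduced_fieldD(3)[OF B]]] by blast
    have aC: "a \<in> ?C i" if "x \<le> i" for i using x(2) that a unfolding C0 by auto
    have g_a: "g i = a" if "r \<le> i" "x \<le> i" for i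
    proof -
      obtain N where "\<forall>i\<ge>N. g i = a" using lim by blast
      then have "g (i + N) = a" by simp
      then show ?thesis using g_run[of i "i + N" a] aC that by auto
    qed
    have rx: "r \<le> x"
    proof (rule ccontr)
      assume "\<not> r \<le> x"
      then have "g r = a" "a \<in> ?C (r - 1)" using g_a[of r] aC[of "r - 1"] by auto
      then show False using gr by simp
    qed
    have g_x: "g i = a" if "x \<le> i" for i using g_a[of i] rx that by simp
    have "?V x a = 0" "?H x (a - 1) = 0"
      unfolding R.zero_iff using M.top_row xx' a by (simp_all add: moveV_simps unmoveH_def)
    then have blank: "field_tiling ?V ?H (x, g x) = Blank"
      using field_Blank_iff[OF R.label_field' x(1) a(1)] g_x[of x] by simp
    have SC: "{j. ?V i j \<noteq> 0} = (if x \<le> i then transpose a (Suc a) ` ?C i else ?C i)" for i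
    proof (cases "x' \<le> i")
      case True
      then have "a \<in> ?C i" "Suc a \<in> ?C i" using aC x'(2) xx' unfolding C0 by auto
      then have "transpose a (Suc a) ` ?C i = ?C i" by (auto simp: transpose_def image_iff)
      then show ?thesis unfolding R.zero_iff image_transpose using True C0[of i] by auto
    next
      case False
      then show ?thesis unfolding R.zero_iff image_transpose using C0[of i] by auto
    qed
    have "g x \<notin> ?C (x - 1)" using x(3) g_x[of x] unfolding C0 by simp
    moreover have "\<forall>i\<ge>x. {j. ?V i j \<noteq> 0} = transpose (g i) (Suc (g i)) ` ?C i"
      using SC g_x by simp
    moreover have "\<forall>i<x. {j. ?V i j \<noteq> 0} = ?C i" using SC by simp
    moreover have "\<not> (g i < j \<and> j \<le> g (Suc i))" if "x \<le> i" for i j using g_x[of i] g_x[of "Suc i"] that by simp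
    ultimately have "St x" unfolding St_def using BV rx blank by blast
    then show ?thesis by blast
  qed
  have step: "\<exists>x0<x. St x0" if "St x" "r < x" for x
  proof -
    obtain V H where S: "reduced_field n ?\<pi> V H \<and> r \<le> x \<and> g x \<notin> ?C (x - 1) \<and>
     field_tiling V H (x, g x) = Blank \<and>
     (\<forall>i\<ge>x. {j. V i j \<noteq> 0} = transpose (g i) (Suc (g i)) ` ?C i) \<and> (\<forall>i<x. {j. V i j \<noteq> 0} = ?C i) \<and>
     (\<forall>i\<ge>x. \<forall>j. g i < j \<and> j \<le> g (Suc i) \<longrightarrow> V (Suc i) j = 0)"
      using \<open>St x\<close> unfolding St_def by (elim exE) (rule that)
    have BV: "reduced_field n ?\<pi> V H" using S by (elim conjE)
    have gx: "g x \<notin> ?C (x - 1)" using S by (elim conjE)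
    have bl: "field_tiling V H (x, g x) = Blank" using S by (elim conjE)
    have "\<forall>i\<ge>x. {j. V i j \<noteq> 0} = transpose (g i) (Suc (g i)) ` ?C i" using S by (elim conjE)
    then have low: "{j. V i j \<noteq> 0} = transpose (g i) (Suc (g i)) ` ?C i" if "x \<le> i" for i
      by (rule allE) (erule mp, rule that)
    have "\<forall>i<x. {j. V i j \<noteq> 0} = ?C i" using S by (elim conjE)
    then have up: "{j. V i j \<noteq> 0} = ?C i" if "i < x" for i by (rule allE) (erule mp, rule that)
    have no': "\<forall>i\<ge>x. \<forall>j. g i < j \<and> j \<le> g (Suc i) \<longrightarrow> V (Suc i) j = 0" using S by (elim conjE)
    have no: "V (Suc i) j = 0" if "x \<le> i" "g i < j" "j \<le> g (Suc i)" for i j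
      using no'[rule_format, OF that(1) conjI[OF that(2,3)]] .
    note P = reduced_fieldD(1)[OF BV]
    have x1: "1 \<le> x" "Suc (x - 1) = x" "r \<le> x - 1" using \<open>r < x\<close> by auto
    \<comment> \<open>The move to be undone took place in the columns \<open>c\<close> and
      \<open>c + 1\<close>.\<close>
    define c where "c = g (x - 1)"
    have cC: "c \<in> ?C (x - 1)" unfolding c_def by (rule g(1)[OF x1(3)])
    have "c \<le> g x" using g(2)[OF x1(3)] x1(2) unfolding c_def by simp
    moreover have "c \<noteq> g x" using cC gx by blast
    ultimately have cx: "c < g x" by simp
    have Vc: "V (x - 1) c \<noteq> 0" using up[of "x - 1"] cC x1 by auto
    have c1: "1 \<le> c" using Vc label_fieldD(2)[OF P, of "x - 1"] by (cases c) auto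
    have gn: "g x < n" using field_BlankD(6)[OF P x1(1) _ bl] cx by simp
    have blanks: "field_tiling V H (x, j) = Blank" if "c < j" "j \<le> g x" for j
      using that(2,1)
    proof (induction j rule: inc_induct)
      case base
      then show ?case using bl by simp
    next
      case (step j)
      have "field_tiling V H (x, Suc j) = Blank" using step by simp
      then have e: "H x j = 0" using field_BlankD(2)[OF P x1(1), of "Suc j"] by simp
      have "j \<notin> ?C (x - 1)" using g(3)[OF x1(3), of j] step x1(2) unfolding c_def by simp
      then have "V (x - 1) j = 0" using up[of "x - 1"] x1 by auto
      then have "V x j = 0" "H x (j - 1) = 0"
        using label_fieldD(5)[OF P x1(1), of j] e step by (auto simp: paired_def)
      then show ?case using field_Blank_iff[OF P x1(1), of j] step by simp
    qed
    have bc: "field_tiling V H (x, Suc c) = Blank" using blanks[of "Suc c"] cx by simp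
    note z = field_BlankD[OF P x1(1) _ bc]
    have z': "V x (Suc c) = 0" "H x c = 0" "V (x - 1) (Suc c) = 0" "H x (Suc c) = 0"
      using z by auto
    let ?Q = "\<lambda>k. \<forall>i. k \<le> i \<and> i < x \<longrightarrow> V i c \<noteq> 0"
    \<comment> \<open>The top of the unbroken run of used edges in column \<open>c\<close> that ends
      just above row \<open>x\<close>.\<close>
    define x0 where "x0 = (LEAST k. ?Q k)"
    have Qx: "?Q (x - 1)"
    proof (intro allI impI)
      fix i assume "x - 1 \<le> i \<and> i < x"
      then have "i = x - 1" by linarith
      then show "V i c \<noteq> 0" using Vc by simp
    qed
    have Q0: "?Q x0" unfolding x0_def by (rule LeastI[of ?Q, OF Qx])
    have "x0 \<le> x - 1" unfolding x0_def by (rule Least_le[of ?Q, OF Qx])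
    then have x0x: "x0 < x" using x1 by linarith
    have x01: "1 \<le> x0"
    proof (rule ccontr)
      assume "\<not> 1 \<le> x0"
      then have "V 0 c \<noteq> 0" using Q0 x1 by simp
      then show False using label_fieldD(1)[OF P] by simp
    qed
    have top: "V (x0 - 1) c = 0"
    proof (rule ccontr)
      assume v: "V (x0 - 1) c \<noteq> 0"
      have "?Q (x0 - 1)"
      proof (intro allI impI)
        fix i assume i: "x0 - 1 \<le> i \<and> i < x"
        then consider "i = x0 - 1" | "x0 \<le> i" by linarith
        then show "V i c \<noteq> 0"
        proof cases
          case 1
          then show ?thesis using v by simp
        next
          case 2
          then show ?thesis using Q0 i by blast
        qed
      qed
      then have "x0 \<le> x0 - 1" unfolding x0_def by (rule Least_le)
      then show False using x01 by linarith
    qed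
    define p where "p = V (x - 1) c"
    have p0: "p \<noteq> 0" using Vc unfolding p_def .
    have "i \<le> x - 1 \<Longrightarrow> x0 \<le> i \<Longrightarrow> V i c = p" for i
    proof (induction i rule: inc_induct)
      case base
      show ?case unfolding p_def ..
    next
      case (step i)
      then have "V (Suc i) c = p" "V i c \<noteq> 0" using Q0 x0x by auto
      then show ?case using reduced_field_column_label[OF BV, of i c] p0 by simp
    qed
    then have col: "V i c = p" if "x0 \<le> i" "i < x" for i using that by simp
    interpret M: backward_move n c x0 x p V H
    proof
      show "label_field n V H" "nobump (x, Suc c) V H" "ascending (cross_pairs (x, Suc c) V H)"
        by (fact P nobump_any[OF reduced_fieldD(2)[OF BV]] ascending_any[OF reduced_fieldD(4)[OF BV]])+
      show "1 \<le> x0" "1 \<le> c" "x0 < x" "V (x0 - 1) c = 0" "V (x - 1) (Suc c) = 0" "p \<noteq> 0" "H x c = 0"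
        by (fact x01 c1 x0x top z' p0)+
      show "c < n" using cx gn by simp
      show "V i c = p" if "x0 \<le> i" "i < x" for i using col[OF that] .
      show "H x (Suc c) = V x (Suc c)" using z' by simp
      show "nobump (0, 0) V H" "ascending (cross_pairs (0, 0) V H)"
        by (fact reduced_fieldD(2)[OF BV] reduced_fieldD(4)[OF BV])+
    qed
    let ?V = "moveV c x0 x V" and ?H = "unmoveH c x0 x p H"
    \<comment> \<open>This time the bottom cell becomes a j-tile and not a bump, so nothing remains
      exempt.\<close>
    have b0: "?V x (Suc c) = 0" using z' by (simp add: moveV_simps)
    have N: "nobump (0, 0) ?V ?H"
      unfolding nobump_def
    proof (intro allI impI)
      fix i j :: nat assume ij: "1 \<le> i" "1 \<le> j"
      show "?V i j = 0 \<or> ?H i (j - 1) = 0 \<or> ?V (i - 1) j = ?V i j"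
      proof (cases "(i, j) = (x, Suc c)")
        case True
        then show ?thesis using b0 by simp
      next
        case False
        show ?thesis by (rule nobumpD[OF M.nobump' _ _ False]) (use ij in auto)
      qed
    qed
    have "ascending (cross_pairs (0, 0) ?V ?H)"
      unfolding ascending_def
    proof clarify
      fix w s assume "(w, s) \<in> cross_pairs (0, 0) ?V ?H"
      then obtain i j where ij: "1 \<le> i" "1 \<le> j" "s = ?V i j" "w = ?H i (j - 1)" "s \<noteq> 0" "w \<noteq> 0"
        unfolding cross_pairs_def by blast
      have ne: "(i, j) \<noteq> (x, Suc c)" using ij(3,5) b0 by auto
      then have "(w, s) \<in> cross_pairs (x, Suc c) ?V ?H" using cross_pairsI[OF ij(1,2) ne] ij by metis
      then show "w < s" by (rule ascendingD[OF M.ascending'])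
    qed
    then have BV': "reduced_field n ?\<pi> ?V ?H"
      unfolding reduced_field_def using M.label_field' N M.exits'[OF reduced_fieldD(3)[OF BV]] by blast
    have cCi: "c \<in> ?C i" if "x0 \<le> i" "i < x" for i using Q0 up[OF that(2)] that by auto
    have g_c: "g i = c" if "r \<le> i" "x0 \<le> i" "i < x" for i
      using g_run[of i "x - 1" c] cCi that unfolding c_def by auto
    have rx0: "r \<le> x0"
    proof (rule ccontr)
      assume n: "\<not> r \<le> x0"
      then have "g r = c" "c \<in> ?C (r - 1)" using g_c[of r] cCi[of "r - 1"] \<open>r < x\<close> by auto
      then show False using gr by simp
    qed
    have g_x0: "g i = c" if "x0 \<le> i" "i < x" for i using g_c[of i] rx0 that by simp
    have "?V x0 c = 0" "?H x0 (c - 1) = 0"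
      using M.top_row x0x c1 by (simp_all add: moveV_simps unmoveH_def)
    then have blank: "field_tiling ?V ?H (x0, g x0) = Blank"
      using field_Blank_iff[OF M.label_field' x01 c1] g_x0[of x0] x0x by simp
    have lt: "x0 - 1 < x" using x0x by linarith
    have "c \<notin> ?C (x0 - 1)" unfolding up[OF lt, symmetric] using top by simp
    then have "g x0 \<notin> ?C (x0 - 1)" using g_x0[of x0] x0x by simp
    moreover have "{j. ?V i j \<noteq> 0} = transpose (g i) (Suc (g i)) ` ?C i" if "x0 \<le> i" for i
    proof (cases "i < x")
      case True
      then show ?thesis unfolding image_transpose using g_x0[of i] up[of i] that by simp
    next
      case False
      then show ?thesis unfolding image_transpose using low[of i] by simp
    qed
    moreover have "\<forall>i<x0. {j. ?V i j \<noteq> 0} = ?C i" unfolding image_transpose using up x0x by simp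
    moreover have "?V (Suc i) j = 0" if "x0 \<le> i" "g i < j" "j \<le> g (Suc i)" for i j
    proof -
      have "\<not> Suc i < x" using that g_x0[of i] g_x0[of "Suc i"] by auto
      moreover have "V (Suc i) j = 0"
      proof (cases "x \<le> i")
        case True
        then show ?thesis using no that by simp
      next
        case False
        then have i: "Suc i = x" using \<open>\<not> Suc i < x\<close> by simp
        then have "c < j" "j \<le> g x" using that g_x0[of i] by auto
        then show ?thesis using field_BlankD(1)[OF P x1(1) _ blanks] i by simp
      qed
      ultimately show ?thesis by (simp add: moveV_def)
    qed
    ultimately have "St x0" unfolding St_def using BV' rx0 blank by blast
    then show ?thesis using x0x by blast
  qed
  define x where "x = (LEAST x. St x)"
  have x: "St x" unfolding x_def using start by (rule LeastI_ex)
  then have "r \<le> x" unfolding St_def by blast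
  moreover have "\<not> r < x"
  proof
    assume "r < x"
    then obtain x0 where "x0 < x" "St x0" using step[OF x] by blast
    then show False using not_less_Least[of x0 St] unfolding x_def by blast
  qed
  ultimately have "St r" using x by simp
  then obtain V H where BV: "reduced_field n ?\<pi> V H"
    and V: "\<forall>i\<ge>r. {j. V i j \<noteq> 0} = transpose (g i) (Suc (g i)) ` ?C i" "\<forall>i<r. {j. V i j \<noteq> 0} = ?C i"
      "\<forall>i\<ge>r. \<forall>j. g i < j \<and> j \<le> g (Suc i) \<longrightarrow> V (Suc i) j = 0"
    unfolding St_def by blast
  show ?thesis
  proof (rule bexI[of _ "field_tiling V H"])
    show "field_tiling V H \<in> BPD ?\<pi>" using field_in_BPD[OF BV] .
    show "(\<forall>i\<ge>r. south_columns (field_tiling V H) i = transpose (g i) (Suc (g i)) ` ?C i) \<and>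
      (\<forall>i<r. south_columns (field_tiling V H) i = ?C i) \<and>
      (\<forall>i\<ge>r. \<forall>j. g i < j \<and> j \<le> g (Suc i) \<longrightarrow> j \<notin> south_columns (field_tiling V H) (Suc i))"
      unfolding south_columns_field[OF reduced_fieldD(1)[OF BV]]
    proof (intro conjI)
      show "\<forall>i\<ge>r. \<forall>j. g i < j \<and> j \<le> g (Suc i) \<longrightarrow> j \<notin> {j. V (Suc i) j \<noteq> 0}" using V(3) by simp
    qed (rule V)+
  qed
qed

section \<open>The bijection\<close>

lemma identity_reduced_field:
  "reduced_field 0 id (\<lambda>i j. if 1 \<le> j \<and> j \<le> i then j else 0) (\<lambda>i j. if 1 \<le> i \<and> i \<le> j then i else 0)"
    (is "reduced_field 0 id ?V ?H")
proof -
  have one: "?V i j = 0 \<or> ?H i (j - 1) = 0" if "1 \<le> i" "1 \<le> j" for i j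
    using that by auto
  have "paired (?V i j) (?H i (j - 1)) (?V (i - 1) j) (?H i j)" if "1 \<le> i" "1 \<le> j" for i j
  proof -
    consider "j < i" | "j = i" | "i < j" by linarith
    then show ?thesis by cases (use that in \<open>auto simp: paired_def\<close>)
  qed
  then have "label_field 0 ?V ?H" unfolding label_field_def by auto
  moreover have "nobump (0, 0) ?V ?H" unfolding nobump_def using one by blast
  moreover have "cross_pairs (0, 0) ?V ?H = {}"
  proof (rule equals0I)
    fix c assume "c \<in> cross_pairs (0, 0) ?V ?H"
    then obtain i j where ij: "1 \<le> i" "1 \<le> j" "?V i j \<noteq> 0" "?H i (j - 1) \<noteq> 0"
      unfolding cross_pairs_def mem_Collect_eq case_prod_unfold by metis
    show False using one[OF ij(1,2)] ij(3,4) by (elim disjE notE)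
  qed
  then have "ascending (cross_pairs (0, 0) ?V ?H)" by (simp add: ascending_def)
  moreover have "exits id ?H" unfolding exits_def by (auto intro: exI)
  ultimately show ?thesis unfolding reduced_field_def by blast
qed

definition identity_tiling :: "cell \<Rightarrow> tile" where
  "identity_tiling = field_tiling (\<lambda>i j. if 1 \<le> j \<and> j \<le> i then j else 0) (\<lambda>i j. if 1 \<le> i \<and> i \<le> j then i else 0)"

lemma identity_tiling_BPD: "identity_tiling \<in> BPD id"
  unfolding identity_tiling_def by (rule field_in_BPD[OF identity_reduced_field])

lemma south_columns_identity: "south_columns identity_tiling i = {1..i}"
  unfolding identity_tiling_def south_columns_field[OF reduced_fieldD(1)[OF identity_reduced_field]] by auto

lemma no_blank_south_columns:
  assumes "D \<in> BPD \<pi>" "blank_cells D = {}"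
  shows "south_columns D i = {1..i}"
proof -
  obtain n V H where B: "reduced_field n \<pi> V H" and D: "D = field_tiling V H" using BPD_imp_field[OF assms(1)] by blast
  have "field_tiling V H (k, j) \<noteq> Blank" if "1 \<le> k" "1 \<le> j" for k j
    using assms(2) that unfolding D blank_cells_def in_grid_def by (auto simp del: field_tiling.simps)
  then have "{j. V i j \<noteq> 0} = {1..i}" using blank_row_structure[OF B, of "Suc i" i] by blast
  then show ?thesis unfolding D south_columns_field[OF reduced_fieldD(1)[OF B]] .
qed

lemma no_blank_identity: "D \<in> BPD \<pi> \<Longrightarrow> blank_cells D = {} \<Longrightarrow> D = identity_tiling"
  by (rule BPD_eqI[OF _ identity_tiling_BPD]) (simp_all only: no_blank_south_columns south_columns_identity)

lemma BPD_determines_permutation: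
  assumes "D \<in> BPD \<pi>" "D \<in> BPD \<rho>" "1 \<le> p"
  shows "\<pi> p = \<rho> p"
proof -
  obtain n V H where B: "reduced_field n \<pi> V H" and D: "D = field_tiling V H" using BPD_imp_field[OF assms(1)] by blast
  have "\<exists>m. \<forall>j\<ge>m. ((\<pi> p, j), East) \<in> bpd_pipe D p" "\<exists>m. \<forall>j\<ge>m. ((\<rho> p, j), East) \<in> bpd_pipe D p"
    using assms unfolding BPD_def by blast+
  then obtain m m' where "\<forall>j\<ge>m. ((\<pi> p, j), East) \<in> bpd_pipe D p" "\<forall>j\<ge>m'. ((\<rho> p, j), East) \<in> bpd_pipe D p"
    by blast
  then have "((\<pi> p, Suc (m + m')), East) \<in> bpd_pipe D p" "((\<rho> p, Suc (m + m')), East) \<in> bpd_pipe D p"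
    by auto
  then have "H (\<pi> p) (m + m') = p" "H (\<rho> p) (m + m') = p"
    unfolding D bpd_pipe_field[OF reduced_fieldD(1)[OF B]] by auto
  then show ?thesis using H_inj[OF reduced_fieldD(1)[OF B], of "\<pi> p" "m + m'" "\<rho> p"] assms(3) by auto
qed

section \<open>Comparing and inverting greedy paths\<close>

lemma nabla_relation_mono:
  assumes "nabla_relation C C' r a f" "r \<le> i" "i \<le> k"
  shows "f i \<le> f k"
  using assms(3)
proof (induction k rule: dec_induct)
  case (step k)
  then have "f k \<le> f (Suc k)" using assms unfolding nabla_relation_def greedy_move_def by simp
  then show ?case using step.IH by simp
qed simp

lemma nabla_relation_le:
  assumes "nabla_relation C C' r a f" "r \<le> i"
  shows "f i \<le> Suc a"
proof -
  obtain N where "\<forall>i\<ge>N. f i = Suc a" using assms unfolding nabla_relation_def by blast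
  then have "f (i + N) = Suc a" by simp
  then show ?thesis using nabla_relation_mono[OF assms, of "i + N"] by simp
qed

lemma nabla_relation_target:
  assumes R: "nabla_relation C C' r a f" and i: "r \<le> i"
  shows "f i - 1 \<in> C' i" "r \<le> f i - 1" "f i - 1 < f i"
proof -
  have "f r \<le> f i" using nabla_relation_mono[OF R order_refl i] .
  then show "r \<le> f i - 1" "f i - 1 < f i" using R unfolding nabla_relation_def by auto
  have "f i \<in> C i" "C' i = transpose (f i - 1) (f i) ` C i"
    using R i unfolding nabla_relation_def greedy_move_def by auto
  then show "f i - 1 \<in> C' i" by (metis imageI transpose_apply_second)
qed

text \<open>Above row \<open>r\<close> the result still has the used columns of the identity, so the
  next step cannot start there. If it also starts in row \<open>r\<close>, its path begins one
  column left of the first and stays left of it: in every row \<open>f (Suc i) - 1\<close> is a used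
  column that the greedy second path cannot skip.\<close>

lemma nabla_relation_compatible:
  assumes R: "nabla_relation C C' r a f" and R': "nabla_relation C' C'' r' a' f'"
  shows "r \<le> a" "r \<le> r'" "r = r' \<Longrightarrow> a' < a"
proof -
  have r: "1 \<le> r" "r < f r" "C r = {1..<r} \<union> {f r}" "\<And>i. i < r \<Longrightarrow> C' i = {1..i}"
    "C' r = transpose (f r - 1) (f r) ` C r"
    using R unfolding nabla_relation_def greedy_move_def by auto
  have r': "1 \<le> r'" "r' < f' r'" "C' r' = {1..<r'} \<union> {f' r'}" using R' unfolding nabla_relation_def by auto
  show "r \<le> a" using nabla_relation_le[OF R order_refl] r(2) by simp
  show "r \<le> r'"
  proof (rule ccontr)
    assume "\<not> r \<le> r'"
    then have "C' r' = {1..r'}" using r(4)[of r'] by simp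
    then have "f' r' \<in> {1..r'}" using r'(3) by blast
    then show False using r'(2) by simp
  qed
  assume rr: "r = r'"
  have "f r - 1 \<in> {1..<r} \<union> {f' r}" using nabla_relation_target(1)[OF R order_refl] r'(3) rr by simp
  then have base: "f' r = f r - 1" using nabla_relation_target(2)[OF R order_refl] by auto
  have le: "f' i \<le> f i - 1" if "r \<le> i" for i
    using that
  proof (induction i rule: dec_induct)
    case base
    then show ?case using \<open>f' r = f r - 1\<close> by simp
  next
    case (step i)
    show ?case
    proof (rule ccontr)
      assume n: "\<not> ?case"
      have "f i \<le> f (Suc i)" using nabla_relation_mono[OF R step(1)] by simp
      then have "f' i \<le> f (Suc i) - 1 \<and> f (Suc i) - 1 < f' (Suc i)" using step.IH n by linarith
      then have "f (Suc i) - 1 \<notin> C' (Suc i)"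
        using R' step(1) rr unfolding nabla_relation_def greedy_move_def by blast
      then show False using nabla_relation_target(1)[OF R, of "Suc i"] step(1) by simp
    qed
  qed
  obtain N where N: "\<forall>i\<ge>N. f i = Suc a" using R unfolding nabla_relation_def by blast
  obtain N' where N': "\<forall>i\<ge>N'. f' i = Suc a'" using R' unfolding nabla_relation_def by blast
  have "f (r + N + N') = Suc a" "f' (r + N + N') = Suc a'" using N N' by auto
  then show "a' < a" using le[of "r + N + N'"] by simp
qed

text \<open>Both paths are \<open>a + 1\<close> far down, and upwards each is determined by the
  common result; then the transposition in each row can be undone.\<close>

lemma nabla_relation_inj:
  assumes R1: "nabla_relation C1 C' r a f1" and R2: "nabla_relation C2 C' r a f2"
  shows "C1 i = C2 i"
proof -
  have f: "f1 i = f2 i" if "r \<le> i" for i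
  proof -
    \<comment> \<open>The column \<open>f2 i - 1\<close> is used after the step, but it lies where
      the first path admits no used column.\<close>
    have not_less: "\<not> f1 i < f2 i"
      if R1: "nabla_relation C1 C' r a f1" and R2: "nabla_relation C2 C' r a f2" and i: "r \<le> i"
        and eq: "f1 (Suc i) = f2 (Suc i)" for C1 C2 f1 f2 i
    proof
      assume "f1 i < f2 i"
      moreover have "f2 i \<le> f2 (Suc i)" using nabla_relation_mono[OF R2 i] by simp
      ultimately have "f1 i \<le> f2 i - 1 \<and> f2 i - 1 < f1 (Suc i)" using eq by linarith
      then have "f2 i - 1 \<notin> C' i" using R1 i unfolding nabla_relation_def greedy_move_def by blast
      then show False using nabla_relation_target(1)[OF R2 i] by simp
    qed
    obtain N1 where N1: "\<forall>i\<ge>N1. f1 i = Suc a" using R1 unfolding nabla_relation_def by blast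
    obtain N2 where N2: "\<forall>i\<ge>N2. f2 i = Suc a" using R2 unfolding nabla_relation_def by blast
    have top: "f1 (i + N1 + N2) = f2 (i + N1 + N2)" using N1 N2 by simp
    have "f1 k = f2 k" if "k \<le> i + N1 + N2" "r \<le> k" for k
      using that
    proof (induction k rule: inc_induct)
      case base
      show ?case by (rule top)
    next
      case (step k)
      then have "f1 (Suc k) = f2 (Suc k)" by simp
      then have "\<not> f1 k < f2 k" "\<not> f2 k < f1 k"
        using not_less[OF R1 R2 step.prems] not_less[OF R2 R1 step.prems] by auto
      then show ?case by simp
    qed
    then show ?thesis using \<open>r \<le> i\<close> by simp
  qed
  show ?thesis
  proof (cases "r \<le> i")
    case True
    have 1: "C' i = transpose (f1 i - 1) (f1 i) ` C1 i"
      using R1 True unfolding nabla_relation_def greedy_move_def by blast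
    have 2: "C' i = transpose (f1 i - 1) (f1 i) ` C2 i"
      using R2 True unfolding f[OF True] nabla_relation_def greedy_move_def by blast
    have 3: "transpose (f1 i - 1) (f1 i) ` C1 i = transpose (f1 i - 1) (f1 i) ` C2 i"
      by (rule trans[OF 1[symmetric] 2])
    have 4: "transpose (f1 i - 1) (f1 i) ` transpose (f1 i - 1) (f1 i) ` X = X" for X
      by (simp add: image_image)
    show ?thesis using 4[of "C1 i"] 4[of "C2 i"] unfolding 3 by (rule trans[OF sym])
  next
    case False
    then have "i < r" by simp
    have "C' i = C1 i" using R1 \<open>i < r\<close> unfolding nabla_relation_def by blast
    moreover have "C' i = C2 i" using R2 \<open>i < r\<close> unfolding nabla_relation_def by blast
    ultimately show ?thesis by (rule trans[OF sym])
  qed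
qed

text \<open>\<open>g\<close> is built upwards from row \<open>N\<close>, each value being the
  greatest admissible one below its successor. The path \<open>f\<close> keeps the sets of
  candidates nonempty and stays below \<open>g\<close>.\<close>

lemma ex_greedy_path:
  fixes C :: "nat \<Rightarrow> nat set"
  assumes lower: "\<And>i. r \<le> i \<Longrightarrow> f i \<in> C i" "\<And>i. r \<le> i \<Longrightarrow> f i \<le> f (Suc i)" "\<And>i. r \<le> i \<Longrightarrow> f i \<le> a"
    and far: "\<And>i. N \<le> i \<Longrightarrow> a \<in> C i"
  shows "\<exists>g. (\<forall>i\<ge>r. g i \<in> C i \<and> f i \<le> g i \<and> g i \<le> g (Suc i) \<and> (\<forall>j. g i < j \<and> j \<le> g (Suc i) \<longrightarrow> j \<notin> C i)) \<and>
    (\<forall>i\<ge>N. g i = a)"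
proof -
  \<comment> \<open>\<open>h k\<close> is the value \<open>k\<close> rows above row
    \<open>N\<close>; truncated subtraction makes \<open>g\<close> constant from row
    \<open>N\<close> on.\<close>
  define h where "h = rec_nat a (\<lambda>k b. Max {j \<in> C (N - Suc k). j \<le> b})"
  have h: "h 0 = a" "h (Suc k) = Max {j \<in> C (N - Suc k). j \<le> h k}" for k by (auto simp: h_def)
  define g where "g i = h (N - i)" for i
  have far_g: "g i = a" if "N \<le> i" for i using that h(1) by (simp add: g_def)
  have rec: "g i = Max {j \<in> C i. j \<le> g (Suc i)}" if "i < N" for i
  proof -
    have "N - i = Suc (N - Suc i)" "N - Suc (N - Suc i) = i" using that by auto
    then show ?thesis unfolding g_def using h(2)[of "N - Suc i"] by simp
  qed
  have Max: "g i \<in> C i \<and> g i \<le> g (Suc i) \<and> f i \<le> g i \<and> (\<forall>j. g i < j \<and> j \<le> g (Suc i) \<longrightarrow> j \<notin> C i)"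
    if "r \<le> i" "i < N" "f (Suc i) \<le> g (Suc i)" for i
  proof -
    let ?S = "{j \<in> C i. j \<le> g (Suc i)}"
    have fin: "finite ?S" by (rule finite_subset[of _ "{..g (Suc i)}"]) auto
    have fS: "f i \<in> ?S" using lower(1,2)[OF that(1)] that(3) by simp
    have "g i \<in> ?S" unfolding rec[OF that(2)] by (rule Max_in[OF fin]) (use fS in blast)
    moreover have "f i \<le> g i" unfolding rec[OF that(2)] by (rule Max_ge[OF fin fS])
    moreover have "j \<le> g i" if "j \<in> C i" "j \<le> g (Suc i)" for j
      unfolding rec[OF \<open>i < N\<close>] by (rule Max_ge[OF fin]) (use that in simp)
    ultimately show ?thesis by fastforce
  qed
  have ge: "f i \<le> g i" if "r \<le> i" for i
  proof (cases "N \<le> i")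
    case True
    then show ?thesis using far_g lower(3)[OF that] by simp
  next
    case False
    then have "i \<le> N" by simp
    then show ?thesis using that
    proof (induction i rule: inc_induct)
      case base
      then show ?case using far_g[of N] lower(3) by simp
    next
      case (step i)
      then show ?case using Max[of i] by simp
    qed
  qed
  have "g i \<in> C i \<and> f i \<le> g i \<and> g i \<le> g (Suc i) \<and> (\<forall>j. g i < j \<and> j \<le> g (Suc i) \<longrightarrow> j \<notin> C i)" if "r \<le> i" for i
  proof (cases "i < N")
    case True
    then show ?thesis using Max[OF that True] ge[of "Suc i"] that by simp
  next
    case False
    then show ?thesis using far_g[of i] far_g[of "Suc i"] far[of i] ge[OF that] by auto
  qed
  then show ?thesis using far_g by blast
qed

text \<open>Nothing enters the leftmost \<open>r\<close> columns from the west, so a column used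
  above a row is also used below it.\<close>

lemma columns_persist:
  assumes B: "reduced_field n \<pi> V H" and "{j. V r j \<noteq> 0} = {1..r}" "r \<le> i" "1 \<le> j" "j \<le> r"
  shows "V i j \<noteq> 0"
proof -
  note P = reduced_fieldD(1)[OF B]
  have "\<forall>j\<le>r. H (Suc i) j = 0 \<and> (1 \<le> j \<longrightarrow> V (Suc i) j \<noteq> 0)" if "\<And>j. 1 \<le> j \<Longrightarrow> j \<le> r \<Longrightarrow> V i j \<noteq> 0" for i
  proof (intro allI impI)
    fix j assume "j \<le> r"
    then show "H (Suc i) j = 0 \<and> (1 \<le> j \<longrightarrow> V (Suc i) j \<noteq> 0)"
    proof (induction j)
      case 0
      then show ?case using label_fieldD(3)[OF P] by simp
    next
      case (Suc j)
      have "paired (V (Suc i) (Suc j)) (H (Suc i) j) (V i (Suc j)) (H (Suc i) (Suc j))"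
        using label_fieldD(5)[OF P, of "Suc i" "Suc j"] by simp
      moreover have "V i (Suc j) \<noteq> 0" using that[of "Suc j"] Suc.prems by simp
      moreover have "H (Suc i) j = 0" using Suc by simp
      ultimately show ?case by (auto simp: paired_def)
    qed
  qed
  note persist = this
  have "\<forall>j. 1 \<le> j \<and> j \<le> r \<longrightarrow> V i j \<noteq> 0"
    using assms(3)
  proof (induction i rule: dec_induct)
    case base
    then show ?case using assms(2) by auto
  next
    case (step i)
    then show ?case using persist[of i] by blast
  qed
  then show ?thesis using assms(4,5) by blast
qed

text \<open>The lower path is that of the next step if it starts in row \<open>r\<close> too; it
  ends at \<open>fst (pop D') + 1\<close>, which is at most \<open>a\<close> by assumption.
  Otherwise column \<open>r\<close> is used in every row from \<open>r\<close> on and the constant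
  \<open>r \<le> a\<close> serves.\<close>

lemma nabla_surjective:
  assumes D': "D' \<in> BPD \<pi>'" and a: "1 \<le> a" "\<pi>' a < \<pi>' (Suc a)" and r: "1 \<le> r" "r \<le> a"
    and pop': "blank_cells D' \<noteq> {} \<Longrightarrow> r \<le> snd (pop D') \<and> (r = snd (pop D') \<longrightarrow> fst (pop D') < a)"
  shows "\<exists>D\<in>BPD (\<pi>' \<circ> simple_transposition a). pop D = (a, r) \<and> nabla D = D'"
proof -
  let ?C = "south_columns D'"
  obtain n V H where B: "reduced_field n \<pi>' V H" and DV: "D' = field_tiling V H" using BPD_imp_field[OF D'] by blast
  note P = reduced_fieldD(1)[OF B]
  have C: "?C i = {j. V i j \<noteq> 0}" for i unfolding DV south_columns_field[OF P] ..
  have "\<exists>f. (\<forall>i\<ge>r. f i \<in> ?C i \<and> f i \<le> f (Suc i) \<and> f i \<le> a) \<and> ?C r = {1..<r} \<union> {f r} \<and> r \<le> f r \<and>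
      (\<forall>i<r. ?C i = {1..i})"
  proof (cases "blank_cells D' = {} \<or> r < snd (pop D')")
    case True
    have id: "?C i = {1..i}" if "i \<le> r" for i
    proof (cases "blank_cells D' = {}")
      case True
      then show ?thesis using no_blank_south_columns[OF D'] by blast
    next
      case False
      obtain f' where R: "nabla_relation ?C (south_columns (nabla D')) (snd (pop D')) (fst (pop D')) f'"
        using nabla_correct(1)[OF D' False, of "fst (pop D')" "snd (pop D')"] by auto
      have "i < snd (pop D')" using True False \<open>i \<le> r\<close> by simp
      then show ?thesis using R unfolding nabla_relation_def by blast
    qed
    have rC: "r \<in> ?C i" if "r \<le> i" for i
    proof -
      have "V i r \<noteq> 0" by (rule columns_persist[OF B _ that r(1) order_refl]) (use id[of r] C in simp)
      then show ?thesis unfolding C by simp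
    qed
    have "{1..r} = {1..<r} \<union> {r}" using r(1) by auto
    then have Cr: "?C r = {1..<r} \<union> {r}" unfolding id[OF order_refl] .
    show ?thesis
    proof (rule exI[of _ "\<lambda>_. r"], intro conjI allI impI)
      show "?C i = {1..i}" if "i < r" for i by (rule id[OF less_imp_le[OF that]])
    qed (rule rC Cr r(2) order_refl, assumption?)+
  next
    case False
    then have ne: "blank_cells D' \<noteq> {}" and eq: "snd (pop D') = r" using pop' by auto
    have lt: "fst (pop D') < a" using pop'[OF ne] eq by simp
    have "pop D' = (fst (pop D'), r)" using eq by (metis prod.collapse)
    then obtain f' where R: "nabla_relation ?C (south_columns (nabla D')) r (fst (pop D')) f'"
      using nabla_correct(1)[OF D' ne] by blast
    have "f' i \<in> ?C i \<and> f' i \<le> f' (Suc i) \<and> f' i \<le> a" if "r \<le> i" for i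
      using R that nabla_relation_le[OF R that] lt unfolding nabla_relation_def greedy_move_def by auto
    moreover have "?C r = {1..<r} \<union> {f' r}" "r \<le> f' r" "\<forall>i<r. ?C i = {1..i}"
      using R unfolding nabla_relation_def by auto
    ultimately show ?thesis by blast
  qed
  then obtain f where f: "\<And>i. r \<le> i \<Longrightarrow> f i \<in> ?C i" "\<And>i. r \<le> i \<Longrightarrow> f i \<le> f (Suc i)"
    "\<And>i. r \<le> i \<Longrightarrow> f i \<le> a" and fr: "?C r = {1..<r} \<union> {f r}" "r \<le> f r" and up: "\<And>i. i < r \<Longrightarrow> ?C i = {1..i}"
    by blast
  have far: "a \<in> ?C i" if "n + a \<le> i" for i unfolding C using label_fieldD(6)[OF P, of i a] that a(1) by simp
  obtain g where g: "\<forall>i\<ge>r. g i \<in> ?C i \<and> f i \<le> g i \<and> g i \<le> g (Suc i) \<and> (\<forall>j. g i < j \<and> j \<le> g (Suc i) \<longrightarrow> j \<notin> ?C i)"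
    "\<forall>i\<ge>n + a. g i = a" using ex_greedy_path[of r f ?C a "n + a", OF f far] by blast
  \<comment> \<open>In row \<open>r\<close> the only used column from \<open>r\<close> on is
    \<open>f r\<close>.\<close>
  have gr: "g r = f r"
  proof -
    have "g r \<in> {1..<r} \<union> {f r}" "f r \<le> g r" using g(1) fr(1) by auto
    then show ?thesis using fr(2) by auto
  qed
  have "?C (r - 1) = {1..r - 1}" using up[of "r - 1"] r(1) by simp
  then have gr': "g r \<notin> ?C (r - 1)" using gr fr(2) r(1) by auto
  have gg: "\<And>i. r \<le> i \<Longrightarrow> g i \<in> ?C i" "\<And>i. r \<le> i \<Longrightarrow> g i \<le> g (Suc i)"
    "\<And>i j. r \<le> i \<Longrightarrow> g i < j \<Longrightarrow> j \<le> g (Suc i) \<Longrightarrow> j \<notin> ?C i" using g(1) by blast+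
  have lim: "\<exists>N. \<forall>i\<ge>N. g i = a" using g(2) by (rule exI)
  have ex: "\<exists>D\<in>BPD (\<pi>' \<circ> simple_transposition a).
    (\<forall>i\<ge>r. south_columns D i = transpose (g i) (Suc (g i)) ` ?C i) \<and>
    (\<forall>i<r. south_columns D i = ?C i) \<and>
    (\<forall>i\<ge>r. \<forall>j. g i < j \<and> j \<le> g (Suc i) \<longrightarrow> j \<notin> south_columns D (Suc i))"
    by (rule backward_construction[OF D' a r(1) _ _ _ lim gr']) (fact gg)+
  obtain D where D: "D \<in> BPD (\<pi>' \<circ> simple_transposition a)"
    and DD: "(\<forall>i\<ge>r. south_columns D i = transpose (g i) (Suc (g i)) ` ?C i) \<and>
      (\<forall>i<r. south_columns D i = ?C i) \<and>
      (\<forall>i\<ge>r. \<forall>j. g i < j \<and> j \<le> g (Suc i) \<longrightarrow> j \<notin> south_columns D (Suc i))"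
    using ex by (elim bexE) (rule that)
  have low: "south_columns D i = transpose (g i) (Suc (g i)) ` ?C i" if "r \<le> i" for i
    by (rule conjunct1[OF DD, rule_format, OF that])
  have up': "south_columns D i = ?C i" if "i < r" for i
    by (rule conjunct1[OF conjunct2[OF DD], rule_format, OF that])
  have no: "j \<notin> south_columns D (Suc i)" if "r \<le> i" "g i < j" "j \<le> g (Suc i)" for i j
    by (rule conjunct2[OF conjunct2[OF DD], rule_format, OF that(1) conjI[OF that(2,3)]])
  have "transpose (g r) (Suc (g r)) k = k" if "k \<in> {1..<r}" for k
    using that gr fr(2) by (intro transpose_apply_other) auto
  then have "transpose (g r) (Suc (g r)) ` ({1..<r} \<union> {g r}) = {1..<r} \<union> {Suc (g r)}"
    by (simp add: image_Un)
  then have Dr: "south_columns D r = {1..<r} \<union> {Suc (g r)}" using low[OF order_refl] fr(1) gr by simp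
  have Di: "south_columns D i = {1..i}" if "i < r" for i using up'[OF that] up[OF that] by simp
  obtain n' V' H' where B': "reduced_field n' (\<pi>' \<circ> simple_transposition a) V' H'" and DV': "D = field_tiling V' H'"
    using BPD_imp_field[OF D] by blast
  have rm: "r < Suc (g r)" using gr fr(2) by simp
  have row: "first_blank_row D = r" "(r, r) \<in> blank_cells D"
    using first_blank_row_eq[OF B' DV' r(1) rm Di Dr] rm by auto
  define a2 where "a2 = fst (pop D)"
  have pop: "pop D = (a2, r)" unfolding a2_def using row(1) by (simp add: pop_def)
  have ne: "blank_cells D \<noteq> {}" using row(2) by blast
  obtain f2 where R: "nabla_relation (south_columns D) (south_columns (nabla D)) r a2 f2"
    using nabla_correct(1)[OF D ne pop] by blast
  \<comment> \<open>Both \<open>f2\<close> and \<open>Suc \<circ> g\<close> pick the first used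
    column of \<open>D\<close> that is not left of the preceding value.\<close>
  have f2: "f2 i = Suc (g i)" if "r \<le> i" for i
    using that
  proof (induction i rule: dec_induct)
    case base
    have "south_columns D r = {1..<r} \<union> {f2 r}" "r < f2 r" using R unfolding nabla_relation_def by auto
    then have "f2 r \<in> {1..<r} \<union> {Suc (g r)}" using Dr by blast
    then show ?case using \<open>r < f2 r\<close> by auto
  next
    case (step i)
    have s: "r \<le> Suc i" using step by simp
    have "g (Suc i) \<in> ?C (Suc i)" "g i \<le> g (Suc i)" using g(1) step s by auto
    then have in1: "Suc (g (Suc i)) \<in> south_columns D (Suc i)" "f2 i \<le> Suc (g (Suc i))"
      unfolding low[OF s] using step.IH by (metis imageI transpose_apply_first, simp)
    have in2: "f2 (Suc i) \<in> south_columns D (Suc i)" "f2 i \<le> f2 (Suc i)"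
      "\<And>j. f2 i \<le> j \<Longrightarrow> j < f2 (Suc i) \<Longrightarrow> j \<notin> south_columns D (Suc i)"
      using R s step(1) unfolding nabla_relation_def greedy_move_def by auto
    have "\<not> Suc (g (Suc i)) < f2 (Suc i)" using in2(3)[of "Suc (g (Suc i))"] in1 by blast
    moreover have "\<not> f2 (Suc i) < Suc (g (Suc i))"
    proof
      assume "f2 (Suc i) < Suc (g (Suc i))"
      then have "f2 (Suc i) \<notin> south_columns D (Suc i)" using no[OF step(1), of "f2 (Suc i)"] in2(2) step.IH by simp
      then show False using in2(1) by simp
    qed
    ultimately show ?case by simp
  qed
  obtain N where "\<forall>i\<ge>N. f2 i = Suc a2" using R unfolding nabla_relation_def by blast
  then have "f2 (r + N + (n + a)) = Suc a2" by simp
  moreover have "g (r + N + (n + a)) = a" using g(2) by simp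
  ultimately have aa: "a2 = a" using f2[of "r + N + (n + a)"] by simp
  have "south_columns (nabla D) i = ?C i" for i
  proof (cases "r \<le> i")
    case True
    have "south_columns (nabla D) i = transpose (f2 i - 1) (f2 i) ` south_columns D i"
      using R True unfolding nabla_relation_def greedy_move_def by blast
    also have "\<dots> = transpose (g i) (Suc (g i)) ` transpose (g i) (Suc (g i)) ` ?C i"
      using f2[OF True] low[OF True] by simp
    also have "\<dots> = ?C i" by (simp add: image_image)
    finally show ?thesis .
  next
    case False
    then have "south_columns (nabla D) i = south_columns D i" using R unfolding nabla_relation_def by simp
    then show ?thesis using up'[of i] False by simp
  qed
  then have "nabla D = D'" by (rule BPD_eqI[OF nabla_correct(2)[OF D ne pop] D'])
  then show ?thesis using D pop aa by blast
qed

section \<open>Induction on the length\<close>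

lemma compatible_Cons:
  "(a # as, r # rs) \<in> compatible_sequences \<pi> \<longleftrightarrow>
    \<pi> \<in> S_infinity \<and> 1 \<le> a \<and> \<pi> (Suc a) < \<pi> a \<and> (as, rs) \<in> compatible_sequences (\<pi> \<circ> simple_transposition a) \<and>
    1 \<le> r \<and> r \<le> a \<and> (as \<noteq> [] \<longrightarrow> r \<le> hd rs \<and> (a < hd as \<longrightarrow> r < hd rs))"
proof -
  have all_less: "(\<forall>k<Suc m. Q k) \<longleftrightarrow> Q 0 \<and> (\<forall>k<m. Q (Suc k))" for Q :: "nat \<Rightarrow> bool" and m
    using less_Suc_eq_0_disj by auto
  have all_Suc: "(\<forall>k. Q k) \<longleftrightarrow> Q 0 \<and> (\<forall>k. Q (Suc k))" for Q :: "nat \<Rightarrow> bool"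
    by (metis not0_implies_Suc)
  show ?thesis
  proof (cases "length rs = length as")
    case True
    have hd: "as \<noteq> [] \<Longrightarrow> hd as = as ! 0 \<and> hd rs = rs ! 0" using True by (metis hd_conv_nth length_0_conv)
    have c1: "(\<forall>k<length (a # as). 1 \<le> (r # rs) ! k \<and> (r # rs) ! k \<le> (a # as) ! k) \<longleftrightarrow>
        1 \<le> r \<and> r \<le> a \<and> (\<forall>k<length as. 1 \<le> rs ! k \<and> rs ! k \<le> as ! k)"
      unfolding list.size add_0_right add_Suc_right all_less by auto
    have c2: "(\<forall>k. Suc k < length (a # as) \<longrightarrow> (r # rs) ! k \<le> (r # rs) ! Suc k) \<longleftrightarrow>
        (as \<noteq> [] \<longrightarrow> r \<le> hd rs) \<and> (\<forall>k. Suc k < length as \<longrightarrow> rs ! k \<le> rs ! Suc k)"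
      by (subst all_Suc) (use hd in auto)
    have c3: "(\<forall>k. Suc k < length (a # as) \<longrightarrow> (a # as) ! k < (a # as) ! Suc k \<longrightarrow> (r # rs) ! k < (r # rs) ! Suc k) \<longleftrightarrow>
        (as \<noteq> [] \<longrightarrow> a < hd as \<longrightarrow> r < hd rs) \<and> (\<forall>k. Suc k < length as \<longrightarrow> as ! k < as ! Suc k \<longrightarrow> rs ! k < rs ! Suc k)"
      by (subst all_Suc) (use hd in auto)
    show ?thesis
      unfolding compatible_sequences_def mem_Collect_eq case_prod_conv c1 c2 c3 reduced_word_Cons
      using True by auto
  next
    case False
    then show ?thesis by (simp add: compatible_sequences_def)
  qed
qed

text \<open>\<open>phi\<close> with the number of steps as a parameter, so that the permutation can
  change in the induction.\<close>

definition pops :: "nat \<Rightarrow> (cell \<Rightarrow> tile) \<Rightarrow> nat list \<times> nat list" where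
  "pops k D = (map (\<lambda>i. fst (pop ((nabla ^^ i) D))) [0..<k], map (\<lambda>i. snd (pop ((nabla ^^ i) D))) [0..<k])"

lemma pops_Suc:
  "pops (Suc k) D = (fst (pop D) # fst (pops k (nabla D)), snd (pop D) # snd (pops k (nabla D)))"
proof -
  have "[0..<Suc k] = 0 # map Suc [0..<k]" by (simp add: map_Suc_upt upt_conv_Cons del: upt_Suc)
  then show ?thesis unfolding pops_def by (simp add: funpow_swap1 comp_def del: upt_Suc)
qed

text \<open>A tiling without blanks is that of the identity, and from a blank \<open>nabla\<close>
  would produce a descent of \<open>\<pi>\<close>.\<close>

lemma blank_cells_empty_iff:
  assumes S: "\<pi> \<in> S_infinity" and D: "D \<in> BPD \<pi>"
  shows "blank_cells D = {} \<longleftrightarrow> \<pi> = id"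
proof
  assume "blank_cells D = {}"
  then have "D \<in> BPD id" using no_blank_identity[OF D] identity_tiling_BPD by simp
  then have "\<pi> p = p" if "1 \<le> p" for p using BPD_determines_permutation[OF D _ that, of id] by simp
  moreover have "\<pi> 0 = 0" by (rule S_infinity_0[OF S])
  ultimately show "\<pi> = id" by (metis eq_id_iff less_one not_le)
next
  assume id: "\<pi> = id"
  show "blank_cells D = {}"
  proof (rule ccontr)
    assume "blank_cells D \<noteq> {}"
    then have "\<pi> (Suc (fst (pop D))) < \<pi> (fst (pop D))"
      using nabla_correct(3)[OF D, of "fst (pop D)" "snd (pop D)"] by simp
    then show False using id by simp
  qed
qed

text \<open>One step of \<open>nabla\<close> splits off the first pair of the sequence and removes
  one blank from the row it records, so both claims reduce to a permutation of smaller
  length.\<close>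

lemma pops_bij:
  assumes "\<pi> \<in> S_infinity" "coxeter_length \<pi> = k"
  shows "bij_betw (pops k) (BPD \<pi>) (compatible_sequences \<pi>) \<and>
    (\<forall>D\<in>BPD \<pi>. blank_rows D = mset (snd (pops k D)))"
  using assms
proof (induction k arbitrary: \<pi>)
  case 0
  then have id: "\<pi> = id" using coxeter_length_eq_0_iff by blast
  have bl: "blank_cells D = {}" if "D \<in> BPD \<pi>" for D using blank_cells_empty_iff[OF 0(1) that] id by simp
  have "BPD \<pi> = {identity_tiling}" using no_blank_identity bl identity_tiling_BPD id by blast
  moreover have "compatible_sequences \<pi> = {([], [])}"
  proof -
    have "(as, rs) \<in> compatible_sequences \<pi> \<longleftrightarrow> as = [] \<and> rs = []" for as rs
    proof (cases as)
      case Nil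
      then show ?thesis using reduced_word_Nil[of \<pi>] id by (auto simp: compatible_sequences_def)
    next
      case (Cons a as')
      then show ?thesis using id reduced_word_Cons[of a as' \<pi>] by (auto simp: compatible_sequences_def)
    qed
    then show ?thesis by auto
  qed
  moreover have "pops 0 D = ([], [])" for D by (simp add: pops_def)
  moreover have "blank_rows D = {#}" if "D \<in> BPD \<pi>" for D using bl[OF that] by (simp add: blank_rows_def)
  ultimately show ?case by (auto simp: bij_betw_def)
next
  case (Suc k)
  note S = Suc.prems(1)
  have nid: "\<pi> \<noteq> id" using coxeter_length_eq_0_iff[OF S] Suc.prems(2) by auto
  have main: "pop D = (a, r) \<Longrightarrow> 1 \<le> a \<and> \<pi> (Suc a) < \<pi> a \<and> nabla D \<in> BPD (\<pi> \<circ> simple_transposition a) \<and>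
      blank_rows D = blank_rows (nabla D) + {#r#} \<and>
      (\<exists>f. nabla_relation (south_columns D) (south_columns (nabla D)) r a f)"
    if "D \<in> BPD \<pi>" for D a r
    using nabla_correct[OF that] blank_cells_empty_iff[OF S that] nid by blast
  have IH: "\<pi> \<circ> simple_transposition a \<in> S_infinity \<and> coxeter_length (\<pi> \<circ> simple_transposition a) = k \<and>
      bij_betw (pops k) (BPD (\<pi> \<circ> simple_transposition a)) (compatible_sequences (\<pi> \<circ> simple_transposition a)) \<and>
      (\<forall>D\<in>BPD (\<pi> \<circ> simple_transposition a). blank_rows D = mset (snd (pops k D)))"
    if "1 \<le> a" "\<pi> (Suc a) < \<pi> a" for a
  proof -
    have "\<pi> \<circ> simple_transposition a \<in> S_infinity"
      by (rule S_infinity_compose[OF S simple_transposition_S_infinity[OF that(1)]])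
    moreover have "coxeter_length (\<pi> \<circ> simple_transposition a) = k"
      using coxeter_length_descent[OF S that] Suc.prems(2) by simp
    ultimately show ?thesis using Suc.IH by blast
  qed
  have hd: "pops k D' = (as, rs) \<Longrightarrow> as \<noteq> [] \<Longrightarrow> hd as = fst (pop D') \<and> hd rs = snd (pop D')" for D' as rs
    by (cases k) (auto simp: pops_def upt_conv_Cons simp del: upt_Suc)
  have into: "pops (Suc k) D \<in> compatible_sequences \<pi>" if D: "D \<in> BPD \<pi>" for D
  proof -
    obtain a r where pop: "pop D = (a, r)" by (cases "pop D")
    obtain as rs where p: "pops k (nabla D) = (as, rs)" by (cases "pops k (nabla D)")
    note m = main[OF D pop]
    obtain f where R: "nabla_relation (south_columns D) (south_columns (nabla D)) r a f" using m by blast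
    have I: "\<pi> \<circ> simple_transposition a \<in> S_infinity" "coxeter_length (\<pi> \<circ> simple_transposition a) = k"
      and comp: "(as, rs) \<in> compatible_sequences (\<pi> \<circ> simple_transposition a)"
      using IH[of a] m p unfolding bij_betw_def by (blast, blast, metis imageI)
    have ra: "1 \<le> r" "r \<le> a" using nabla_relation_le[OF R order_refl] R unfolding nabla_relation_def by auto
    have "r \<le> hd rs \<and> (a < hd as \<longrightarrow> r < hd rs)" if as: "as \<noteq> []"
    proof -
      have k: "k \<noteq> 0" using p as by (cases k) (auto simp: pops_def)
      have "\<pi> \<circ> simple_transposition a \<noteq> id" using coxeter_length_eq_0_iff[OF I(1)] I(2) k by metis
      then have ne: "blank_cells (nabla D) \<noteq> {}" using blank_cells_empty_iff[OF I(1)] m by blast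
      obtain a' r' where pop': "pop (nabla D) = (a', r')" by (cases "pop (nabla D)")
      obtain f' where R': "nabla_relation (south_columns (nabla D)) (south_columns (nabla (nabla D))) r' a' f'"
        using nabla_correct(1)[OF _ ne pop'] m by blast
      have "r \<le> r' \<and> (r = r' \<longrightarrow> a' < a)" using nabla_relation_compatible[OF R R'] by blast
      moreover have "hd as = a'" "hd rs = r'" using hd[OF p as] pop' by auto
      ultimately show ?thesis by auto
    qed
    then have "(a # as, r # rs) \<in> compatible_sequences \<pi>"
      unfolding compatible_Cons using S m comp ra by blast
    then show ?thesis unfolding pops_Suc pop p by simp
  qed
  have "bij_betw (pops (Suc k)) (BPD \<pi>) (compatible_sequences \<pi>)"
  proof (rule bij_betwI')
    fix D1 D2 assume D: "D1 \<in> BPD \<pi>" "D2 \<in> BPD \<pi>"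
    show "pops (Suc k) D1 = pops (Suc k) D2 \<longleftrightarrow> D1 = D2"
    proof
      assume eq: "pops (Suc k) D1 = pops (Suc k) D2"
      obtain a r where pop1: "pop D1 = (a, r)" by (cases "pop D1")
      have pop2: "pop D2 = (a, r)" and eq': "pops k (nabla D1) = pops k (nabla D2)"
        using eq pop1 unfolding pops_Suc by (auto simp: prod_eq_iff)
      note m1 = main[OF D(1) pop1] and m2 = main[OF D(2) pop2]
      have "inj_on (pops k) (BPD (\<pi> \<circ> simple_transposition a))" using IH[of a] m1 unfolding bij_betw_def by blast
      then have n: "nabla D1 = nabla D2" using eq' m1 m2 unfolding inj_on_def by blast
      obtain f1 f2 where "nabla_relation (south_columns D1) (south_columns (nabla D1)) r a f1"
        "nabla_relation (south_columns D2) (south_columns (nabla D1)) r a f2" using m1 m2 n by metis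
      then have "south_columns D1 i = south_columns D2 i" for i by (rule nabla_relation_inj)
      then show "D1 = D2" by (rule BPD_eqI[OF D])
    qed simp
  next
    fix D assume "D \<in> BPD \<pi>"
    then show "pops (Suc k) D \<in> compatible_sequences \<pi>" by (rule into)
  next
    fix ar assume ar: "ar \<in> compatible_sequences \<pi>"
    then obtain bs ts where bt: "ar = (bs, ts)" "reduced_word bs \<pi>" "length ts = length bs"
      unfolding compatible_sequences_def by auto
    have "length bs = Suc k" using bt(2) Suc.prems(2) unfolding reduced_word_def by simp
    then obtain a as r rs where e: "bs = a # as" "ts = r # rs" using bt(3) by (metis length_Suc_conv)
    have c: "1 \<le> a" "\<pi> (Suc a) < \<pi> a" "(as, rs) \<in> compatible_sequences (\<pi> \<circ> simple_transposition a)"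
      "1 \<le> r" "r \<le> a" "as \<noteq> [] \<longrightarrow> r \<le> hd rs \<and> (a < hd as \<longrightarrow> r < hd rs)"
      using ar unfolding bt e compatible_Cons by auto
    let ?\<pi>' = "\<pi> \<circ> simple_transposition a"
    have I: "?\<pi>' \<in> S_infinity" "coxeter_length ?\<pi>' = k"
      "bij_betw (pops k) (BPD ?\<pi>') (compatible_sequences ?\<pi>')" using IH[OF c(1,2)] by auto
    obtain D' where D': "D' \<in> BPD ?\<pi>'" "pops k D' = (as, rs)"
      using I(3) c(3) unfolding bij_betw_def by (metis imageE)
    have asc: "?\<pi>' a < ?\<pi>' (Suc a)" using c(2) by (simp add: simple_transposition_def)
    have twice: "?\<pi>' \<circ> simple_transposition a = \<pi>" by (simp only: comp_assoc simple_transposition_involution comp_id)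
    have "r \<le> snd (pop D') \<and> (r = snd (pop D') \<longrightarrow> fst (pop D') < a)" if ne: "blank_cells D' \<noteq> {}"
    proof -
      have "?\<pi>' \<noteq> id" using blank_cells_empty_iff[OF I(1) D'(1)] ne by blast
      then have "k \<noteq> 0" using coxeter_length_eq_0_iff[OF I(1)] I(2) by auto
      then have as: "as \<noteq> []" using D'(2) by (auto simp: pops_def)
      have h: "hd as = fst (pop D')" "hd rs = snd (pop D')" using hd[OF D'(2) as] by auto
      \<comment> \<open>\<open>a\<close> is an ascent and the next letter a descent of the same
        permutation, so they differ and the weak inequality between them becomes strict.\<close>
      have "?\<pi>' (Suc (fst (pop D'))) < ?\<pi>' (fst (pop D'))"
        using nabla_correct(3)[OF D'(1) ne, of "fst (pop D')" "snd (pop D')"] by simp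
      then have "fst (pop D') \<noteq> a" using asc by auto
      then show ?thesis using c(6) as h by auto
    qed
    then obtain D where D: "D \<in> BPD \<pi>" "pop D = (a, r)" "nabla D = D'"
      using nabla_surjective[OF D'(1) c(1) asc c(4,5)] unfolding twice by blast
    have "ar = pops (Suc k) D" unfolding pops_Suc D(2,3) D'(2) bt e by simp
    then show "\<exists>D\<in>BPD \<pi>. ar = pops (Suc k) D" using D(1) by blast
  qed
  moreover have "blank_rows D = mset (snd (pops (Suc k) D))" if D: "D \<in> BPD \<pi>" for D
  proof -
    obtain a r where pop: "pop D = (a, r)" by (cases "pop D")
    note m = main[OF D pop]
    then have "blank_rows (nabla D) = mset (snd (pops k (nabla D)))" using IH[of a] by blast
    then show ?thesis using m unfolding pops_Suc pop by simp
  qed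
  ultimately show ?case by blast
qed

lemma bpd_weight_eq: "bpd_weight D = prod_mset (image_mset var (blank_rows D))"
  unfolding bpd_weight_def blank_rows_def prod_unfold_prod_mset
  by (simp add: multiset.map_comp comp_def case_prod_unfold)

theorem theorem3p6:
  fixes \<pi> :: "nat \<Rightarrow> nat"
  assumes "\<pi> \<in> S_infinity"
  shows "bij_betw (phi \<pi>) (BPD \<pi>) (compatible_sequences \<pi>)
    \<and> bij_betw pd_sequence (PD \<pi>) (compatible_sequences \<pi>)
    \<and> (\<forall>D\<in>BPD \<pi>. bpd_weight D = sequence_weight (phi \<pi> D))"
proof -
  have phi: "phi \<pi> = pops (coxeter_length \<pi>)" by (intro ext) (simp add: phi_def pops_def)
  note b = pops_bij[OF assms refl]
  have "bpd_weight D = sequence_weight (phi \<pi> D)" if "D \<in> BPD \<pi>" for D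
  proof -
    have "blank_rows D = mset (snd (phi \<pi> D))" using b that unfolding phi by blast
    then show ?thesis
      unfolding bpd_weight_eq sequence_weight_def by (simp flip: prod_mset_prod_list add: mset_map)
  qed
  then show ?thesis using b bij_pd_sequence[OF assms] unfolding phi by blast
qed

end
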